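(* Let $\Omega=[a_1,a_1+r_1)\cup[a_2,a_2+r_2)\cup[a_3,a_3+r_3)\subset\mathbb{R}$ with $a_1=0$, $r_j>0$, $r_1+r_2+r_3=1$ and $a_j+r_j<a_{j+1}$ for $j=1,2$. Suppose $\Omega$ is spectral with a spectrum $\Lambda$ normalized (by a translation) so that $0\in\Lambda$ and $d\mathbb{Z}\subseteq\Lambda$ for some positive integer $d$, and let $d$ be the smallest positive integer with $d\mathbb{Z}\subseteq\Lambda$. Assume that (a) $\Lambda$ is contained in a lattice $\theta\mathbb{Z}$, $\theta>0$; and (b) for all $\lambda_1,\lambda_2\in\Lambda$, the vector $v_{\lambda_1-\lambda_2}$ is of Type 1 if and only if $\lambda_1-\lambda_2\in d\mathbb{Z}$. Then $\Omega$ tiles $\mathbb{R}$ by translations.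
   Context: A set $\Lambda\subset\mathbb{R}$ is a spectrum for a measurable set $\Omega\subset\mathbb{R}$ of finite positive measure if the functions $e_\lambda(x)=|\Omega|^{-1/2}e^{2\pi i\lambda x}\chi_\Omega(x)$, $\lambda\in\Lambda$, form an orthonormal basis of $L^2(\Omega)$; $\Omega$ is spectral if it has a spectrum. Any translate of a spectrum is a spectrum. $\Omega$ tiles $\mathbb{R}$ by translations if there is a subset $\mathcal{T}\subset\mathbb{R}$ such that the translates $\{\Omega+t : t\in\mathcal{T}\}$ form a partition of $\mathbb{R}$ up to sets of measure zero. For $\lambda\in\mathbb{R}$ put $$v_\lambda=\big(e^{2\pi i\lambda(a_1+r_1)},-e^{2\pi i\lambda a_1},e^{2\pi i\lambda(a_2+r_2)},-e^{2\pi i\lambda a_2},e^{2\pi i\lambda(a_3+r_3)},-e^{2\pi i\lambda a_3}\big)\in\mathbb{C}^6.$$ A vector $(\alpha_1,\dots,\alpha_6)\in\mathbb{C}^6$ is of Type 1 if there is a permutation $\sigma$ of $\{1,\dots,6\}$ with $\alpha_{\sigma(1)}+\alpha_{\sigma(2)}=\alpha_{\sigma(3)}+\alpha_{\sigma(4)}=\alpha_{\sigma(5)}+\alpha_{\sigma(6)}=0$. *)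

theory Defs
  imports "HOL-Analysis.Analysis" "HOL-Combinatorics.Permutations"
begin

subsection \<open>Orthonormal bases of complex $L^2$ spaces\<close>

text \<open>Elements of $L^2(M)$ are represented by functions; equality almost everywhere is
  not quotiented out.\<close>

definition L2_fun :: "'a measure \<Rightarrow> ('a \<Rightarrow> complex) set" where
  "L2_fun M = {f \<in> borel_measurable M. integrable M (\<lambda>x. (cmod (f x))\<^sup>2)}"

definition L2_inner :: "'a measure \<Rightarrow> ('a \<Rightarrow> complex) \<Rightarrow> ('a \<Rightarrow> complex) \<Rightarrow> complex" where
  "L2_inner M f g = (LINT x|M. f x * cnj (g x))"

definition L2_norm :: "'a measure \<Rightarrow> ('a \<Rightarrow> complex) \<Rightarrow> real" where
  "L2_norm M f = sqrt (LINT x|M. (cmod (f x))\<^sup>2)"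

text \<open>An orthonormal family in $L^2(M)$ whose linear span is dense.\<close>

definition L2_orthonormal_basis :: "'a measure \<Rightarrow> 'i set \<Rightarrow> ('i \<Rightarrow> 'a \<Rightarrow> complex) \<Rightarrow> bool" where
  "L2_orthonormal_basis M I e \<longleftrightarrow>
     (\<forall>i\<in>I. e i \<in> L2_fun M) \<and>
     (\<forall>i\<in>I. \<forall>j\<in>I. L2_inner M (e i) (e j) = (if i = j then 1 else 0)) \<and>
     (\<forall>f\<in>L2_fun M. \<forall>\<epsilon>>0. \<exists>J c. finite J \<and> J \<subseteq> I \<and>
        L2_norm M (\<lambda>x. f x - (\<Sum>i\<in>J. c i * e i x)) < \<epsilon>)"

subsection \<open>Spectra and tilings\<close>

definition expo :: "real set \<Rightarrow> real \<Rightarrow> real \<Rightarrow> complex" where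
  "expo \<Omega> l x =
     complex_of_real (1 / sqrt (measure lebesgue \<Omega>)) *
     exp (2 * of_real pi * \<i> * of_real l * of_real x) * indicator \<Omega> x"

definition is_spectrum :: "real set \<Rightarrow> real set \<Rightarrow> bool" where
  "is_spectrum \<Omega> \<Lambda> \<longleftrightarrow>
     \<Omega> \<in> sets lebesgue \<and> 0 < emeasure lebesgue \<Omega> \<and> emeasure lebesgue \<Omega> < \<infinity> \<and>
     L2_orthonormal_basis (lebesgue_on \<Omega>) \<Lambda> (expo \<Omega>)"

definition tiles_by_translations :: "real set \<Rightarrow> bool" where
  "tiles_by_translations \<Omega> \<longleftrightarrow>
     (\<exists>T. (\<forall>s\<in>T. \<forall>t\<in>T. s \<noteq> t \<longrightarrow> negligible ((\<lambda>x. x + s) ` \<Omega> \<inter> (\<lambda>x. x + t) ` \<Omega>)) \<and>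
          negligible (- (\<Union>t\<in>T. (\<lambda>x. x + t) ` \<Omega>)))"

definition int_multiples :: "real \<Rightarrow> real set" where
  "int_multiples c = range (\<lambda>k::int. c * of_int k)"

subsection \<open>Endpoint vectors and vectors of Type 1\<close>

definition endpoint_vec :: "(nat \<Rightarrow> real) \<Rightarrow> (nat \<Rightarrow> real) \<Rightarrow> real \<Rightarrow> complex^6" where
  "endpoint_vec a r l =
     (let E = (\<lambda>x. exp (2 * of_real pi * \<i> * of_real l * of_real x))
      in vector [E (a 1 + r 1), - E (a 1), E (a 2 + r 2), - E (a 2), E (a 3 + r 3), - E (a 3)])"

text \<open>In the index type \<open>6\<close> the numeral \<open>6\<close> denotes the same element as \<open>0\<close>; the elements
  \<open>1, \<dots>, 6\<close> are the six distinct indices.\<close>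

definition Type1 :: "complex^6 \<Rightarrow> bool" where
  "Type1 \<alpha> \<longleftrightarrow> (\<exists>\<sigma>. \<sigma> permutes (UNIV :: 6 set) \<and>
     \<alpha> $ \<sigma> 1 + \<alpha> $ \<sigma> 2 = 0 \<and> \<alpha> $ \<sigma> 3 + \<alpha> $ \<sigma> 4 = 0 \<and> \<alpha> $ \<sigma> 5 + \<alpha> $ \<sigma> 6 = 0)"

end

theory Submission
  imports Defs
begin

text \<open>Write $e(x) = e^{2\pi i x}$, let $c_p$ run through the six endpoints of the intervals, with sign
$\varepsilon_p = 1$ at right and $-1$ at left endpoints, so that $v_\lambda = (\varepsilon_p\, e(\lambda c_p))_p$.
Integrating $e((\lambda-\mu)x)$ over the intervals, orthogonality says that $v_{\lambda-\mu}$ has coordinate sum $0$ for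
all $\lambda,\mu$ in the spectrum (lemma \<open>sum_V\<close>). Completeness is used in one form only
(lemma \<open>step_function_null\<close>): a step function on disjoint translates of one interval that lie in $\Omega$
and whose weights are orthogonal to all $e(\lambda h)$ vanishes.

Because $d\mathbb{Z}\subseteq\Lambda$, the coordinate sums of $v_{\lambda+dk}$ vanish for every $k$, and by a Vandermonde argument
the coordinates with a common value of $e(d c_p)$ sum to $0$ separately. Each such class has as many right as left
endpoints (take $\lambda = 0$), hence an even number of elements, and two or four unimodular numbers with sum $0$ consist of
antipodal pairs. So if the endpoints are not all congruent modulo $1/d$, every $v_\lambda$ is of Type 1, which forces
$\Lambda = d\mathbb{Z}$. In that case completeness shows that the translates of $\Omega$ by $\frac1d\mathbb{Z}$ are disjoint;
as $|\Omega| = 1$ this gives $d = 1$ and a tiling by $\mathbb{Z}$ (lemma \<open>lattice_spectrum_tiles\<close>).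

Otherwise all $d c_p$ are integers, and since $\Lambda$ lies in a lattice the coordinates of $v_\lambda$ are roots of unity.
The main point is that $\Lambda$ then has at most three classes modulo $d\mathbb{Z}$, because four vectors cannot have all their
quotients of coordinate sum $0$ and not of Type 1 (lemma \<open>no_four_pairwise_admissible\<close>). This rests on the
classification of six roots of unity with sum $0$ (theorem \<open>classify\<close>): either there are three antipodal pairs, or
two triples that are rotated sets of cube roots of unity, or the six numbers are a rotation of
$\zeta,\zeta^2,\zeta^3,\zeta^4,-\omega,-\omega^2$ with primitive fifth and cube roots of unity
$\zeta$ and $\omega$. Comparing how these patterns can multiply in a
triangle of three vectors leaves few possibilities, and none for four vectors.

With at most three classes, four disjoint cells of length $1/d$ inside $\Omega$ would carry a non-zero step function orthogonal to
all exponentials. Hence every interval is a single cell, so all lengths are $1/3$ and $d = 3$. A $\lambda \in \Lambda$ outside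
$3\mathbb{Z}$ satisfies $1 + e(\lambda a_2) + e(\lambda a_3) = 0$, which says that $\{0, 3a_2, 3a_3\}$ is $3^k$ times a complete residue
system modulo $3$, and such a set of unit cells tiles (lemma \<open>three_cells_tile\<close>).\<close>

section \<open>Galois conjugates of vanishing sums of roots of unity\<close>

definition ipoly :: "int poly \<Rightarrow> complex \<Rightarrow> complex" where
  "ipoly f z = poly (map_poly of_int f) z"

lemma ipoly_0 [simp]: "ipoly 0 z = 0"
  by (simp add: ipoly_def)

lemma ipoly_pCons [simp]: "ipoly (pCons a f) z = of_int a + z * ipoly f z"
  by (cases "f = 0 \<and> a = 0") (auto simp: ipoly_def map_poly_pCons)

lemma ipoly_1 [simp]: "ipoly 1 z = 1"
  by (simp add: one_pCons)

lemma ipoly_add [simp]: "ipoly (f + g) z = ipoly f z + ipoly g z"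
  by (induction f g rule: poly_induct2) (auto simp: algebra_simps)

lemma ipoly_smult [simp]: "ipoly (smult a f) z = of_int a * ipoly f z"
  by (induction f) (auto simp: algebra_simps)

lemma ipoly_mult [simp]: "ipoly (f * g) z = ipoly f z * ipoly g z"
  by (induction f) (auto simp: algebra_simps)

lemma ipoly_uminus [simp]: "ipoly (- f) z = - ipoly f z"
  using ipoly_smult[of "-1" f z] by simp

lemma ipoly_diff [simp]: "ipoly (f - g) z = ipoly f z - ipoly g z"
  using ipoly_add[of f "- g" z] by simp

lemma ipoly_monom [simp]: "ipoly (monom a n) z = of_int a * z ^ n"
  by (induction n) (auto simp: monom_0 monom_Suc algebra_simps)

lemma ipoly_power [simp]: "ipoly (f ^ n) z = ipoly f z ^ n"
  by (induction n) auto

lemma ipoly_sum [simp]: "ipoly (sum f A) z = (\<Sum>i\<in>A. ipoly (f i) z)"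
  by (induction A rule: infinite_finite_induct) auto

text \<open>The inner binomial coefficients of a prime exponent are divisible by that prime.\<close>

lemma prime_dvd_power_add_minus:
  fixes a b :: "'a::comm_ring_1"
  assumes "prime p"
  shows "of_nat p dvd (a + b) ^ p - a ^ p - b ^ p"
proof -
  have p: "p > 0" using assms prime_gt_0_nat by blast
  have "(a + b) ^ p = (\<Sum>k\<le>p. of_nat (p choose k) * a ^ k * b ^ (p - k))"
    by (rule binomial_ring)
  also have "{..p} = insert 0 (insert p {1..<p})" using p by auto
  also have "(\<Sum>k\<in>\<dots>. of_nat (p choose k) * a ^ k * b ^ (p - k)) =
     b ^ p + a ^ p + (\<Sum>k\<in>{1..<p}. of_nat (p choose k) * a ^ k * b ^ (p - k))"
    using p by (simp add: algebra_simps)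
  finally have "(a + b) ^ p - a ^ p - b ^ p = (\<Sum>k\<in>{1..<p}. of_nat (p choose k) * a ^ k * b ^ (p - k))"
    by simp
  also have "of_nat p dvd \<dots>"
  proof (rule dvd_sum)
    fix k assume "k \<in> {1..<p}"
    then have "p dvd p choose k" by (intro dvd_choose_prime) (use assms in auto)
    then have "(of_nat p :: 'a) dvd of_nat (p choose k)" by (auto simp: dvd_def)
    then show "(of_nat p :: 'a) dvd of_nat (p choose k) * a ^ k * b ^ (p - k)"
      by (simp add: mult.assoc)
  qed
  finally show ?thesis .
qed

lemma prime_dvd_int_power_minus:
  fixes a :: int
  assumes "prime p"
  shows "int p dvd a ^ p - a"
proof -
  have p: "p > 0" using assms prime_gt_0_nat by blast
  have step: "int p dvd (b + 1) ^ p - (b + 1) \<longleftrightarrow> int p dvd b ^ p - b" for b :: int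
  proof -
    have "int p dvd (b + 1) ^ p - b ^ p - 1"
      using prime_dvd_power_add_minus[OF assms, of b 1] by simp
    then have "int p dvd ((b + 1) ^ p - b ^ p - 1) + (b ^ p - b) \<longleftrightarrow> int p dvd b ^ p - b"
      by (rule dvd_add_right_iff)
    then show ?thesis by (simp add: algebra_simps)
  qed
  show ?thesis
  proof (induction a rule: int_induct[where k = 0])
    case base
    then show ?case using p by (simp add: zero_power)
  next
    case (step1 i)
    then show ?case using step[of i] by simp
  next
    case (step2 i)
    then show ?case using step[of "i - 1"] by simp
  qed
qed

text \<open>The Frobenius map in characteristic zero: $f(X^p)$ and $f(X)^p$ differ by $p$ times an integer polynomial.
It is stated for values, which is how it is applied.\<close>

lemma ipoly_frobenius:
  assumes "prime p"
  shows "\<exists>e. \<forall>z. ipoly f (z ^ p) = ipoly f z ^ p + of_nat p * ipoly e z"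
proof (induction f)
  case 0
  have "p > 0" using assms prime_gt_0_nat by blast
  then show ?case by (intro exI[of _ 0]) (simp add: zero_power)
next
  case (pCons a f)
  then obtain e where e: "\<And>z. ipoly f (z ^ p) = ipoly f z ^ p + of_nat p * ipoly e z" by blast
  obtain b where b: "a ^ p - a = int p * b"
    using prime_dvd_int_power_minus[OF assms] by (auto simp: dvd_def)
  obtain c where c: "([:a:] + pCons 0 f) ^ p - [:a:] ^ p - pCons 0 f ^ p = of_nat p * c"
    using prime_dvd_power_add_minus[OF assms, of "[:a:]" "pCons 0 f"] by (auto simp: dvd_def)
  show ?case
  proof (intro exI allI)
    fix z
    have "ipoly (([:a:] + pCons 0 f) ^ p - [:a:] ^ p - pCons 0 f ^ p) z = ipoly (of_nat p * c) z"
      by (simp only: c)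
    then have 1: "(of_int a + z * ipoly f z) ^ p - of_int a ^ p - (z * ipoly f z) ^ p = of_nat p * ipoly c z"
      by (simp add: of_nat_poly)
    have "of_int (a ^ p - a) = (of_int (int p * b) :: complex)" by (simp only: b)
    then have 2: "of_int a ^ p - of_int a = (of_nat p * of_int b :: complex)" by simp
    have "ipoly (pCons a f) (z ^ p) = of_int a + z ^ p * (ipoly f z ^ p + of_nat p * ipoly e z)"
      by (simp add: e)
    also have "\<dots> = (of_int a + z * ipoly f z) ^ p - of_nat p * ipoly c z - of_nat p * of_int b + of_nat p * (z ^ p * ipoly e z)"
      using 1 2 by (simp add: algebra_simps power_mult_distrib)
    also have "\<dots> = ipoly (pCons a f) z ^ p + of_nat p * ipoly (monom 1 p * e - c - [:b:]) z"
      by (simp add: algebra_simps)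
    finally show "ipoly (pCons a f) (z ^ p) = ipoly (pCons a f) z ^ p + of_nat p * ipoly (monom 1 p * e - c - [:b:]) z" .
  qed
qed

text \<open>Gauss's lemma for the minimal polynomial of $\eta$. Pseudo-division by a primitive integer polynomial of least
degree leaves no remainder; comparing contents turns divisibility up to an integer factor into divisibility, and the leading
coefficient is then a unit because that of $P$ is.\<close>

lemma monic_minimal_ipoly:
  assumes "lead_coeff P = 1" "ipoly P \<eta> = 0" "P \<noteq> 0" and cP: "content (P :: int poly) = 1"
  obtains m where "lead_coeff m = 1" "ipoly m \<eta> = 0" "m dvd P"
    "\<And>q. ipoly q \<eta> = 0 \<Longrightarrow> degree q < degree m \<Longrightarrow> q = 0"
proof -
  define n where "n = (LEAST n. \<exists>q. q \<noteq> 0 \<and> ipoly q \<eta> = 0 \<and> degree q = n)"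
  have "\<exists>n. \<exists>q. q \<noteq> 0 \<and> ipoly q \<eta> = 0 \<and> degree q = n" using assms by blast
  then have "\<exists>q. q \<noteq> 0 \<and> ipoly q \<eta> = 0 \<and> degree q = n" unfolding n_def by (rule LeastI_ex)
  then obtain q0 where q0: "q0 \<noteq> 0" "ipoly q0 \<eta> = 0" "degree q0 = n" by blast
  have minn: "q = 0" if "ipoly q \<eta> = 0" "degree q < n" for q
    using that not_less_Least[of "degree q" "\<lambda>n. \<exists>q. q \<noteq> 0 \<and> ipoly q \<eta> = 0 \<and> degree q = n"]
    unfolding n_def by blast
  define m0 where "m0 = primitive_part q0"
  have m0: "content m0 = 1" "m0 \<noteq> 0" using q0 by (auto simp: m0_def)
  have deg: "degree m0 = n" by (simp add: m0_def q0)
  have root: "ipoly m0 \<eta> = 0"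
  proof -
    have "of_int (content q0) * ipoly m0 \<eta> = 0"
      using q0(2) content_times_primitive_part[of q0] unfolding m0_def by (metis ipoly_smult)
    then show ?thesis using q0 by simp
  qed
  obtain a q where aq: "a \<noteq> 0" "smult a P = m0 * q + pseudo_mod P m0"
    and r: "pseudo_mod P m0 = 0 \<or> degree (pseudo_mod P m0) < degree m0"
    using pseudo_mod[OF m0(2), of P] by blast
  have "ipoly (pseudo_mod P m0) \<eta> = 0"
    using arg_cong[OF aq(2), of "\<lambda>f. ipoly f \<eta>"] assms root by simp
  then have "pseudo_mod P m0 = 0" using r minn deg by metis
  then have eq: "smult a P = m0 * q" using aq by simp
  have "content q = normalize a"
    using arg_cong[OF eq, of content] m0 cP by (simp add: content_mult)
  then have "[:a:] dvd q" by (simp add: const_poly_dvd_iff_dvd_content)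
  then obtain q' where "q = smult a q'" by (auto simp: dvd_def)
  then have "smult a P = smult a (m0 * q')" using eq by simp
  then have eq': "P = m0 * q'" using aq(1) by (simp add: smult_cancel)
  then have "lead_coeff m0 * lead_coeff q' = 1" using assms by (simp add: lead_coeff_mult)
  then have lc: "lead_coeff m0 = 1 \<or> lead_coeff m0 = -1" using zmult_eq_1_iff by blast
  define m where "m = smult (lead_coeff m0) m0"
  show ?thesis
  proof (rule that)
    show "lead_coeff m = 1" using lc by (auto simp: m_def)
    show "ipoly m \<eta> = 0" using root by (simp add: m_def)
    show "m dvd P" using lc eq' by (auto simp: m_def)
    show "q = 0" if "ipoly q \<eta> = 0" "degree q < degree m" for q
      using that minn lc deg by (auto simp: m_def)
  qed
qed

text \<open>The core of the irreducibility of cyclotomic polynomials, arranged so that no reduction modulo $p$ is needed.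
Let $m$ be the minimal polynomial of $\eta$ and $X^N - 1 = m g$. If $m(\eta^p) \neq 0$ then $g(\eta^p) = 0$, and differentiating
at $\eta^p$ gives $N \eta^{-p} = m(\eta^p)\, g'(\eta^p)$. By the Frobenius congruence $m(\eta^p) \in p\,\mathbb{Z}[\eta]$, so
$N \in p\,\mathbb{Z}[\eta]$; as the powers of $\eta$ below the degree of $m$ are independent, $p$ divides $N$.\<close>

lemma ipoly_root_power_prime:
  assumes \<eta>: "\<eta> ^ N = 1" and N: "N > 0" and p: "prime p" "\<not> p dvd N" and q: "ipoly q \<eta> = 0"
  shows "ipoly q (\<eta> ^ p) = 0"
proof -
  define P :: "int poly" where "P = monom 1 N - 1"
  have cN: "coeff P N = 1" using N by (simp add: P_def)
  have dP: "degree P = N"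
  proof (rule antisym)
    show "degree P \<le> N" unfolding P_def
      by (rule degree_diff_le) (auto simp: degree_monom_le)
    show "N \<le> degree P" using cN by (intro le_degree) simp
  qed
  have P: "lead_coeff P = 1" using cN dP by simp
  have P0: "P \<noteq> 0" using P by auto
  have cP: "content P = 1"
    using content_dvd_coeff[of P N] cN by (simp add: is_unit_content_iff[symmetric] del: is_unit_content_iff)
  have rP: "ipoly P x = x ^ N - 1" for x by (simp add: P_def)
  obtain m where m: "lead_coeff m = 1" "ipoly m \<eta> = 0" "m dvd P"
    and minm: "\<And>q. ipoly q \<eta> = 0 \<Longrightarrow> degree q < degree m \<Longrightarrow> q = 0"
    using monic_minimal_ipoly[OF P _ P0 cP, of \<eta>] rP \<eta> by auto
  have m0: "m \<noteq> 0" using m by auto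
  have dm: "degree m > 0"
  proof (rule ccontr)
    assume "\<not> degree m > 0"
    then obtain c where c: "m = [:c:]" by (metis degree_eq_zeroE not_gr_zero)
    then show False using m by simp
  qed
  obtain g where g: "P = m * g" using m(3) by (auto simp: dvd_def)
  have reduce: "\<exists>h. ipoly h \<eta> = ipoly f \<eta> \<and> degree h < degree m \<and> m dvd f - h" for f
  proof -
    have "\<exists>h k. f = m * k + h \<and> (h = 0 \<or> degree h < degree m)"
      using pseudo_divmod[OF m0, of f "fst (pseudo_divmod f m)" "snd (pseudo_divmod f m)"] m(1)
      by auto
    then obtain h k where "f = m * k + h" "h = 0 \<or> degree h < degree m" by blast
    then show ?thesis using dm m by (intro exI[of _ h]) auto
  qed
  have mq: "m dvd q"
  proof -
    obtain h where h: "ipoly h \<eta> = ipoly q \<eta>" "degree h < degree m" "m dvd q - h"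
      using reduce by blast
    then have "h = 0" using minm[of h] q by simp
    then show ?thesis using h by simp
  qed
  have "ipoly m (\<eta> ^ p) = 0"
  proof (rule ccontr)
    assume nz: "ipoly m (\<eta> ^ p) \<noteq> 0"
    let ?\<xi> = "\<eta> ^ p"
    have "?\<xi> ^ N = 1" using \<eta> by (metis mult.commute power_mult power_one)
    then have "ipoly m ?\<xi> * ipoly g ?\<xi> = 0" using rP[of ?\<xi>] g by simp
    then have g0: "ipoly g ?\<xi> = 0" using nz by simp
    have dipoly: "ipoly (pderiv (f * h)) z = ipoly f z * ipoly (pderiv h) z + ipoly h z * ipoly (pderiv f) z" for f h z
      by (simp add: pderiv_mult)
    have "pderiv P = monom (int N) (N - 1)"
      by (simp add: P_def pderiv_diff pderiv_monom)
    then have 1: "of_nat N * ?\<xi> ^ (N - 1) = ipoly m ?\<xi> * ipoly (pderiv g) ?\<xi>"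
      using dipoly[of m g ?\<xi>] g g0 by simp
    obtain e where e: "\<And>z. ipoly m (z ^ p) = ipoly m z ^ p + of_nat p * ipoly e z"
      using ipoly_frobenius[OF p(1)] by blast
    have p0: "p > 0" using p prime_gt_0_nat by blast
    have 2: "ipoly m ?\<xi> = of_nat p * ipoly e \<eta>" using e[of \<eta>] m p0 by simp
    define E where "E = e * pcompose (pderiv g * monom 1 1) (monom 1 p)"
    have pc: "ipoly (pcompose f (monom 1 p)) z = ipoly f (z ^ p)" for f z
      by (induction f) (auto simp: pcompose_pCons)
    have "of_nat N * (?\<xi> ^ (N - 1) * ?\<xi>) = of_nat p * ipoly E \<eta>"
      using 1 2 by (simp add: E_def pc algebra_simps)
    moreover have "?\<xi> ^ (N - 1) * ?\<xi> = 1"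
      using N \<open>?\<xi> ^ N = 1\<close> by (metis power_minus_mult)
    ultimately have NE: "of_nat N = of_nat p * ipoly E \<eta>" by simp
    obtain h where h: "ipoly h \<eta> = ipoly E \<eta>" "degree h < degree m" using reduce by blast
    have "smult (int p) h - [:int N:] = 0"
    proof (rule minm)
      show "ipoly (smult (int p) h - [:int N:]) \<eta> = 0" using NE h by simp
      show "degree (smult (int p) h - [:int N:]) < degree m"
        using h dm by (intro degree_diff_less) auto
    qed
    then have "coeff (smult (int p) h - [:int N:]) 0 = 0" by simp
    then have "int N = int p * coeff h 0" by simp
    then have "int p dvd int N" by (rule dvdI)
    then show False using p by simp
  qed
  then show ?thesis using mq by (auto simp: dvd_def)
qed

lemma ipoly_root_power_coprime:
  assumes "\<eta> ^ N = 1" "N > 0" "coprime k N" "ipoly q \<eta> = 0"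
  shows "ipoly q (\<eta> ^ k) = 0"
  using assms
proof (induction k arbitrary: \<eta> rule: prime_divisors_induct)
  case zero
  then show ?case by simp
next
  case (unit x)
  then show ?case by simp
next
  case (factor p x)
  have "\<not> p dvd N" using factor.prems factor.hyps
    by (meson coprime_common_divisor dvd_triv_left not_prime_unit)
  then have "ipoly q (\<eta> ^ p) = 0" using ipoly_root_power_prime factor by blast
  moreover have "(\<eta> ^ p) ^ N = 1" using factor.prems by (metis mult.commute power_mult power_one)
  ultimately show ?case using factor.IH[of "\<eta> ^ p"] factor.prems by (auto simp: power_mult)
qed

text \<open>A vanishing sum of roots of unity remains one after applying a Galois conjugation. The relation is homogeneous,
so it suffices that the terms become roots of unity after a common rotation, that is, that their $N$-th powers agree.\<close>

theorem root_sum_power_coprime: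
  fixes z :: "'i \<Rightarrow> complex"
  assumes "finite I" and N: "N > 0" and z: "\<And>i j. i \<in> I \<Longrightarrow> j \<in> I \<Longrightarrow> z i ^ N = z j ^ N"
    and k: "coprime k N" "k > 0" and sum: "(\<Sum>i\<in>I. z i) = 0"
  shows "(\<Sum>i\<in>I. z i ^ k) = 0"
proof (cases "\<exists>j\<in>I. z j \<noteq> 0")
  case False
  then show ?thesis using k by (simp add: zero_power)
next
  case True
  then obtain j where j: "j \<in> I" "z j \<noteq> 0" by blast
  define \<zeta> where "\<zeta> = cis (2 * pi / real N)"
  have \<zeta>: "\<zeta> ^ N = 1" unfolding \<zeta>_def Complex.DeMoivre using N by simp
  have "\<exists>m. z i / z j = \<zeta> ^ m" if "i \<in> I" for i
  proof -
    have "(z i / z j) ^ N = 1" using z[OF that j(1)] j by (simp add: power_divide)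
    then obtain m where "z i / z j = cis (2 * pi * real m / real N)"
      using Complex.bij_betw_roots_unity[OF N] by (auto simp: bij_betw_def)
    then show ?thesis unfolding \<zeta>_def Complex.DeMoivre by (intro exI[of _ m]) (simp add: algebra_simps)
  qed
  then obtain m where m: "\<And>i. i \<in> I \<Longrightarrow> z i / z j = \<zeta> ^ m i" by metis
  define q :: "int poly" where "q = (\<Sum>i\<in>I. monom 1 (m i))"
  have "ipoly q \<zeta> = (\<Sum>i\<in>I. z i / z j)" using m by (simp add: q_def)
  also have "\<dots> = 0" using sum by (simp add: sum_divide_distrib[symmetric])
  finally have "ipoly q (\<zeta> ^ k) = 0" using ipoly_root_power_coprime[OF \<zeta> N k(1)] by blast
  moreover have "ipoly q (\<zeta> ^ k) = (\<Sum>i\<in>I. (z i / z j) ^ k)"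
    using m by (auto simp: q_def power_mult[symmetric] mult.commute intro!: sum.cong)
  moreover have "\<dots> = (\<Sum>i\<in>I. z i ^ k) / z j ^ k"
    by (simp add: power_divide sum_divide_distrib)
  ultimately show ?thesis using j by simp
qed

section \<open>Short vanishing sums of unimodular numbers\<close>

text \<open>Evaluating at a polynomial that vanishes at every value of $w$ except $c$ isolates the class of $c$.\<close>

lemma vandermonde_class_sum:
  fixes z w :: "'i \<Rightarrow> 'a::field"
  assumes fin: "finite I" and h: "\<And>j::nat. (\<Sum>i\<in>I. z i * w i ^ j) = 0"
  shows "(\<Sum>i\<in>{i\<in>I. w i = c}. z i) = 0"
proof -
  have poly0: "(\<Sum>i\<in>I. z i * poly p (w i)) = 0" for p
  proof -
    have "(\<Sum>i\<in>I. z i * poly p (w i)) = (\<Sum>i\<in>I. \<Sum>j\<le>degree p. coeff p j * (z i * w i ^ j))"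
      by (simp add: poly_altdef sum_distrib_left algebra_simps)
    also have "\<dots> = (\<Sum>j\<le>degree p. coeff p j * (\<Sum>i\<in>I. z i * w i ^ j))"
      by (subst sum.swap) (simp add: sum_distrib_left)
    finally show ?thesis using h by simp
  qed
  \<comment> \<open>up to a factor, the Lagrange polynomial of \<open>c\<close>\<close>
  define p where "p = (\<Prod>v\<in>w ` I - {c}. [:- v, 1:])"
  have pw: "poly p (w i) = (if w i = c then poly p c else 0)" if "i \<in> I" for i
    using that fin by (auto simp: p_def poly_prod)
  have pc: "poly p c \<noteq> 0" using fin by (auto simp: p_def poly_prod)
  have "0 = (\<Sum>i\<in>I. z i * poly p (w i))" using poly0 by simp
  also have "\<dots> = (\<Sum>i\<in>I. if w i = c then z i * poly p c else 0)"
    by (rule sum.cong) (auto simp: pw)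
  also have "\<dots> = (\<Sum>i\<in>{i\<in>I. w i = c}. z i) * poly p c"
    using fin by (simp add: sum.If_cases sum_distrib_right Int_def)
  finally show ?thesis using pc by simp
qed

lemma unimodular_cnj: "cmod z = 1 \<Longrightarrow> z * cnj z = 1"
  by (simp add: complex_norm_square[symmetric])

text \<open>Conjugation inverts unimodular numbers and so turns $a+b+c=0$ into $ab+bc+ca=0$: the three numbers are the roots of
$T^3 = abc$.\<close>

lemma unimodular_zero_sum_triple:
  assumes "cmod a = 1" "cmod b = 1" "cmod c = 1" and s: "a + b + c = 0"
  shows "a * a = b * c" "a ^ 3 = b ^ 3" "a \<noteq> b" "a\<^sup>2 + a * b + b\<^sup>2 = 0"
proof -
  have u: "a * cnj a = 1" "b * cnj b = 1" "c * cnj c = 1"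
    using assms unimodular_cnj by auto
  have "cnj a + cnj b + cnj c = 0" using s by (metis complex_cnj_add complex_cnj_zero)
  then have "a * b * c * (cnj a + cnj b + cnj c) = 0" by simp
  then have "(a * cnj a) * b * c + a * (b * cnj b) * c + a * b * (c * cnj c) = 0"
    by (simp add: algebra_simps)
  then have e2: "b * c + a * c + a * b = 0" by (simp only: u) simp
  have c: "c = - a - b" using s by (simp add: algebra_simps eq_neg_iff_add_eq_0)
  have "a\<^sup>2 + a * b + b\<^sup>2 = - (b * c + a * c + a * b)"
    unfolding c by (simp add: algebra_simps power2_eq_square)
  then show q: "a\<^sup>2 + a * b + b\<^sup>2 = 0" using e2 by simp
  have "a * a - b * c = a\<^sup>2 + a * b + b\<^sup>2"
    unfolding c by (simp add: algebra_simps power2_eq_square)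
  then show "a * a = b * c" using q by simp
  have "a ^ 3 - b ^ 3 = (a - b) * (a\<^sup>2 + a * b + b\<^sup>2)"
    by (simp add: power2_eq_square power3_eq_cube algebra_simps)
  then show "a ^ 3 = b ^ 3" using q by simp
  show "a \<noteq> b"
  proof
    assume "a = b"
    then have "3 * a\<^sup>2 = 0" using q by (simp add: power2_eq_square)
    then show False using assms by auto
  qed
qed

text \<open>With $d = -a-b-c$ the conjugate relation becomes $(a+b)(a+c)(b+c) = 0$.\<close>

lemma unimodular_zero_sum_quadruple:
  assumes "cmod a = 1" "cmod b = 1" "cmod c = 1" "cmod d = 1" and s: "a + b + c + d = 0"
  shows "a + b = 0 \<and> c + d = 0 \<or> a + c = 0 \<and> b + d = 0 \<or> a + d = 0 \<and> b + c = 0"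
proof -
  have u: "a * cnj a = 1" "b * cnj b = 1" "c * cnj c = 1" "d * cnj d = 1"
    using assms unimodular_cnj by auto
  have "cnj a + cnj b + cnj c + cnj d = 0" using s by (metis complex_cnj_add complex_cnj_zero)
  then have "a * b * c * d * (cnj a + cnj b + cnj c + cnj d) = 0" by simp
  then have "(a * cnj a) * b * c * d + a * (b * cnj b) * c * d + a * b * (c * cnj c) * d + a * b * c * (d * cnj d) = 0"
    by (simp add: algebra_simps)
  then have e3: "b * c * d + a * c * d + a * b * d + a * b * c = 0" by (simp only: u) simp
  have d: "d = - a - b - c" using s by (simp add: algebra_simps eq_neg_iff_add_eq_0)
  have "(a + b) * ((a + c) * (b + c)) = - (b * c * d + a * c * d + a * b * d + a * b * c)"
    unfolding d by (simp add: algebra_simps)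
  then have "(a + b) * ((a + c) * (b + c)) = 0" using e3 by simp
  then have "a + b = 0 \<or> a + c = 0 \<or> b + c = 0" by simp
  then show ?thesis unfolding d by (auto simp: algebra_simps add_eq_0_iff)
qed

text \<open>Vectors of Type 1, phrased without permutations.\<close>

definition antipodal :: "(6 \<Rightarrow> complex) \<Rightarrow> bool" where
  "antipodal z \<longleftrightarrow> (\<exists>a b c d e f. distinct [a, b, c, d, e, f] \<and>
     z a + z b = 0 \<and> z c + z d = 0 \<and> z e + z f = 0)"

definition two_triples :: "(6 \<Rightarrow> complex) \<Rightarrow> 6 set \<Rightarrow> bool" where
  "two_triples z P \<longleftrightarrow> card P = 3 \<and> sum z P = 0 \<and> sum z (- P) = 0"

text \<open>The shape of a rotation of $\zeta,\zeta^2,\zeta^3,\zeta^4,-\omega,-\omega^2$, where $\zeta$ and $\omega$ are primitive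
fifth and cube roots of unity; $E$ is the pair of positions of $-\omega$ and $-\omega^2$. The homomorphisms
$z \mapsto z^{15}, z^{10}, z^6$ separate the parts of order $2$, $3$ and $5$ of a 30th root of unity, and each condition records
part of what one of them sees.\<close>

definition pentagonal :: "(6 \<Rightarrow> complex) \<Rightarrow> 6 set \<Rightarrow> bool" where
  "pentagonal z E \<longleftrightarrow> card E = 2 \<and> (\<exists>K. \<forall>p. z p ^ 15 = (if p \<in> E then - K else K)) \<and>
     (\<exists>G. \<forall>p. p \<notin> E \<longrightarrow> z p ^ 10 = G) \<and>
     (\<forall>p q. z p ^ 6 = z q ^ 6 \<longleftrightarrow> p = q \<or> p \<in> E \<and> q \<in> E)"

lemma antipodalI:
  assumes "distinct [a, b, c, d, e, f]" "z a + z b = 0" "z c + z d = 0" "z e + z f = 0"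
  shows "antipodal z"
  using assms unfolding antipodal_def by blast

text \<open>The four remaining terms also have sum $0$ and split into antipodal pairs.\<close>

lemma antipodal_if_pair:
  assumes u: "\<And>p. cmod (z p) = 1" and s: "sum z UNIV = 0" and pq: "p \<noteq> q" "z p + z q = 0"
  shows "antipodal z"
proof -
  have "card (UNIV - {p, q}) = 4" using pq by (simp add: card_Diff_subset)
  then obtain a B where B: "UNIV - {p, q} = insert a B" "a \<notin> B" "card B = 3"
    using card_Suc_eq[of "UNIV - {p, q}" 3] by auto
  obtain b c d where "B = {b, c, d}" "b \<noteq> c" "b \<noteq> d" "c \<noteq> d"
    using B(3) by (auto simp: card_3_iff)
  then have A: "UNIV - {p, q} = {a, b, c, d}" and dist: "distinct [a, b, c, d]" using B by auto
  have "sum z UNIV = sum z {p, q} + sum z (UNIV - {p, q})"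
    by (metis add.commute finite_class.finite_UNIV subset_UNIV sum.subset_diff)
  then have "z a + z b + z c + z d = 0" using s pq A dist by (simp add: add.assoc)
  then have "z a + z b = 0 \<and> z c + z d = 0 \<or> z a + z c = 0 \<and> z b + z d = 0 \<or> z a + z d = 0 \<and> z b + z c = 0"
    by (intro unimodular_zero_sum_quadruple u)
  moreover have "p \<notin> {a, b, c, d}" "q \<notin> {a, b, c, d}" using A by auto
  ultimately show ?thesis
  proof (elim disjE)
    assume "z a + z b = 0 \<and> z c + z d = 0"
    then show ?thesis using dist pq \<open>p \<notin> _\<close> \<open>q \<notin> _\<close>
      by (intro antipodalI[of p q a b c d]) auto
  next
    assume "z a + z c = 0 \<and> z b + z d = 0"
    then show ?thesis using dist pq \<open>p \<notin> _\<close> \<open>q \<notin> _\<close>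
      by (intro antipodalI[of p q a c b d]) auto
  next
    assume "z a + z d = 0 \<and> z b + z c = 0"
    then show ?thesis using dist pq \<open>p \<notin> _\<close> \<open>q \<notin> _\<close>
      by (intro antipodalI[of p q a d b c]) auto
  qed
qed

lemma sum_Compl_zero:
  fixes z :: "6 \<Rightarrow> complex"
  assumes "sum z UNIV = 0" "sum z U = 0"
  shows "sum z (- U) = 0"
  using assms sum.subset_diff[of U UNIV z] by (simp add: Compl_eq_Diff_UNIV)

text \<open>A vanishing subsum has a vanishing complement, and one of the two has at most three terms; a single term cannot
vanish and two terms are an antipodal pair.\<close>

lemma zero_subsum:
  assumes u: "\<And>p. cmod (z p) = 1" and s: "sum z UNIV = 0" and U: "U \<noteq> {}" "U \<noteq> UNIV" "sum z U = 0"
  shows "antipodal z \<or> two_triples z U"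
proof -
  have small: "antipodal z" if V: "sum z V = 0" "card V = 1 \<or> card V = 2" for V
    using V(2)
  proof
    assume "card V = 1"
    then obtain p where "V = {p}" by (auto simp: card_1_singleton_iff)
    then show ?thesis using V u[of p] by simp
  next
    assume "card V = 2"
    then obtain p q where "V = {p, q}" "p \<noteq> q" by (auto simp: card_2_iff)
    then show ?thesis using V antipodal_if_pair[OF u s, of p q] by simp
  qed
  have "card U \<noteq> 0" using U by simp
  moreover have "card U < 6" using U psubset_card_mono[of UNIV U] by auto
  moreover have cc: "card (- U) = 6 - card U" by (simp add: Compl_eq_Diff_UNIV card_Diff_subset)
  moreover have s': "sum z (- U) = 0" using sum_Compl_zero s U by blast
  ultimately consider "card U = 1 \<or> card U = 2" | "card U = 3" | "card (- U) = 1 \<or> card (- U) = 2"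
    by linarith
  then show ?thesis
  proof cases
    case 2
    then show ?thesis using U s' by (simp add: two_triples_def)
  qed (use small U s' in blast)+
qed

section \<open>Vanishing sums of six roots of unity\<close>

lemma coprime_Suc_mult: "coprime (1 + j * M) (M :: nat)"
proof (rule coprimeI)
  fix c assume "c dvd 1 + j * M" "c dvd M"
  then show "is_unit c" using dvd_add_left_iff[of c "j * M" 1] by simp
qed

text \<open>If $q^2$ divides $N = qM$, then $1 + jM$ is coprime to $N$ for every $j$. The corresponding conjugations multiply $z_i$ by
$(z_i^M)^j$, so the terms with a common value of $z_i^M$ sum to $0$.\<close>

lemma class_sum_square:
  fixes z :: "'i \<Rightarrow> complex"
  assumes fin: "finite I" and q: "prime q" "q dvd M" "M > 0"
    and z: "\<And>i j. i \<in> I \<Longrightarrow> j \<in> I \<Longrightarrow> z i ^ (q * M) = z j ^ (q * M)" and s: "sum z I = 0"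
  shows "(\<Sum>i\<in>{i\<in>I. z i ^ M = c}. z i) = 0"
proof (rule vandermonde_class_sum[OF fin])
  fix j
  have "coprime (1 + j * M) (q * M)"
  proof -
    have "coprime (1 + j * M) M" by (rule coprime_Suc_mult)
    moreover from this have "coprime (1 + j * M) q" using coprime_divisors[OF dvd_refl q(2)] by blast
    ultimately show ?thesis by simp
  qed
  then have "(\<Sum>i\<in>I. z i ^ (1 + j * M)) = 0"
    using q(3) prime_gt_0_nat[OF q(1)]
    by (intro root_sum_power_coprime[OF fin _ _ _ _ s, of "q * M"] z) simp_all
  then show "(\<Sum>i\<in>I. z i * (z i ^ M) ^ j) = 0"
    by (simp add: power_mult[symmetric] mult.commute)
qed

text \<open>If $q$ divides $N = qM$ only once, the exponents $1 + iM$ are coprime to $N$ except for one residue $i = j$ modulo $q$.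
Thus the discrete Fourier transform over the $q$ classes of $z_i^M$ has at most one non-zero coefficient, and up to an explicit
rotation all class sums are equal. In particular, one empty class makes all of them vanish.\<close>

lemma class_sum_coprime:
  fixes z :: "'i \<Rightarrow> complex"
  assumes fin: "finite I" and q: "prime q" "\<not> q dvd M" "M > 0"
    and z: "\<And>i. i \<in> I \<Longrightarrow> z i ^ (q * M) = W" and W: "W \<noteq> 0" and s: "sum z I = 0"
  obtains C j where "q dvd 1 + j * M"
    "\<And>w. w ^ q = W \<Longrightarrow> w ^ j * (\<Sum>i\<in>{i\<in>I. z i ^ M = w}. z i) = C"
proof -
  have q0: "q > 0" using q prime_gt_0_nat by blast
  have "gcd M q = 1" using prime_imp_coprime[OF q(1,2)] by (simp add: coprime_commute flip: coprime_iff_gcd_eq_1)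
  then obtain x y where xy: "M * x = q * y + 1" using bezout_nat[of M q] q by auto
  \<comment> \<open>\<open>x\<close> inverts \<open>M\<close> modulo \<open>q\<close>, so \<open>j\<close> is minus that inverse\<close>
  obtain r where r: "q = Suc r" using q0 gr0_implies_Suc by blast
  define j where "j = x * r mod q"
  have "1 + x * r * M = 1 + r * (M * x)" by (simp add: algebra_simps)
  also have "\<dots> = q + r * (q * y)" unfolding xy by (simp add: r algebra_simps)
  also have "\<dots> = q * (1 + r * y)" by (simp add: algebra_simps)
  finally have "(1 + x * r * M) mod q = 0" by simp
  then have "(1 + j * M) mod q = 0" unfolding j_def by (metis mod_add_right_eq mod_mult_left_eq)
  then have j: "q dvd 1 + j * M" by auto
  have jq: "j < q" using q0 by (simp add: j_def)
  have uniq: "i = j" if "i < q" "q dvd 1 + i * M" for i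
  proof -
    have "int q dvd int (1 + i * M) - int (1 + j * M)"
      using that(2) j by (intro dvd_diff) (simp_all only: int_dvd_int_iff)
    then have "int q dvd (int i - int j) * int M" by (simp add: algebra_simps)
    then have "int q dvd int i - int j"
      using q by (auto simp: prime_dvd_mult_iff)
    then have "int i - int j = 0 \<or> int q \<le> \<bar>int i - int j\<bar>"
      using dvd_imp_le_int[of "int i - int j" "int q"] by auto
    then show ?thesis using that(1) jq by linarith
  qed
  define F where "F i = (\<Sum>k\<in>I. z k * (z k ^ M) ^ i)" for i
  have F0: "F i = 0" if "i < q" "i \<noteq> j" for i
  proof -
    have "\<not> q dvd 1 + i * M" using uniq that by blast
    then have "coprime (1 + i * M) q" using prime_imp_coprime[OF q(1)] coprime_commute by blast
    moreover have "coprime (1 + i * M) M" by (rule coprime_Suc_mult)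
    ultimately have "coprime (1 + i * M) (q * M)" by simp
    then have "(\<Sum>k\<in>I. z k ^ (1 + i * M)) = 0"
      using q(3) q0 by (intro root_sum_power_coprime[OF fin _ _ _ _ s, of "q * M"]) (simp_all add: z)
    then show ?thesis by (simp add: F_def power_mult[symmetric] mult.commute)
  qed
  show ?thesis
  proof (rule that[OF j])
    fix w assume w: "w ^ q = W"
    then have w0: "w \<noteq> 0" using W q0 by (auto simp: zero_power)
    have geo: "(\<Sum>i<q. (z k ^ M / w) ^ i) = (if z k ^ M = w then of_nat q else 0)" if "k \<in> I" for k
    proof (cases "z k ^ M = w")
      case True
      then show ?thesis using w0 by simp
    next
      case False
      then have "z k ^ M / w \<noteq> 1" using w0 by simp
      moreover have "(z k ^ M / w) ^ q = 1"
        using z[OF that] w W by (simp add: power_divide power_mult[symmetric] mult.commute)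
      ultimately show ?thesis using False by (simp add: sum_gp_strict)
    qed
    have "F j / w ^ j = (\<Sum>i<q. F i / w ^ i)"
      using jq F0 by (subst sum.remove[of _ j]) auto
    also have "\<dots> = (\<Sum>i<q. \<Sum>k\<in>I. z k * (z k ^ M / w) ^ i)"
      by (simp add: F_def sum_divide_distrib power_divide)
    also have "\<dots> = (\<Sum>k\<in>I. z k * (\<Sum>i<q. (z k ^ M / w) ^ i))"
      by (subst sum.swap) (simp add: sum_distrib_left)
    also have "\<dots> = (\<Sum>k\<in>I. if z k ^ M = w then z k * of_nat q else 0)"
      by (rule sum.cong) (auto simp: geo)
    also have "\<dots> = (\<Sum>k\<in>{k\<in>I. z k ^ M = w}. z k) * of_nat q"
      using fin by (simp add: sum.If_cases sum_distrib_right Int_def)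
    finally show "w ^ j * (\<Sum>k\<in>{k\<in>I. z k ^ M = w}. z k) = F j / of_nat q"
      using w0 q0 by (simp add: field_simps)
  qed
qed

lemma root_neq0:
  fixes w W :: complex
  assumes "w ^ q = W" "W \<noteq> 0" "q > 0"
  shows "w \<noteq> 0"
  using assms by (auto simp: zero_power)

text \<open>Five non-empty classes for six terms: four classes are singletons, and the fifth has two terms whose sum is unimodular,
so they are $-\omega D$ and $-\omega^2 D$ for the missing vertex $D$ of a regular pentagon.\<close>

lemma classify_pentagon:
  assumes u: "\<And>p. cmod (z p) = 1" and s: "sum z UNIV = 0"
    and M: "\<not> 5 dvd M" "M > 0" and W: "\<And>p. z p ^ (5 * M) = W"
    and j: "5 dvd 1 + j * M"
    and cls: "\<And>w. w ^ 5 = W \<Longrightarrow> w ^ j * (\<Sum>p\<in>{p. z p ^ M = w}. z p) = C" and C: "C \<noteq> 0"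
  shows "\<exists>E. pentagonal z E"
proof -
  define w where "w p = z p ^ M" for p
  have W0: "W \<noteq> 0" using W[of 1] u[of 1] by auto
  have w5: "w p ^ 5 = W" for p using W[of p] by (simp add: w_def power_mult[symmetric] mult.commute)
  have w0: "w p \<noteq> 0" for p using root_neq0[OF w5 W0] by simp
  have rng: "range w = {v. v ^ 5 = W}"
  proof
    show "range w \<subseteq> {v. v ^ 5 = W}" using w5 by auto
    show "{v. v ^ 5 = W} \<subseteq> range w"
    proof
      fix v assume "v \<in> {v. v ^ 5 = W}"
      then have "v ^ j * (\<Sum>p\<in>{p. z p ^ M = v}. z p) \<noteq> 0" using cls C by simp
      then have "{p. z p ^ M = v} \<noteq> {}" by force
      then show "v \<in> range w" by (auto simp: w_def)
    qed
  qed
  have c5: "card (range w) = 5" unfolding rng using W0 by (intro card_nth_roots) auto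
  have "\<not> inj w"
  proof
    assume "inj w"
    then have "card (range w) = card (UNIV :: 6 set)" by (rule card_image)
    then show False using c5 by simp
  qed
  then obtain p1 p2 where p12: "p1 \<noteq> p2" "w p1 = w p2" by (auto simp: inj_def)
  have "w ` (- {p1}) = range w"
  proof -
    have "w p1 \<in> w ` (- {p1})" using p12 by (intro image_eqI[of _ _ p2]) auto
    then show ?thesis by auto
  qed
  then have inj: "inj_on w (- {p1})"
    using c5 by (intro eq_card_imp_inj_on) (simp_all add: Compl_eq_Diff_UNIV card_Diff_subset)
  define E where "E = {p1, p2}"
  have weq: "w p = w q \<longleftrightarrow> p = q \<or> p \<in> E \<and> q \<in> E" for p q
  proof -
    have *: "w p1 = w q \<Longrightarrow> q \<in> E" for q
      using inj_onD[OF inj, of p2 q] p12 by (cases "q = p1") (auto simp: E_def)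
    then have **: "w q = w p1 \<Longrightarrow> q \<in> E" for q by metis
    show ?thesis
    proof (cases "p = p1 \<or> q = p1")
      case True
      then show ?thesis using *[of q] **[of p] p12 by (auto simp: E_def)
    next
      case False
      then show ?thesis using inj_onD[OF inj, of p q] p12 by (auto simp: E_def)
    qed
  qed
  have single: "w p ^ j * z p = C" if "p \<notin> E" for p
  proof -
    have "w q = w p \<longleftrightarrow> q = p" for q using weq[of q p] that by auto
    then have "{q. z q ^ M = w p} = {p}" by (auto simp: w_def)
    then show ?thesis using cls[OF w5[of p]] by simp
  qed
  have "{q. z q ^ M = w p1} = E"
  proof -
    have "w q = w p1 \<longleftrightarrow> q \<in> E" for q using weq[of q p1] by (auto simp: E_def)
    then show ?thesis by (auto simp: w_def)
  qed
  then have pair: "w p1 ^ j * (z p1 + z p2) = C" using cls[OF w5[of p1]] p12 by (simp add: E_def)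
  have unit_w: "cmod (w p) = 1" for p by (simp add: w_def norm_power u)
  obtain p0 where p0: "p0 \<notin> E"
  proof -
    have "card E < card (UNIV :: 6 set)" using p12 by (simp add: E_def)
    then show ?thesis using that by (metis UNIV_eq_I less_irrefl)
  qed
  have C1: "cmod C = 1" unfolding single[OF p0, symmetric] by (simp add: norm_mult norm_power unit_w u)
  \<comment> \<open>the vertex of the pentagon that the two terms in \<open>E\<close> replace\<close>
  define D where "D = C / w p1 ^ j"
  have D1: "cmod D = 1" by (simp add: D_def norm_divide norm_power C1 unit_w)
  have D0: "D \<noteq> 0" using D1 by auto
  have "z p1 + z p2 + (- D) = 0" using pair w0[of p1] by (simp add: D_def field_simps)
  from unimodular_zero_sum_triple[OF u u _ this] unimodular_zero_sum_triple(2)[of "z p2" "- D" "z p1"] this u D1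
  have z3: "z p1 ^ 3 = z p2 ^ 3" "z p2 ^ 3 = (- D) ^ 3" by (simp_all add: algebra_simps)
  then have zE: "z p ^ 3 = - (D ^ 3)" if "p \<in> E" for p using that by (auto simp: E_def)
  have "(w p1 ^ j) ^ 5 = W ^ j"
    unfolding w5[of p1, symmetric] by (metis mult.commute power_mult)
  moreover have "D * w p1 ^ j = C" using w0[of p1] by (simp add: D_def)
  ultimately have D5: "D ^ 5 * W ^ j = C ^ 5" by (metis power_mult_distrib)
  have z5: "z p ^ 5 = D ^ 5" if "p \<notin> E" for p
  proof -
    have "z p ^ 5 * W ^ j = C ^ 5"
      unfolding single[OF that, symmetric] w5[of p, symmetric]
      by (simp add: power_mult_distrib power_mult[symmetric] mult.commute)
    then show ?thesis using D5 W0 by (metis mult_cancel_right power_not_zero)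
  qed
  have z15: "z p ^ 15 = (z p ^ 3) ^ 5" "z p ^ 15 = (z p ^ 5) ^ 3" "z p ^ 10 = (z p ^ 5) ^ 2"
     "z p ^ 6 = (z p ^ 3) ^ 2" "z p ^ 6 = z p ^ 5 * z p" for p
    by (simp_all add: power_mult[symmetric] power_Suc2[symmetric] del: power_Suc2)
  have z6E: "z p ^ 6 = D ^ 5 * D" if "p \<in> E" for p
    using zE[OF that] by (simp add: z15(4)) (simp add: power2_eq_square power3_eq_cube eval_nat_numeral)
  have z6: "z p ^ 6 = D ^ 5 * z p" if "p \<notin> E" for p
    using z5[OF that] by (simp add: z15(5))
  have notD: "z p \<noteq> D" if "p \<notin> E" for p
  proof
    assume "z p = D"
    then have "w p ^ j * D = w p1 ^ j * D" using single[OF that] w0[of p1] by (simp add: D_def)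
    then have "w p ^ j = w p1 ^ j" using D0 by simp
    then have 1: "(w p / w p1) ^ j = 1" using w0[of p1] by (simp add: power_divide)
    have 5: "(w p / w p1) ^ 5 = 1" using w0[of p1] W0 by (simp add: power_divide w5)
    obtain k where "1 + j * M = 5 * k" using j by (auto simp: dvd_def)
    then have "(w p / w p1) ^ (1 + j * M) = 1" using 5 by (simp add: power_mult del: power_Suc)
    then have "w p / w p1 = 1" using 1 by (simp add: power_add power_mult)
    then have "w p = w p1" using w0[of p1] by simp
    then show False using weq[of p p1] that by (auto simp: E_def)
  qed
  have "pentagonal z E" unfolding pentagonal_def
  proof (intro conjI)
    show "card E = 2" using p12 by (simp add: E_def)
    show "\<exists>K. \<forall>p. z p ^ 15 = (if p \<in> E then - K else K)"
    proof (intro exI[of _ "D ^ 15"] allI)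
      fix p
      have "(- (D ^ 3)) ^ 5 = - (D ^ 15)" "(D ^ 5) ^ 3 = D ^ 15" by (simp_all add: power_mult[symmetric])
      then show "z p ^ 15 = (if p \<in> E then - (D ^ 15) else D ^ 15)"
        using zE[of p] z5[of p] z15(1,2)[of p] by metis
    qed
    show "\<exists>G. \<forall>p. p \<notin> E \<longrightarrow> z p ^ 10 = G"
      using z5 z15(3) by metis
    show "\<forall>p q. z p ^ 6 = z q ^ 6 \<longleftrightarrow> p = q \<or> p \<in> E \<and> q \<in> E"
    proof (intro allI)
      fix p q
      show "z p ^ 6 = z q ^ 6 \<longleftrightarrow> p = q \<or> p \<in> E \<and> q \<in> E"
      proof (cases "p \<in> E"; cases "q \<in> E")
        assume "p \<notin> E" "q \<notin> E"
        then have "z p ^ 6 = z q ^ 6 \<longleftrightarrow> z p = z q" using z6 D0 by simp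
        moreover have "z p = z q \<Longrightarrow> p = q" using weq[of p q] \<open>p \<notin> E\<close> by (auto simp: w_def)
        ultimately show ?thesis using \<open>p \<notin> E\<close> by auto
      qed (use z6 z6E D0 notD in auto)
    qed
  qed
  then show ?thesis by blast
qed

text \<open>Without an antipodal pair, terms with equal squares are equal. Hence each of the three classes of $z_p^2$ is constant,
and equality of the class sums up to rotation gives the classes the same size; one term from each class forms a vanishing triple.\<close>

lemma classify_hexagon:
  assumes u: "\<And>p. cmod (z p) = 1" and s: "sum z UNIV = 0" and z6: "\<And>p q. z p ^ 6 = z q ^ 6"
  shows "antipodal z \<or> (\<exists>P. two_triples z P)"
proof (cases "\<exists>p q. p \<noteq> q \<and> z p + z q = 0")
  case True
  then show ?thesis using antipodal_if_pair[OF u s] by blast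
next
  case False
  have z0: "z p \<noteq> 0" for p using u[of p] by auto
  then have nopair: "z p + z q \<noteq> 0" for p q using False by (cases "p = q") auto
  define W where "W = z 1 ^ 6"
  have W0: "W \<noteq> 0" using z0 by (simp add: W_def)
  have W: "z p ^ (3 * 2) = W" for p using z6[of p 1] by (simp add: W_def)
  obtain C j where j: "3 dvd 1 + j * (2::nat)"
    and cls: "\<And>w. w ^ 3 = W \<Longrightarrow> w ^ j * (\<Sum>p\<in>{p\<in>UNIV. z p ^ 2 = w}. z p) = C"
    by (rule class_sum_coprime[of UNIV 3 2 z W]) (use W W0 s in auto)
  have same: "z p = z q" if "z p ^ 2 = z q ^ 2" for p q
    using that nopair[of p q] by (auto simp: power2_eq_iff)
  define w where "w p = z p ^ 2" for p
  have w3: "w p ^ 3 = W" for p using W[of p] by (simp add: w_def power_mult[symmetric])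
  define n where "n v = card {p. w p = v}" for v
  have S: "(\<Sum>p\<in>{p. w p = w q}. z p) = of_nat (n (w q)) * z q" for q
  proof -
    have "(\<Sum>p\<in>{p. w p = w q}. z p) = (\<Sum>p\<in>{p. w p = w q}. z q)"
      by (rule sum.cong) (auto simp: w_def intro: same)
    then show ?thesis by (simp add: n_def)
  qed
  have cls': "v ^ j * (\<Sum>p\<in>{p. w p = v}. z p) = C" if "v ^ 3 = W" for v
    using cls[OF that] by (simp add: w_def)
  have unit_w: "cmod (w p) = 1" for p by (simp add: w_def norm_power u)
  have nC: "real (n (w q)) = cmod C" for q
    unfolding cls'[OF w3[of q], symmetric] S by (simp add: norm_mult norm_power unit_w u)
  have "n (w 1) \<noteq> 0" unfolding n_def by (auto simp: card_eq_0_iff)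
  then have C: "C \<noteq> 0" using nC[of 1] by auto
  have rng: "range w = {v. v ^ 3 = W}"
  proof
    show "range w \<subseteq> {v. v ^ 3 = W}" using w3 by auto
    show "{v. v ^ 3 = W} \<subseteq> range w"
    proof
      fix v assume "v \<in> {v. v ^ 3 = W}"
      then have "v ^ j * (\<Sum>p\<in>{p. w p = v}. z p) \<noteq> 0" using cls' C by simp
      then have "{p. w p = v} \<noteq> {}" by force
      then show "v \<in> range w" by auto
    qed
  qed
  have c3: "card (range w) = 3" unfolding rng using W0 by (intro card_nth_roots) auto
  define rep where "rep = inv w"
  have rep: "w (rep v) = v" if "v \<in> range w" for v using that by (simp add: rep_def f_inv_into_f)
  have injr: "inj_on rep (range w)" using rep by (metis inj_on_inverseI)
  have "0 = (\<Sum>v\<in>range w. \<Sum>p\<in>{p. w p = v}. z p)"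
    using sum.image_gen[of UNIV z w] s by simp
  also have "\<dots> = (\<Sum>v\<in>range w. of_real (cmod C) * z (rep v))"
  proof (rule sum.cong)
    fix v assume "v \<in> range w"
    then show "(\<Sum>p\<in>{p. w p = v}. z p) = of_real (cmod C) * z (rep v)"
      using S[of "rep v"] nC[of "rep v"] rep[of v] by (metis of_real_of_nat_eq)
  qed simp
  also have "\<dots> = of_real (cmod C) * (\<Sum>p\<in>rep ` range w. z p)"
    using injr by (simp add: sum.reindex sum_distrib_left)
  finally have "sum z (rep ` range w) = 0" using C by simp
  moreover have "card (rep ` range w) = 3" using injr c3 by (simp add: card_image)
  ultimately have "two_triples z (rep ` range w)" using sum_Compl_zero[OF s] by (simp add: two_triples_def)
  then show ?thesis by blast
qed

lemma dvd_6_if_squarefree: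
  fixes N :: nat
  assumes "N > 0" and sq: "\<And>q. prime q \<Longrightarrow> \<not> q * q dvd N" and le: "\<And>q. prime q \<Longrightarrow> q dvd N \<Longrightarrow> q < 5"
  shows "N dvd 6"
proof -
  have p23: "q = 2 \<or> q = 3" if "prime q" "q dvd N" for q
  proof -
    have "q \<noteq> 4" using primes_dvd_imp_eq[OF two_is_prime_nat that(1)] by auto
    moreover have "q < 5" "q \<ge> 2" using le that prime_ge_2_nat by auto
    ultimately show ?thesis by linarith
  qed
  show ?thesis
  proof (cases "N = 1")
    case False
    then obtain q M where q: "prime q" and N: "N = q * M"
      using prime_factor_nat[of N] by (auto simp: dvd_def)
    show ?thesis
    proof (cases "M = 1")
      case True
      then show ?thesis using p23[of q] q N by auto
    next
      case False
      then obtain r L where r: "prime r" and M: "M = r * L"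
        using prime_factor_nat[of M] by (auto simp: dvd_def)
      have "r \<noteq> q" using sq[OF q] by (auto simp: N M)
      then have qr: "q = 2 \<and> r = 3 \<or> q = 3 \<and> r = 2"
        using p23[of q] p23[of r] q r by (auto simp: N M)
      have "L = 1"
      proof (rule ccontr)
        assume "L \<noteq> 1"
        then obtain t K where t: "prime t" and L: "L = t * K"
          using prime_factor_nat[of L] by (auto simp: dvd_def)
        have "t = q \<or> t = r" using p23[of t] t qr by (auto simp: N M L)
        moreover have "N = (q * q) * (r * K)" if "t = q" using that by (simp add: N M L)
        moreover have "N = (r * r) * (q * K)" if "t = r" using that by (simp add: N M L)
        ultimately show False using sq[OF q] sq[OF r] by (metis dvd_triv_left)
      qed
      then show ?thesis using qr by (auto simp: N M)
    qed
  qed simp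
qed

text \<open>Descent on $N$. A prime $q$ with $q^2 \mid N$, or a prime $q \ge 7$ dividing $N$ once, makes the class sums of $z_p^{N/q}$
vanish; then either there is a proper vanishing subsum or all terms lie in one class and $N$ can be replaced by $N/q$. The
prime $5$ allows the pentagonal exception, and in the end $N$ divides $6$.\<close>

theorem classify:
  assumes "\<And>p. cmod (z p) = 1" "N > 0" "\<And>p q. z p ^ N = z q ^ N" "sum z UNIV = 0"
  shows "antipodal z \<or> (\<exists>P. two_triples z P) \<or> (\<exists>E. pentagonal z E)"
  using assms
proof (induction N rule: less_induct)
  case (less N)
  note u = less.prems(1) and N = less.prems(2) and zN = less.prems(3) and s = less.prems(4)
  have split: ?thesis if cls: "\<And>c. (\<Sum>p\<in>{p\<in>UNIV. z p ^ M = c}. z p) = 0" and M: "M < N" "M > 0" for M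
  proof (cases "\<forall>p. z p ^ M = z 1 ^ M")
    case True
    then show ?thesis using less.IH[OF M(1) u M(2) _ s] by metis
  next
    case False
    let ?U = "{p\<in>UNIV. z p ^ M = z 1 ^ M}"
    have "1 \<in> ?U" "?U \<noteq> UNIV" using False by auto
    then show ?thesis using zero_subsum[OF u s, of ?U] cls by blast
  qed
  have less: "M < N" "M > 0" if "N = q * M" "prime q" for q M :: nat
    using that N prime_gt_1_nat[of q] by auto
  consider (square) q where "prime q" "q * q dvd N" | (large) q where "prime q" "q dvd N" "\<not> q * q dvd N" "q \<ge> 5"
    | (six) "N dvd 6"
    using dvd_6_if_squarefree[OF N] not_less by blast
  then show ?case
  proof cases
    case square
    then obtain k where k: "N = q * (q * k)" by (auto simp: dvd_def mult.assoc)
    have M: "q * k < N" "q * k > 0" using less[OF k square(1)] by auto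
    show ?thesis
    proof (rule split[OF _ M])
      show "(\<Sum>p\<in>{p\<in>UNIV. z p ^ (q * k) = c}. z p) = 0" for c
        using M zN k square(1) by (intro class_sum_square[OF _ square(1) _ _ _ s]) auto
    qed
  next
    case large
    then obtain M where k: "N = q * M" by (auto simp: dvd_def)
    have M: "M < N" "M > 0" using less[OF k large(1)] by auto
    have nd: "\<not> q dvd M" using large(3) k by simp
    define W where "W = z 1 ^ N"
    have W0: "W \<noteq> 0" using u[of 1] by (auto simp: W_def)
    have W: "z p ^ (q * M) = W" for p using zN[of p 1] k by (simp add: W_def)
    obtain C j where j: "q dvd 1 + j * M"
      and cls: "\<And>w. w ^ q = W \<Longrightarrow> w ^ j * (\<Sum>p\<in>{p\<in>UNIV. z p ^ M = w}. z p) = C"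
      by (rule class_sum_coprime[OF _ large(1) nd M(2) W W0 s]) auto
    show ?thesis
    proof (cases "C = 0")
      case True
      show ?thesis
      proof (rule split[OF _ M])
        fix c
        show "(\<Sum>p\<in>{p\<in>UNIV. z p ^ M = c}. z p) = 0"
        proof (cases "c ^ q = W")
          case True
          then have "c \<noteq> 0" using W0 large(4) by (auto simp: zero_power)
          then show ?thesis using cls[OF True] \<open>C = 0\<close> by simp
        next
          case False
          then have "{p\<in>UNIV. z p ^ M = c} = {}" using W by (auto simp: power_mult[symmetric] mult.commute)
          then show ?thesis by (metis sum.empty)
        qed
      qed
    next
      case False
      have "{v. v ^ q = W} \<subseteq> range (\<lambda>p. z p ^ M)"
      proof
        fix v assume "v \<in> {v. v ^ q = W}"
        then have "v ^ j * (\<Sum>p\<in>{p\<in>UNIV. z p ^ M = v}. z p) \<noteq> 0" using cls False by simp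
        then have "{p\<in>UNIV. z p ^ M = v} \<noteq> {}" by force
        then show "v \<in> range (\<lambda>p. z p ^ M)" by auto
      qed
      then have "card {v. v ^ q = W} \<le> card (range (\<lambda>p. z p ^ M))" by (intro card_mono) auto
      also have "\<dots> \<le> card (UNIV :: 6 set)" by (rule card_image_le) simp
      finally have "q \<le> 6" using W0 large(4) by (simp add: card_nth_roots)
      moreover have "q \<noteq> 6" using primes_dvd_imp_eq[OF two_is_prime_nat large(1)] by auto
      ultimately have q5: "q = 5" using large(4) by simp
      show ?thesis
        using classify_pentagon[OF u s, of M W j C] nd M W j cls False unfolding q5 by auto
    qed
  next
    case six
    then obtain k where "6 = N * k" by (auto simp: dvd_def)
    then have "z p ^ 6 = z q ^ 6" for p q using zN[of p q] by (metis power_mult)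
    then show ?thesis using classify_hexagon[OF u s] by blast
  qed
qed

section \<open>Triangles of vanishing sums\<close>

text \<open>The sign of an endpoint: positions $1, 3, 5$ hold the right endpoints.\<close>

definition end_sign :: "6 \<Rightarrow> complex" where
  "end_sign p = (if p \<in> {1, 3, 5} then 1 else - 1)"

definition right_ends :: "6 set" where "right_ends = {1, 3, 5}"

text \<open>The condition on $v_{\lambda-\mu}$ for $\lambda, \mu \in \Lambda$ in different classes modulo $d\mathbb{Z}$.\<close>

definition admissible :: "(6 \<Rightarrow> complex) \<Rightarrow> bool" where
  "admissible z \<longleftrightarrow> (\<forall>p. cmod (z p) = 1) \<and> sum z UNIV = 0 \<and> \<not> antipodal z"

text \<open>A set $P$ stands for the splitting of the index set into the two blocks $P$ and $- P$.\<close>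

abbreviation same :: "'a set \<Rightarrow> 'a \<Rightarrow> 'a \<Rightarrow> bool" where
  "same P p q \<equiv> (p \<in> P \<longleftrightarrow> q \<in> P)"

lemma end_sign_right_ends: "end_sign p = (if p \<in> right_ends then 1 else - 1)"
  by (simp add: end_sign_def right_ends_def)

lemma end_sign_square [simp]: "end_sign p * end_sign p = 1" "end_sign p * (end_sign p * x) = x"
  by (simp_all add: end_sign_def)

lemma end_sign_neq0 [simp]: "end_sign p \<noteq> 0" by (simp add: end_sign_def)

lemma norm_end_sign [simp]: "cmod (end_sign p) = 1" by (simp add: end_sign_def)

lemma end_sign_power: "end_sign p ^ 6 = 1" "end_sign p ^ 10 = 1" "end_sign p ^ 15 = end_sign p" "end_sign p ^ 3 = end_sign p"
  by (simp_all add: end_sign_def)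

lemma card_right_ends: "card right_ends = 3" by (simp add: right_ends_def)

lemma card_Compl6: "card (- P) = 6 - card (P :: 6 set)"
  by (simp add: Compl_eq_Diff_UNIV card_Diff_subset)

lemma end_sign_neg: "end_sign p \<noteq> end_sign q \<longleftrightarrow> end_sign p = - end_sign q" "end_sign p \<noteq> end_sign q \<longleftrightarrow> \<not> same right_ends p q"
  by (auto simp: end_sign_right_ends)

lemma two_triples_Compl: "two_triples z P \<Longrightarrow> two_triples z (- P)"
  by (auto simp: two_triples_def card_Compl6)

lemma admissibleD:
  assumes "admissible z"
  shows "cmod (z p) = 1" "z p \<noteq> 0" "sum z UNIV = 0" "\<not> antipodal z"
  using assms by (auto simp: admissible_def) (metis norm_zero zero_neq_one)

lemma admissible_no_pair:
  assumes "admissible z" shows "z p + z q \<noteq> 0"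
proof (cases "p = q")
  case True
  then show ?thesis using admissibleD(2)[OF assms] by simp
next
  case False
  then show ?thesis using antipodal_if_pair[of z p q] admissibleD[OF assms] by blast
qed

lemma same_block_triple:
  assumes "two_triples z P" "same P p q" "p \<noteq> q"
  obtains r where "same P p r" "r \<noteq> p" "r \<noteq> q" "z p + z q + z r = 0"
proof -
  define B where "B = (if p \<in> P then P else - P)"
  have B: "card B = 3" "sum z B = 0" "p \<in> B" "q \<in> B" and same: "\<And>r. r \<in> B \<Longrightarrow> same P p r"
    using assms by (auto simp: B_def two_triples_def card_Compl6)
  have "card (B - {p, q}) = 1" using B assms by (simp add: card_Diff_subset)
  then obtain r where r: "B - {p, q} = {r}" by (auto simp: card_1_singleton_iff)
  then have "B = {p, q, r}" "r \<noteq> p" "r \<noteq> q" using B by auto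
  then show ?thesis using that[of r] B same assms by (auto simp: add.assoc)
qed

lemma two_triples_block:
  assumes "admissible z" "two_triples z P" "same P p q"
  shows "z p ^ 3 = z q ^ 3" "p \<noteq> q \<Longrightarrow> z p \<noteq> z q" "p \<noteq> q \<Longrightarrow> (z p)\<^sup>2 + z p * z q + (z q)\<^sup>2 = 0"
proof -
  have *: "z p ^ 3 = z q ^ 3 \<and> z p \<noteq> z q \<and> (z p)\<^sup>2 + z p * z q + (z q)\<^sup>2 = 0" if pq: "p \<noteq> q"
  proof -
    obtain r where "z p + z q + z r = 0" using same_block_triple[OF assms(2,3) pq] by blast
    then show ?thesis using unimodular_zero_sum_triple admissibleD[OF assms(1)] by metis
  qed
  show "z p ^ 3 = z q ^ 3" using * by (cases "p = q") auto
  show "p \<noteq> q \<Longrightarrow> z p \<noteq> z q" "p \<noteq> q \<Longrightarrow> (z p)\<^sup>2 + z p * z q + (z q)\<^sup>2 = 0" using * by auto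
qed

text \<open>Within a block the terms are $c, c\omega, c\omega^2$: sixth and fifteenth powers do not see $\omega$, and tenth powers
keep it.\<close>

lemma two_triples_block_power:
  assumes "admissible z" "two_triples z P" "same P p q"
  shows "z p ^ 6 = z q ^ 6" "z p ^ 15 = z q ^ 15"
    and "z p ^ 10 = z q ^ 10 \<Longrightarrow> p = q"
proof -
  have c: "z p ^ 3 = z q ^ 3" using two_triples_block(1)[OF assms] .
  have e: "x ^ 6 = (x ^ 3) ^ 2" "x ^ 15 = (x ^ 3) ^ 5" "x ^ 10 = (x ^ 3) ^ 3 * x" for x :: complex
    by (simp_all add: power_mult[symmetric] power_Suc2[symmetric] del: power_Suc2)
  show "z p ^ 6 = z q ^ 6" "z p ^ 15 = z q ^ 15" by (simp_all only: e c)
  assume "z p ^ 10 = z q ^ 10"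
  then have "z p = z q" using admissibleD(2)[OF assms(1)] by (simp add: e(3) c)
  then show "p = q" using two_triples_block(2)[OF assms] by blast
qed

text \<open>Two rotated copies of $1,\omega,\omega^2$ multiply termwise to a constant if their orientations are opposite, and to
another such copy if they agree.\<close>

lemma zero_sum_triple_product:
  assumes "cmod a = 1" "cmod b = 1" "cmod c = 1" "a + b + c = 0"
    and "cmod a' = 1" "cmod b' = 1" "cmod c' = 1" "a' + b' + c' = 0"
  shows "(a * a' = b * b' \<and> a * a' = c * c') \<or> a * a' + b * b' + c * c' = 0"
proof -
  define t t' where "t = b / a" and "t' = b' / a'"
  have nz: "a \<noteq> 0" "a' \<noteq> 0" using assms by auto
  have b: "b = t * a" "b' = t' * a'" using nz by (simp_all add: t_def t'_def)
  have "a\<^sup>2 + a * b + b\<^sup>2 = 0" "a'\<^sup>2 + a' * b' + b'\<^sup>2 = 0"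
    using unimodular_zero_sum_triple(4) assms by blast+
  then have "a\<^sup>2 * (t\<^sup>2 + t + 1) = 0" "a'\<^sup>2 * (t'\<^sup>2 + t' + 1) = 0"
    unfolding b by (simp_all add: algebra_simps power2_eq_square)
  then have t: "t\<^sup>2 + t + 1 = 0" "t'\<^sup>2 + t' + 1 = 0" using nz by auto
  have c: "c = (- 1 - t) * a" "c' = (- 1 - t') * a'"
    using assms(4,8) b by (simp_all add: algebra_simps eq_neg_iff_add_eq_0)
  have "(t - t') * (t + t' + 1) = (t\<^sup>2 + t + 1) - (t'\<^sup>2 + t' + 1)"
    by (simp add: algebra_simps power2_eq_square)
  then have "t = t' \<or> t + t' + 1 = 0" using t by simp
  then show ?thesis
  proof
    assume "t = t'"
    then have "a * a' + b * b' + c * c' = 2 * (a * a') * (t\<^sup>2 + t + 1)"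
      unfolding b c by (simp add: algebra_simps power2_eq_square)
    then show ?thesis using t by simp
  next
    assume "t + t' + 1 = 0"
    then have t': "t' = - 1 - t" by (simp add: algebra_simps eq_neg_iff_add_eq_0)
    have "b * b' - a * a' = - (a * a') * (t\<^sup>2 + t + 1)" "c * c' - a * a' = - (a * a') * (t\<^sup>2 + t + 1)"
      unfolding b c t' by (simp_all add: algebra_simps power2_eq_square)
    then show ?thesis using t by simp
  qed
qed

lemma block_product:
  assumes "admissible u" "admissible v" "two_triples u P" "two_triples v P"
  shows "(\<forall>p\<in>P. \<forall>q\<in>P. u p * v p = u q * v q) \<or> (\<Sum>p\<in>P. u p * v p) = 0"
proof -
  obtain a b c where P: "P = {a, b, c}" "a \<noteq> b" "a \<noteq> c" "b \<noteq> c"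
    using assms(3) by (auto simp: two_triples_def card_3_iff)
  have "u a + u b + u c = 0" "v a + v b + v c = 0"
    using assms(3,4) P by (auto simp: two_triples_def add.assoc)
  then have "(u a * v a = u b * v b \<and> u a * v a = u c * v c) \<or> u a * v a + u b * v b + u c * v c = 0"
    using admissibleD[OF assms(1)] admissibleD[OF assms(2)] by (intro zero_sum_triple_product) auto
  then show ?thesis using P by (auto simp: add.assoc)
qed

text \<open>Equality in the triangle inequality.\<close>

lemma unimodular_sum_eq_3:
  assumes "cmod a = 1" "cmod b = 1" "cmod c = 1" "cmod k = 1" "a + b + c = 3 * k"
  shows "a = k"
proof -
  have "3 * k - a = b + c" using assms(5) by (simp add: algebra_simps)
  then have le: "cmod (3 * k - a) \<le> 2" using norm_triangle_ineq[of b c] assms by simp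
  have sq: "Re x * Re x + Im x * Im x = 1" if "cmod x = 1" for x
    using that by (metis cmod_power2 one_power2 power2_eq_square)
  have "(cmod (3 * k - a))\<^sup>2 \<le> 2\<^sup>2" using le by (intro power_mono) auto
  then have "(Re (3 * k - a))\<^sup>2 + (Im (3 * k - a))\<^sup>2 \<le> 4" by (simp add: cmod_power2)
  then have "Re k * Re a + Im k * Im a \<ge> 1"
    using sq[OF assms(1)] sq[OF assms(4)] by (simp add: power2_eq_square algebra_simps)
  then have "(Re (k - a))\<^sup>2 + (Im (k - a))\<^sup>2 \<le> 0"
    using sq[OF assms(1)] sq[OF assms(4)] by (simp add: power2_eq_square algebra_simps)
  then have "(cmod (k - a))\<^sup>2 \<le> 0" by (simp add: cmod_power2)
  then show ?thesis by simp
qed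

text \<open>A splitting other than that into right and left ends has two blocks with signs $\pm,\mp,\mp$; the element whose sign
occurs once in its block is singled out.\<close>

lemma lone_elements:
  assumes P: "card P = 3" "P \<noteq> right_ends" "P \<noteq> - right_ends"
  obtains b e where "b \<in> P" "e \<notin> P" "\<And>p. p \<in> P \<Longrightarrow> p \<noteq> b \<Longrightarrow> end_sign p = - end_sign b"
    "\<And>p. p \<notin> P \<Longrightarrow> p \<noteq> e \<Longrightarrow> end_sign p = - end_sign e"
proof -
  have fin: "finite (A :: 6 set)" for A by simp
  have 1: "card (P \<inter> right_ends) + card (P - right_ends) = 3" using P(1) card_Int_Diff[OF fin, of P right_ends] by simp
  have 2: "card (P \<inter> right_ends) + card (right_ends - P) = 3"
    using card_right_ends card_Int_Diff[OF fin, of right_ends P] by (simp add: Int_commute)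
  have 3: "card (right_ends - P) + card (- (P \<union> right_ends)) = 3"
  proof -
    have "card (- P) = 3" using P by (simp add: card_Compl6)
    then have "card (- P \<inter> right_ends) + card (- P - right_ends) = 3" using card_Int_Diff[OF fin, of "- P" right_ends] by simp
    moreover have "- P \<inter> right_ends = right_ends - P" "- P - right_ends = - (P \<union> right_ends)" by auto
    ultimately show ?thesis by simp
  qed
  have "card (P - right_ends) \<noteq> 0" using P card_right_ends 1 by (metis Diff_eq_empty_iff card_0_eq card_subset_eq fin)
  moreover have "card (P - right_ends) \<noteq> 3"
  proof
    assume "card (P - right_ends) = 3"
    then have "P \<inter> right_ends = {}" using 1 fin by simp
    then have "P \<subseteq> - right_ends" by auto
    moreover have "card P = card (- right_ends)" using P card_right_ends by (simp add: card_Compl6)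
    ultimately show False using P(3) card_subset_eq[OF fin] by metis
  qed
  ultimately consider "card (P - right_ends) = 1" | "card (P - right_ends) = 2" using 1 by linarith
  then show ?thesis
  proof cases
    case 1
    then have "card (right_ends - P) = 1" using 2 \<open>card (P \<inter> right_ends) + card (P - right_ends) = 3\<close> by simp
    with 1 obtain b e where be: "P - right_ends = {b}" "right_ends - P = {e}" by (auto simp: card_1_singleton_iff)
    then have "p \<in> P \<and> p \<notin> right_ends \<longleftrightarrow> p = b" "p \<in> right_ends \<and> p \<notin> P \<longleftrightarrow> p = e" for p by blast+
    note * = this
    show ?thesis
      by (rule that[of b e]; use *[of b] *[of e] * in \<open>auto simp: end_sign_right_ends\<close>)
  next
    case 2
    then have "card (P \<inter> right_ends) = 1" "card (- (P \<union> right_ends)) = 1"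
      using 3 \<open>card (P \<inter> right_ends) + card (P - right_ends) = 3\<close> \<open>card (P \<inter> right_ends) + card (right_ends - P) = 3\<close> by simp_all
    then obtain b e where be: "P \<inter> right_ends = {b}" "- (P \<union> right_ends) = {e}" by (auto simp: card_1_singleton_iff)
    then have "p \<in> P \<and> p \<in> right_ends \<longleftrightarrow> p = b" "p \<notin> right_ends \<and> p \<notin> P \<longleftrightarrow> p = e" for p by blast+
    note * = this
    show ?thesis
      by (rule that[of b e]; use *[of b] *[of e] * in \<open>auto simp: end_sign_right_ends\<close>)
  qed
qed

text \<open>The products $y_p = u_p v_p$ are constant or of sum $0$ on each block. Suppose first that the splitting $P$ is not the one into
right and left ends. Constancy would make two terms of $w$ with opposite signs antipodal. If both sums vanish, then
changing the sign of the lone elements $b$, $e$ of the two blocks gives $0 = \sum w = 2 w_b + 2 w_e$, again an antipodal pair. If $P$ is the splitting into right and left ends, constancy on the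
right ends would force every left term to be the negative of the common right term; so $w$ has sum $0$ on both blocks.\<close>

lemma common_splitting:
  assumes u: "admissible u" "two_triples u P" and v: "admissible v" "two_triples v P" and w: "admissible w" "\<And>p. w p = end_sign p * u p * v p"
  shows "two_triples u right_ends \<and> two_triples v right_ends \<and> two_triples w right_ends"
proof -
  define y where "y p = u p * v p" for p
  have wy: "w p = end_sign p * y p" for p by (simp add: w y_def)
  have opp: "y p \<noteq> y q" if "end_sign p \<noteq> end_sign q" for p q
    using admissible_no_pair[OF w(1), of p q] that end_sign_neg(1) by (auto simp: wy)
  have tot: "sum w P + sum w (- P) = 0" for P
    using sum.subset_diff[of P UNIV w] admissibleD(3)[OF w(1)] by (simp add: Compl_eq_Diff_UNIV add.commute)
  have bl: "(\<forall>p\<in>B. \<forall>q\<in>B. y p = y q) \<or> (\<Sum>p\<in>B. y p) = 0" if "two_triples u B" "two_triples v B" for B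
    using block_product[OF u(1) v(1) that] by (simp add: y_def)
  have PX: "P = right_ends \<or> P = - right_ends"
  proof (rule ccontr)
    assume "\<not> (P = right_ends \<or> P = - right_ends)"
    then obtain b e where be: "b \<in> P" "e \<notin> P" "\<And>p. p \<in> P \<Longrightarrow> p \<noteq> b \<Longrightarrow> end_sign p = - end_sign b"
      "\<And>p. p \<notin> P \<Longrightarrow> p \<noteq> e \<Longrightarrow> end_sign p = - end_sign e"
      using lone_elements[of P] u(2) by (auto simp: two_triples_def)
    have two: "sum w B = 2 * w b" if B: "two_triples u B" "two_triples v B" "b \<in> B" "\<And>p. p \<in> B \<Longrightarrow> p \<noteq> b \<Longrightarrow> end_sign p = - end_sign b" for B b
    proof -
      have "card (B - {b}) = 2" using B by (simp add: two_triples_def)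
      then have "B - {b} \<noteq> {}" by force
      then obtain p where p: "p \<in> B" "p \<noteq> b" by blast
      then have "y b \<noteq> y p" using opp[of b p] B(4)[of p] by simp
      then have "sum y B = 0" using bl[OF B(1,2)] B(3) p by blast
      then have s: "y b + sum y (B - {b}) = 0" using B(3) by (simp add: sum.remove)
      have "sum w B = w b + sum w (B - {b})" using B(3) by (simp add: sum.remove)
      also have "sum w (B - {b}) = (\<Sum>p\<in>B - {b}. - end_sign b * y p)"
        by (rule sum.cong) (auto simp: wy B(4))
      also have "\<dots> = - end_sign b * sum y (B - {b})" by (simp add: sum_distrib_left)
      also have "\<dots> = w b" using s by (simp add: wy add_eq_0_iff)
      finally show ?thesis by simp
    qed
    have "sum w P = 2 * w b" by (rule two[OF u(2) v(2) be(1,3)])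
    moreover have "sum w (- P) = 2 * w e"
      using be by (intro two two_triples_Compl u v) auto
    ultimately have "2 * (w b + w e) = 0" using tot[of P] by (simp add: algebra_simps)
    then have "(2 :: complex) = 0 \<or> w b + w e = 0" by (simp only: mult_eq_0_iff)
    then have "w b + w e = 0" by simp
    then show False using admissible_no_pair[OF w(1)] by blast
  qed
  then have uX: "two_triples u right_ends" and vX: "two_triples v right_ends"
    using u(2) v(2) two_triples_Compl[of u P] two_triples_Compl[of v P] by auto
  have "sum y right_ends = 0"
  proof (rule ccontr)
    assume "sum y right_ends \<noteq> 0"
    then have "\<forall>p\<in>right_ends. \<forall>q\<in>right_ends. y p = y q" using bl[OF uX vX] by blast
    moreover have "1 \<in> right_ends" by (simp add: right_ends_def)
    ultimately have y1: "y p = y 1" if "p \<in> right_ends" for p using that by blast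
    have w1: "w p = w 1" if "p \<in> right_ends" for p
      using that \<open>1 \<in> right_ends\<close> y1[OF that] by (simp add: wy end_sign_right_ends)
    have "sum w right_ends = (\<Sum>p\<in>right_ends. w 1)" by (rule sum.cong[OF refl w1])
    then have "sum w right_ends = 3 * w 1" by (simp add: card_right_ends)
    then have s: "sum w (- right_ends) = 3 * (- w 1)" using tot[of right_ends] by (simp add: add_eq_0_iff)
    have "card (- right_ends) = 3" by (simp add: card_Compl6 card_right_ends)
    then obtain a b d where abd: "- right_ends = {a, b, d}" "a \<noteq> b" "a \<noteq> d" "b \<noteq> d" by (auto simp: card_3_iff)
    then have "w a + w b + w d = 3 * (- w 1)" using s by (simp add: add.assoc)
    from unimodular_sum_eq_3[OF _ _ _ _ this] have "w a = - w 1" by (simp add: admissibleD(1)[OF w(1)])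
    then show False using admissible_no_pair[OF w(1), of a 1] by simp
  qed
  then have "sum w right_ends = 0" by (simp add: wy end_sign_right_ends)
  then have "two_triples w right_ends" using sum_Compl_zero admissibleD(3)[OF w(1)] by (simp add: two_triples_def card_right_ends)
  then show ?thesis using uX vX by blast
qed

text \<open>If every block of $R$ were inside a block of $P$, the blocks would coincide by cardinality.\<close>

lemma block_separation:
  assumes "card P = 3" "card R = 3" "R \<noteq> P" "R \<noteq> - (P :: 6 set)"
  obtains p q where "same R p q" "\<not> same P p q"
proof (cases "\<forall>p q. same R p q \<longrightarrow> same P p q")
  case True
  have "R \<noteq> {}" using assms by auto
  then obtain r where r: "r \<in> R" by blast
  have "R \<subseteq> P \<or> R \<subseteq> - P" using True r by blast
  then have False
  proof
    assume "R \<subseteq> P" then show False using card_subset_eq[of P R] assms by simp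
  next
    assume "R \<subseteq> - P" then show False using card_subset_eq[of "- P" R] assms by (simp add: card_Compl6)
  qed
  then show ?thesis ..
next
  case False
  then show ?thesis using that by blast
qed

lemma three_splittings_aux:
  fixes f g :: "6 \<Rightarrow> complex"
  assumes c: "card P = 3" "card R = 3" "R \<noteq> P" "R \<noteq> - P"
    and f: "\<And>p q. same P p q \<Longrightarrow> f p = f q" "\<And>p. f p \<noteq> 0"
    and g: "\<And>p q. same Q p q \<Longrightarrow> g p = g q" "\<And>p. g p \<noteq> 0"
    and fg: "\<And>p q. same R p q \<Longrightarrow> f p * g p = f q * g q"
    and pq: "same R p q" "same P p q" "\<not> same Q p q"
  shows "f x = f y" "g x = g y"
proof -
  have "g p = g q" using fg[OF pq(1)] f(1)[OF pq(2)] f(2) by simp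
  then have gp: "g x = g p" for x using g(1)[of x p] g(1)[of x q] pq(3) by metis
  then show "g x = g y" by metis
  obtain p' q' where pq': "same R p' q'" "\<not> same P p' q'" using block_separation[OF c] by blast
  have "f p' = f q'" using fg[OF pq'(1)] gp g(2) by (metis mult_right_cancel)
  then have "f x = f p'" for x using f(1)[of x p'] f(1)[of x q'] pq'(2) by metis
  then show "f x = f y" by metis
qed

text \<open>If two positions lie in one block of $R$ and of $P$ but in different blocks of $Q$, then $g$ takes one value on both blocks
of $Q$, and $f$ follows because the blocks of $R$ and $P$ interlace. If neither this nor the mirror situation occurred, $P$ and
$Q$ would agree up to complement on each block of $R$, which parity of cardinalities forbids unless they agree up to complement
altogether.\<close>

lemma three_splittings:
  fixes f g :: "6 \<Rightarrow> complex"
  assumes c: "card P = 3" "card Q = 3" "card R = 3"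
    and n: "R \<noteq> P" "R \<noteq> - P" "R \<noteq> Q" "R \<noteq> - Q" "Q \<noteq> P" "Q \<noteq> - P"
    and f: "\<And>p q. same P p q \<Longrightarrow> f p = f q" "\<And>p. f p \<noteq> 0"
    and g: "\<And>p q. same Q p q \<Longrightarrow> g p = g q" "\<And>p. g p \<noteq> 0"
    and fg: "\<And>p q. same R p q \<Longrightarrow> f p * g p = f q * g q"
  shows "f x = f y" "g x = g y"
proof -
  have "\<exists>p q. same R p q \<and> same P p q \<noteq> same Q p q"
  proof (rule ccontr)
    assume "\<nexists>p q. same R p q \<and> same P p q \<noteq> same Q p q"
    then have *: "same P p q = same Q p q" if "same R p q" for p q using that by blast
    have on: "P \<inter> B = Q \<inter> B \<or> P \<inter> B = B - Q" if "\<And>p q. p \<in> B \<Longrightarrow> q \<in> B \<Longrightarrow> same R p q" for B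
    proof (cases "B = {}")
      case False
      then obtain r where "r \<in> B" by blast
      then show ?thesis using *[of _ r] that by blast
    qed simp
    have R1: "P \<inter> R = Q \<inter> R \<or> P \<inter> R = R - Q" by (rule on) auto
    have R2: "P \<inter> - R = Q \<inter> - R \<or> P \<inter> - R = - R - Q" by (rule on) auto
    have cut: "card A = card (A \<inter> R) + card (A \<inter> - R)" for A :: "6 set"
      using card_Int_Diff[of A R] by (simp add: Diff_eq)
    have RQ: "card (R - Q) = 3 - card (Q \<inter> R)"
      using c card_Int_Diff[of R Q] by (simp add: Int_commute)
    have "card (- R) = 3" using c by (simp add: card_Compl6)
    then have RQ': "card (- R - Q) = 3 - card (Q \<inter> - R)"
      using card_Int_Diff[of "- R" Q] by (simp add: Int_commute)
    have PQ: "P = (P \<inter> R) \<union> (P \<inter> - R)" "Q = (Q \<inter> R) \<union> (Q \<inter> - R)" by auto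
    show False
      using R1 R2
    proof (elim disjE)
      assume "P \<inter> R = Q \<inter> R" "P \<inter> - R = Q \<inter> - R"
      then show False using PQ n by metis
    next
      assume "P \<inter> R = R - Q" "P \<inter> - R = - R - Q"
      then have "Q = - P" by auto
      then show False using n by blast
    next
      assume "P \<inter> R = Q \<inter> R" "P \<inter> - R = - R - Q"
      then show False using cut[of P] cut[of Q] RQ' c by simp presburger
    next
      assume "P \<inter> R = R - Q" "P \<inter> - R = Q \<inter> - R"
      then show False using cut[of P] cut[of Q] RQ c by simp presburger
    qed
  qed
  then obtain p q where pq: "same R p q" "same P p q \<noteq> same Q p q" by blast
  have "f x = f y \<and> g x = g y"
  proof (cases "same P p q")
    case True
    then have nQ: "\<not> same Q p q" using pq(2) by simp
    show ?thesis
      using three_splittings_aux[where P = P and R = R and Q = Q and f = f and g = g and x = x and y = y,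
          OF c(1,3) n(1,2) f g fg pq(1) True nQ] by simp
  next
    case False
    have gf: "g p * f p = g q * f q" if "same R p q" for p q using fg[OF that] by (simp add: mult.commute)
    have Q: "same Q p q" using pq(2) False by simp
    show ?thesis
      using three_splittings_aux[where P = Q and R = R and Q = P and f = g and g = f and x = x and y = y,
          OF c(2,3) n(3,4) g f gf pq(1) Q False] by simp
  qed
  then show "f x = f y" "g x = g y" by auto
qed

text \<open>If the cubes on the two blocks differed they would be opposite; then minus a term of one block is a cube root of the common
cube of the other block, hence equal to one of its terms, and this is an antipodal pair.\<close>

lemma two_triples_cube_const:
  assumes z: "admissible z" "two_triples z P" and z6: "\<And>p q. z p ^ 6 = z q ^ 6"
  shows "z p ^ 3 = z q ^ 3"
proof (rule ccontr)
  assume ne: "z p ^ 3 \<noteq> z q ^ 3"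
  then have "p \<noteq> q" by auto
  have "(z p ^ 3)\<^sup>2 = (z q ^ 3)\<^sup>2" using z6[of p q] by (simp add: power_mult[symmetric])
  then have "z p ^ 3 = - (z q ^ 3)" using ne power2_eq_iff by blast
  then have neg: "(- z q) ^ 3 = z p ^ 3" by simp
  define B where "B = (if p \<in> P then P else - P)"
  have B: "card B = 3" "p \<in> B" using z(2) by (auto simp: B_def two_triples_def card_Compl6)
  have "card (B - {p}) = 2" using B by simp
  then obtain p' where "p' \<in> B - {p}" by (metis card_2_iff insertI1)
  then have p': "same P p p'" "p \<noteq> p'" by (auto simp: B_def split: if_splits)
  obtain r where r: "z p + z p' + z r = 0" using same_block_triple[OF z(2) p'] by blast
  have zr: "z r = - z p - z p'" using r by (simp add: algebra_simps eq_neg_iff_add_eq_0)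
  have q: "(z p)\<^sup>2 + z p * z p' + (z p')\<^sup>2 = 0" using two_triples_block(3)[OF z p'] .
  have "(t - z p) * ((t - z p') * (t - z r)) = t ^ 3 - z p ^ 3 - (t - z p) * ((z p)\<^sup>2 + z p * z p' + (z p')\<^sup>2)" for t
    unfolding zr by (simp add: algebra_simps power2_eq_square power3_eq_cube)
  then have "(- z q - z p) * ((- z q - z p') * (- z q - z r)) = 0" using q neg by simp
  moreover have "(- z q - z p) * ((- z q - z p') * (- z q - z r)) = - ((z q + z p) * ((z q + z p') * (z q + z r)))"
    by (simp add: algebra_simps)
  ultimately have "(z q + z p) * ((z q + z p') * (z q + z r)) = 0" by simp
  then have "z q + z p = 0 \<or> z q + z p' = 0 \<or> z q + z r = 0"
    by (simp only: mult_eq_0_iff)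
  then show False using admissible_no_pair[OF z(1)] by blast
qed

text \<open>For three different splittings all sixth powers, and then all cubes, are constant on each of the three vectors. But the
cubes multiply up to the sign $\varepsilon_p$, which is not constant.\<close>

lemma distinct_splittings:
  assumes u: "admissible u" "two_triples u P" and v: "admissible v" "two_triples v Q" and w: "admissible w" "two_triples w R" "\<And>p. w p = end_sign p * u p * v p"
    and n: "R \<noteq> P" "R \<noteq> - P" "R \<noteq> Q" "R \<noteq> - Q" "Q \<noteq> P" "Q \<noteq> - P"
  shows False
proof -
  have w6: "w p ^ 6 = u p ^ 6 * v p ^ 6" for p by (simp add: w(3) power_mult_distrib end_sign_power)
  have c: "card P = 3" "card Q = 3" "card R = 3" using u v w by (auto simp: two_triples_def)
  have nz: "u p ^ 6 \<noteq> 0" "v p ^ 6 \<noteq> 0" for p using admissibleD(2)[OF u(1)] admissibleD(2)[OF v(1)] by simp_all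
  have fg: "u p ^ 6 * v p ^ 6 = u q ^ 6 * v q ^ 6" if "same R p q" for p q
    using two_triples_block_power(1)[OF w(1,2) that] by (simp add: w6)
  note 6 = three_splittings[where P = P and Q = Q and R = R and f = "\<lambda>p. u p ^ 6" and g = "\<lambda>p. v p ^ 6", OF c n
    two_triples_block_power(1)[OF u] nz(1) two_triples_block_power(1)[OF v] nz(2) fg]
  have "u 1 ^ 3 = u 2 ^ 3" "v 1 ^ 3 = v 2 ^ 3" "w 1 ^ 3 = w 2 ^ 3"
    using two_triples_cube_const[OF u 6(1)] two_triples_cube_const[OF v 6(2)] two_triples_cube_const[OF w(1,2)] w6 6 by metis+
  moreover have "w 1 ^ 3 = u 1 ^ 3 * v 1 ^ 3" "w 2 ^ 3 = - (u 2 ^ 3 * v 2 ^ 3)"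
    by (simp_all add: w(3) power_mult_distrib end_sign_power) (simp_all add: end_sign_def)
  ultimately have "w 1 ^ 3 = 0" by simp
  then show False using admissibleD(2)[OF w(1)] by simp
qed

lemma two_triples_cnj: "two_triples z P \<Longrightarrow> two_triples (\<lambda>p. cnj (z p)) P"
  unfolding two_triples_def by (metis cnj_sum complex_cnj_zero)

lemma antipodal_cnj: "antipodal (\<lambda>p. cnj (z p)) \<longleftrightarrow> antipodal z"
  unfolding antipodal_def complex_cnj_add[symmetric] complex_cnj_zero_iff ..

lemma admissible_cnj: "admissible z \<Longrightarrow> admissible (\<lambda>p. cnj (z p))"
  unfolding admissible_def antipodal_cnj cnj_sum[symmetric] by simp

lemma pentagonal_cnj: assumes "pentagonal z E" shows "pentagonal (\<lambda>p. cnj (z p)) E"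
proof -
  obtain K G where "\<And>p. z p ^ 15 = (if p \<in> E then - K else K)" "\<And>p. p \<notin> E \<Longrightarrow> z p ^ 10 = G"
    using assms unfolding pentagonal_def by metis
  then have "\<forall>p. cnj (z p) ^ 15 = (if p \<in> E then - cnj K else cnj K)" "\<forall>p. p \<notin> E \<longrightarrow> cnj (z p) ^ 10 = cnj G"
    by (auto simp: complex_cnj_power[symmetric] simp del: complex_cnj_power)
  moreover have "cnj (z p) ^ 6 = cnj (z q) ^ 6 \<longleftrightarrow> z p ^ 6 = z q ^ 6" for p q
    by (simp add: complex_cnj_power[symmetric] del: complex_cnj_power)
  moreover have "card E = 2" "\<forall>p q. z p ^ 6 = z q ^ 6 \<longleftrightarrow> p = q \<or> p \<in> E \<and> q \<in> E"
    using assms by (simp_all add: pentagonal_def)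
  ultimately show ?thesis
    unfolding pentagonal_def by (intro conjI exI[of _ "cnj K"] exI[of _ "cnj G"]) simp_all
qed

text \<open>In a triangle all of whose sides split into two triples, every side splits into its right and its left ends.\<close>

lemma triangle_two_triples:
  assumes u: "admissible u" "two_triples u P" and v: "admissible v" "two_triples v Q" and w: "admissible w" "two_triples w R" and w': "\<And>p. w p = end_sign p * u p * v p"
  shows "two_triples u right_ends \<and> two_triples v right_ends \<and> two_triples w right_ends"
proof -
  have eqv: "two_triples z P" if "two_triples z Q" "Q = P \<or> Q = - P" for z and P Q :: "6 set"
    using that two_triples_Compl[of z Q] by auto
  consider "Q = P \<or> Q = - P" | "R = P \<or> R = - P" | "R = Q \<or> R = - Q"
    | "R \<noteq> P" "R \<noteq> - P" "R \<noteq> Q" "R \<noteq> - Q" "Q \<noteq> P" "Q \<noteq> - P" by blast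
  then show ?thesis
  proof cases
    case 1
    then show ?thesis using common_splitting[OF u v(1) eqv[OF v(2) 1] w(1) w'] by blast
  next
    case 2
    have "v p = end_sign p * w p * cnj (u p)" for p
      using unimodular_cnj[OF admissibleD(1)[OF u(1)], of p] by (simp add: w' algebra_simps)
    from common_splitting[OF w(1) eqv[OF w(2) 2] admissible_cnj[OF u(1)] two_triples_cnj[OF u(2)] v(1) this]
    have A: "two_triples w right_ends" "two_triples (\<lambda>p. cnj (u p)) right_ends" "two_triples v right_ends" by blast+
    show ?thesis using A two_triples_cnj[OF A(2)] unfolding complex_cnj_cnj by blast
  next
    case 3
    have "u p = end_sign p * w p * cnj (v p)" for p
      using unimodular_cnj[OF admissibleD(1)[OF v(1)], of p] by (simp add: w' algebra_simps)
    from common_splitting[OF w(1) eqv[OF w(2) 3] admissible_cnj[OF v(1)] two_triples_cnj[OF v(2)] u(1) this]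
    have A: "two_triples w right_ends" "two_triples (\<lambda>p. cnj (v p)) right_ends" "two_triples u right_ends" by blast+
    show ?thesis using A two_triples_cnj[OF A(2)] unfolding complex_cnj_cnj by blast
  next
    case 4
    then show ?thesis using distinct_splittings[OF u v w w'] by blast
  qed
qed

lemma pentagonalE:
  assumes "pentagonal z E"
  obtains K G where "card E = 2" "\<And>p. z p ^ 15 = (if p \<in> E then - K else K)"
    "\<And>p. p \<notin> E \<Longrightarrow> z p ^ 10 = G" "\<And>p q. z p ^ 6 = z q ^ 6 \<longleftrightarrow> p = q \<or> p \<in> E \<and> q \<in> E"
  using assms unfolding pentagonal_def by metis

lemma pentagonal_15:
  assumes "pentagonal z E"
  obtains K where "\<And>p. z p ^ 15 = (if p \<in> E then - 1 else 1) * K"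
proof -
  have "\<exists>K. \<forall>p. z p ^ 15 = (if p \<in> E then - K else K)"
    using assms unfolding pentagonal_def by (rule conjunct1[OF conjunct2])
  then obtain K where "\<And>p. z p ^ 15 = (if p \<in> E then - K else K)" by metis
  then show ?thesis using that[of K] by simp
qed

lemma pentagonal_10:
  assumes "pentagonal z E" "p \<notin> E" "q \<notin> E"
  shows "z p ^ 10 = z q ^ 10"
  using assms by (metis pentagonalE)

text \<open>Sixth powers take at most two values on each factor, so at most four on the product, but five on a pentagonal vector.\<close>

lemma pentagonal_not_product_of_two_triples:
  assumes u: "admissible u" "two_triples u P" and v: "admissible v" "two_triples v Q" and w: "pentagonal w E" "\<And>p. w p = end_sign p * u p * v p"
  shows False
proof -
  have two: "card (range (\<lambda>p. z p ^ 6)) \<le> 2" if z: "admissible z" "two_triples z P" for z P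
  proof -
    have "card P = 3" using z by (simp add: two_triples_def)
    then obtain a where a: "a \<in> P" by (metis card.empty ex_in_conv zero_neq_numeral)
    have "card (- P) = 3" using z by (simp add: two_triples_def card_Compl6)
    then obtain b where b: "b \<in> - P" by (metis card.empty ex_in_conv zero_neq_numeral)
    have "range (\<lambda>p. z p ^ 6) \<subseteq> {z a ^ 6, z b ^ 6}"
    proof
      fix x assume "x \<in> range (\<lambda>p. z p ^ 6)"
      then obtain p where "x = z p ^ 6" by blast
      then show "x \<in> {z a ^ 6, z b ^ 6}"
        using two_triples_block_power(1)[OF z, of p a] two_triples_block_power(1)[OF z, of p b] a b by (cases "p \<in> P") auto
    qed
    then have "card (range (\<lambda>p. z p ^ 6)) \<le> card {z a ^ 6, z b ^ 6}" by (intro card_mono) auto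
    also have "\<dots> \<le> 2" by (simp add: card_insert_if)
    finally show ?thesis .
  qed
  obtain K G where E: "card E = 2" and w6: "\<And>p q. w p ^ 6 = w q ^ 6 \<longleftrightarrow> p = q \<or> p \<in> E \<and> q \<in> E"
    using pentagonalE[OF w(1)] by metis
  obtain e f where ef: "E = {e, f}" "e \<noteq> f" using E by (auto simp: card_2_iff)
  have "inj_on (\<lambda>p. w p ^ 6) (- {e})" using w6 ef by (auto simp: inj_on_def)
  then have five: "card ((\<lambda>p. w p ^ 6) ` (- {e})) = 5" by (simp add: card_image card_Compl6)
  have "(\<lambda>p. w p ^ 6) ` (- {e}) \<subseteq> (\<lambda>(x, y). x * y) ` (range (\<lambda>p. u p ^ 6) \<times> range (\<lambda>p. v p ^ 6))"
    by (auto simp: w(2) power_mult_distrib end_sign_power)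
  then have "card ((\<lambda>p. w p ^ 6) ` (- {e})) \<le> card ((\<lambda>(x, y). x * y) ` (range (\<lambda>p. u p ^ 6) \<times> range (\<lambda>p. v p ^ 6)))"
    by (intro card_mono) auto
  also have "\<dots> \<le> card (range (\<lambda>p. u p ^ 6) \<times> range (\<lambda>p. v p ^ 6))"
    by (rule card_image_le) simp
  also have "\<dots> \<le> 2 * 2"
    unfolding card_cartesian_product by (intro mult_mono two[OF u] two[OF v]) auto
  finally show False using five by simp
qed

text \<open>Parity of the signs. The fifteenth powers give a relation $\varepsilon_p\, s_E(p)\, s_F(p)\, s_D(p) = \mathrm{const}$, where $s_A$ is $-1$ on
$A$ and $1$ elsewhere. Multiplied over the six positions, the right side and each $s_A$ give $1$, but $\varepsilon$ gives $-1$.\<close>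

lemma pentagonal_not_product_of_pentagonal:
  assumes u: "pentagonal u E" and v: "pentagonal v F" and w: "pentagonal w D" "\<And>p. w p = end_sign p * u p * v p" and nz: "\<And>p. w p \<noteq> 0"
  shows False
proof -
  define s where "s A p = (if p \<in> A then - 1 else 1 :: complex)" for A and p :: 6
  have cK0: "card E = 2" using u by (simp add: pentagonal_def)
  obtain K where K: "\<And>p. u p ^ 15 = s E p * K"
    using pentagonal_15[OF u] unfolding s_def by blast
  have cL0: "card F = 2" using v by (simp add: pentagonal_def)
  obtain L where L: "\<And>p. v p ^ 15 = s F p * L"
    using pentagonal_15[OF v] unfolding s_def by blast
  have cJ0: "card D = 2" using w(1) by (simp add: pentagonal_def)
  obtain J where J: "\<And>p. w p ^ 15 = s D p * J"
    using pentagonal_15[OF w(1)] unfolding s_def by blast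
  define x where "x p = end_sign p * s E p * s F p * s D p" for p
  have s2: "s A p * s A p = 1" for A p by (simp add: s_def)
  have x1: "x p = 1 \<or> x p = - 1" for p by (auto simp: x_def s_def end_sign_def)
  have J0: "J \<noteq> 0" using J[of 1] nz[of 1] by auto
  have "J = x p * (K * L)" for p
  proof -
    have "s D p * J = end_sign p * (s E p * K) * (s F p * L)"
      unfolding J[symmetric] K[symmetric] L[symmetric] by (simp add: w(2) power_mult_distrib end_sign_power)
    then have "s D p * (s D p * J) = s D p * (end_sign p * (s E p * K) * (s F p * L))" by simp
    moreover have "s D p * (s D p * J) = J" using s2[of D p] by (metis mult.assoc mult_1)
    moreover have "s D p * (end_sign p * (s E p * K) * (s F p * L)) = x p * (K * L)" by (simp add: x_def mult_ac)
    ultimately show ?thesis by simp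
  qed
  then have "x p * (K * L) = x 1 * (K * L)" for p by metis
  then have xc: "x p = x 1" for p using J0 \<open>\<And>p. J = x p * (K * L)\<close> by (metis mult_cancel_right mult_zero_right)
  have "(\<Prod>p\<in>UNIV. x p) = (\<Prod>p\<in>(UNIV :: 6 set). x 1)" by (rule prod.cong[OF refl xc])
  also have "\<dots> = x 1 ^ 6" by simp
  also have "\<dots> = 1" using x1[of 1] by auto
  finally have "(\<Prod>p\<in>UNIV. x p) = 1" .
  moreover have "(\<Prod>p\<in>UNIV. s A p) = 1" if "card A = 2" for A
    using that by (simp add: s_def prod.If_cases)
  moreover have "(\<Prod>p\<in>UNIV. end_sign p) = - 1"
    unfolding end_sign_right_ends using card_right_ends card_Compl6[of right_ends] by (simp add: prod.If_cases)
  ultimately show False using cK0 cL0 cJ0 by (simp add: x_def prod.distrib)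
qed

text \<open>In a triangle with two pentagonal sides and one side that splits into triples $R$, $- R$, tenth powers show that each block
contains only one position outside the exceptional pairs $E$ and $F$, sixth powers that each pair has one position in each
block, and fifteenth powers that $m$ and $m'$ carry the signs that are lone in their blocks.\<close>

lemma triangle_pentagonal:
  assumes u: "admissible u" "pentagonal u E" and v: "admissible v" "pentagonal v F" and w: "admissible w" "two_triples w R" "\<And>p. w p = end_sign p * u p * v p"
  obtains m e f m' e' f' where "R = {m, e, f}" "- R = {m', e', f'}" "E = {e, e'}" "F = {f, f'}"
    "distinct [m, e, f, m', e', f']"
    "end_sign e = - end_sign m" "end_sign f = - end_sign m" "end_sign m' = - end_sign m" "end_sign e' = end_sign m" "end_sign f' = end_sign m"
proof -
  obtain K G where E: "card E = 2" "\<And>p. u p ^ 15 = (if p \<in> E then - K else K)"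
    "\<And>p. p \<notin> E \<Longrightarrow> u p ^ 10 = G" "\<And>p q. u p ^ 6 = u q ^ 6 \<longleftrightarrow> p = q \<or> p \<in> E \<and> q \<in> E"
    using pentagonalE[OF u(2)] by metis
  obtain L H where F: "card F = 2" "\<And>p. v p ^ 15 = (if p \<in> F then - L else L)"
    "\<And>p. p \<notin> F \<Longrightarrow> v p ^ 10 = H" "\<And>p q. v p ^ 6 = v q ^ 6 \<longleftrightarrow> p = q \<or> p \<in> F \<and> q \<in> F"
    using pentagonalE[OF v(2)] by metis
  have w15: "w p ^ 15 = end_sign p * u p ^ 15 * v p ^ 15" and w10: "w p ^ 10 = u p ^ 10 * v p ^ 10"
    and w6: "w p ^ 6 = u p ^ 6 * v p ^ 6" for p
    by (simp_all add: w(3) power_mult_distrib end_sign_power)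
  have cR: "card R = 3" "card (- R) = 3" using w(2) by (simp_all add: two_triples_def card_Compl6)
  define W where "W = - (E \<union> F)"
  have uniqW: "p = q" if "p \<in> W" "q \<in> W" "same R p q" for p q
    using two_triples_block_power(3)[OF w(1,2) that(3)] that E(3) F(3) by (simp add: w10 W_def)
  have sameE: "\<not> same R p q" if "p \<in> E" "q \<in> E" "p \<noteq> q" "E \<inter> F = {}" for p q
  proof
    assume sR: "same R p q"
    have "u p ^ 6 * v p ^ 6 = u q ^ 6 * v q ^ 6" using two_triples_block_power(1)[OF w(1,2) sR] by (simp add: w6)
    moreover have "u p ^ 6 = u q ^ 6" using E(4) that by simp
    moreover have "u q ^ 6 \<noteq> 0" using admissibleD(2)[OF u(1)] by simp
    ultimately have "v p ^ 6 = v q ^ 6" by simp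
    then show False using F(4) that by auto
  qed
  have sameF: "\<not> same R p q" if "p \<in> F" "q \<in> F" "p \<noteq> q" "E \<inter> F = {}" for p q
  proof
    assume sR: "same R p q"
    have "u p ^ 6 * v p ^ 6 = u q ^ 6 * v q ^ 6" using two_triples_block_power(1)[OF w(1,2) sR] by (simp add: w6)
    moreover have "v p ^ 6 = v q ^ 6" using F(4) that by simp
    moreover have "v q ^ 6 \<noteq> 0" using admissibleD(2)[OF v(1)] by simp
    ultimately have "u p ^ 6 = u q ^ 6" by simp
    then show False using E(4) that by auto
  qed
  have le1: "card (W \<inter> R) \<le> 1" "card (W - R) \<le> 1"
    using uniqW by (auto simp: card_le_Suc0_iff_eq)
  have "card W = card (W \<inter> R) + card (W - R)" by (intro card_Int_Diff) simp
  moreover have cW: "card W + card (E \<union> F) = 6"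
    using card_Compl6[of "E \<union> F"] card_mono[of UNIV "E \<union> F"] by (simp add: W_def)
  moreover have cEF: "card (E \<union> F) + card (E \<inter> F) = 4"
    using card_Un_Int[of E F] E F by simp
  ultimately have "card (W \<inter> R) = 1" "card (W - R) = 1" "card (E \<inter> F) = 0" using le1 by linarith+
  then obtain m m' where m: "W \<inter> R = {m}" "W - R = {m'}" and dj: "E \<inter> F = {}"
    by (auto simp: card_1_singleton_iff)
  obtain e0 e1 where e01: "E = {e0, e1}" "e0 \<noteq> e1" using E(1) by (auto simp: card_2_iff)
  obtain e e' where e: "E = {e, e'}" "e \<in> R" "e' \<notin> R"
    using sameE[of e0 e1] e01 dj by (cases "e0 \<in> R") auto
  obtain f0 f1 where f01: "F = {f0, f1}" "f0 \<noteq> f1" using F(1) by (auto simp: card_2_iff)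
  obtain f f' where f: "F = {f, f'}" "f \<in> R" "f' \<notin> R"
    using sameF[of f0 f1] f01 dj by (cases "f0 \<in> R") auto
  have W: "W = {m, m'}" "m \<in> R" "m' \<notin> R" using m by auto
  have dist: "distinct [m, e, f, m', e', f']"
    using W e f dj unfolding W_def by auto
  have all: "p = m \<or> p = m' \<or> p = e \<or> p = e' \<or> p = f \<or> p = f'" for p
    using W e f unfolding W_def by blast
  have "p \<in> R \<longleftrightarrow> p \<in> {m, e, f}" for p using all[of p] W e f by auto
  then have R: "R = {m, e, f}" by blast
  have "p \<in> - R \<longleftrightarrow> p \<in> {m', e', f'}" for p using all[of p] W e f by auto
  then have R': "- R = {m', e', f'}" by blast
  have nz: "K \<noteq> 0" "L \<noteq> 0" using E(2)[of m] F(2)[of m] admissibleD(2)[OF u(1), of m] admissibleD(2)[OF v(1), of m]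
    by (auto split: if_splits)
  have odd: "end_sign p = - end_sign q" if "p \<in> E \<union> F" "q \<in> W" "same R p q" for p q
  proof -
    have "end_sign p * u p ^ 15 * v p ^ 15 = end_sign q * u q ^ 15 * v q ^ 15"
      using two_triples_block_power(2)[OF w(1,2) that(3)] by (simp add: w15)
    moreover have "u p ^ 15 * v p ^ 15 = - (K * L)" "u q ^ 15 * v q ^ 15 = K * L"
      using that dj E(2) F(2) by (auto simp: W_def)
    ultimately have "end_sign p * (- (K * L)) = end_sign q * (K * L)" by (simp add: mult.assoc)
    then have "(- end_sign p) * (K * L) = end_sign q * (K * L)" by simp
    then show ?thesis using nz by (metis add.inverse_inverse mult_cancel_right mult_eq_0_iff)
  qed
  have s: "end_sign e = - end_sign m" "end_sign f = - end_sign m" "end_sign e' = - end_sign m'" "end_sign f' = - end_sign m'"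
    using odd W e f by auto
  have "sum end_sign UNIV = 0"
    unfolding end_sign_right_ends using card_right_ends card_Compl6[of right_ends] by (simp add: sum.If_cases)
  moreover have "sum end_sign UNIV = sum end_sign R + sum end_sign (- R)"
    using sum.subset_diff[of R UNIV end_sign] by (simp add: Compl_eq_Diff_UNIV add.commute)
  moreover have "sum end_sign R = - end_sign m" "sum end_sign (- R) = - end_sign m'"
    unfolding R' unfolding R using dist s by simp_all
  ultimately have "- end_sign m + - end_sign m' = 0" by metis
  then have "end_sign m' = - end_sign m" by (metis add_eq_0_iff minus_minus)
  then show ?thesis using that[of m e f m' e' f'] R R' e f dist s by simp
qed

section \<open>No four pairwise admissible vectors\<close>

text \<open>For $u_p = e(\lambda c_p)$ and $v_p = e(\mu c_p)$ this is $v_{\lambda-\mu}$.\<close>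

definition quotient :: "(6 \<Rightarrow> complex) \<Rightarrow> (6 \<Rightarrow> complex) \<Rightarrow> 6 \<Rightarrow> complex" where
  "quotient u v p = end_sign p * u p * cnj (v p)"

lemma quotient_sym: "quotient v u = (\<lambda>p. cnj (quotient u v p))"
  by (simp add: quotient_def end_sign_def fun_eq_iff mult.commute)

lemma quotient_trans:
  assumes "\<And>p. cmod (v p) = 1"
  shows "quotient u w p = end_sign p * quotient u v p * quotient v w p"
proof -
  have "end_sign p * quotient u v p * quotient v w p = (end_sign p * end_sign p) * end_sign p * u p * (v p * cnj (v p)) * cnj (w p)"
    by (simp add: quotient_def mult_ac)
  then show ?thesis using unimodular_cnj[OF assms] by (simp add: quotient_def)
qed

lemma quotient_admissible_sym: "admissible (quotient u v) \<Longrightarrow> admissible (quotient v u)"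
  using admissible_cnj[of "quotient u v"] by (simp add: quotient_sym[of v u])

lemma quotient_two_triples_sym: "two_triples (quotient u v) P \<Longrightarrow> two_triples (quotient v u) P"
  using two_triples_cnj[of "quotient u v"] by (simp add: quotient_sym[of v u])

lemma quotient_pentagonal_sym: "pentagonal (quotient u v) P \<Longrightarrow> pentagonal (quotient v u) P"
  using pentagonal_cnj[of "quotient u v"] by (simp add: quotient_sym[of v u])

text \<open>The ratios of two fixed coordinates of the four vectors would be four numbers any two of which differ by a primitive cube
root of unity.\<close>

lemma no_four_parallel:
  assumes u: "\<And>p. cmod (a p) = 1" "\<And>p. cmod (b p) = 1" "\<And>p. cmod (c p) = 1" "\<And>p. cmod (d p) = 1"
    and t: "two_triples (quotient a b) right_ends" "two_triples (quotient a c) right_ends" "two_triples (quotient a d) right_ends" "two_triples (quotient b c) right_ends" "two_triples (quotient b d) right_ends" "two_triples (quotient c d) right_ends"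
    and ad: "admissible (quotient a b)" "admissible (quotient a c)" "admissible (quotient a d)" "admissible (quotient b c)" "admissible (quotient b d)" "admissible (quotient c d)"
  shows False
proof -
  define f where "f v = v 1 * cnj (v 3)" for v :: "6 \<Rightarrow> complex"
  have quad: "(f v)\<^sup>2 + f v * f w + (f w)\<^sup>2 = 0"
    if "two_triples (quotient v w) right_ends" "admissible (quotient v w)" "\<And>p. cmod (v p) = 1" "\<And>p. cmod (w p) = 1" for v w
  proof -
    have "(quotient v w 1)\<^sup>2 + quotient v w 1 * quotient v w 3 + (quotient v w 3)\<^sup>2 = 0"
      using two_triples_block(3)[OF that(2,1), of 1 3] by (simp add: right_ends_def)
    moreover have "quotient v w 1 = v 1 * cnj (w 1)" "quotient v w 3 = v 3 * cnj (w 3)"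
      by (simp_all add: quotient_def end_sign_def)
    ultimately have q: "(v 1 * cnj (w 1))\<^sup>2 + (v 1 * cnj (w 1)) * (v 3 * cnj (w 3)) + (v 3 * cnj (w 3))\<^sup>2 = 0" by simp
    have i: "cnj (v p) = inverse (v p)" "cnj (w p) = inverse (w p)" "v p \<noteq> 0" "w p \<noteq> 0" for p
      using unimodular_cnj[OF that(3), of p] unimodular_cnj[OF that(4), of p]
      by (auto simp: inverse_unique)
    have "(f v)\<^sup>2 + f v * f w + (f w)\<^sup>2
        = (w 1 / v 3)\<^sup>2 * ((v 1 * cnj (w 1))\<^sup>2 + (v 1 * cnj (w 1)) * (v 3 * cnj (w 3)) + (v 3 * cnj (w 3))\<^sup>2)"
      unfolding f_def i using i(3,4) by (simp add: field_simps power2_eq_square)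
    then show ?thesis using q by simp
  qed
  have ab: "(f a)\<^sup>2 + f a * f b + (f b)\<^sup>2 = 0" and ac: "(f a)\<^sup>2 + f a * f c + (f c)\<^sup>2 = 0"
    and ad': "(f a)\<^sup>2 + f a * f d + (f d)\<^sup>2 = 0" and bc: "(f b)\<^sup>2 + f b * f c + (f c)\<^sup>2 = 0"
    and bd: "(f b)\<^sup>2 + f b * f d + (f d)\<^sup>2 = 0" and cd: "(f c)\<^sup>2 + f c * f d + (f d)\<^sup>2 = 0"
    using quad t ad u by blast+
  have nz: "f v \<noteq> 0" if "\<And>p. cmod (v p) = 1" for v
    using that[of 1] that[of 3] by (auto simp: f_def)
  have third: "z = - x - y" if "x\<^sup>2 + x * y + y\<^sup>2 = 0" "x\<^sup>2 + x * z + z\<^sup>2 = 0" "y\<^sup>2 + y * z + z\<^sup>2 = 0" "z \<noteq> 0"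
    for x y z :: complex
  proof -
    have "y \<noteq> z"
    proof
      assume "y = z"
      then have "3 * z\<^sup>2 = 0" using that(3) by (simp add: power2_eq_square)
      then show False using that(4) by simp
    qed
    moreover have "(z - y) * (x + y + z) = (x\<^sup>2 + x * z + z\<^sup>2) - (x\<^sup>2 + x * y + y\<^sup>2)"
      by (simp add: algebra_simps power2_eq_square)
    ultimately have "x + y + z = 0" using that by auto
    then show ?thesis by (simp add: algebra_simps eq_neg_iff_add_eq_0)
  qed
  have "f c = - f a - f b" "f d = - f a - f b"
    using third[OF ab ac bc] third[OF ab ad' bd] nz u by blast+
  then have "3 * (f d)\<^sup>2 = 0" using cd by (simp add: power2_eq_square)
  then show False using nz[OF u(4)] by simp
qed

text \<open>The triangle opposite to the centre of the star splits into right and left ends; but in a triangle with two pentagonal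
sides both signs occur in one block.\<close>

lemma no_pentagonal_star:
  assumes u: "\<And>p. cmod (a p) = 1" "\<And>p. cmod (b p) = 1" "\<And>p. cmod (c p) = 1" "\<And>p. cmod (d p) = 1"
    and t3: "pentagonal (quotient b a) E" "pentagonal (quotient a c) F" and t2: "two_triples (quotient b c) P" "two_triples (quotient c d) Q" "two_triples (quotient b d) R"
    and ad: "admissible (quotient b a)" "admissible (quotient a c)" "admissible (quotient b c)" "admissible (quotient c d)" "admissible (quotient b d)"
  shows False
proof -
  have X: "two_triples (quotient b c) right_ends"
    using triangle_two_triples[OF ad(3) t2(1) ad(4) t2(2) ad(5) t2(3) quotient_trans[of c, OF u(3)]] by blast
  obtain m e f where "right_ends = {m, e, f}" "end_sign e = - end_sign m"
    using triangle_pentagonal[OF ad(1) t3(1) ad(2) t3(2) ad(3) X quotient_trans[of a, OF u(1)]] by metis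
  then have "m \<in> right_ends" "e \<in> right_ends" by auto
  then show False using \<open>end_sign e = - end_sign m\<close> by (simp add: end_sign_right_ends)
qed

text \<open>The four pentagonal sides form a square with two diagonals that split into triples. Comparing the complements of the
exceptional pairs shows that opposite sides have the same pair and that a block $m, e, f$ of the first diagonal has $e$, $f$ in
a common block of the second. Tenth powers on $m, e, f$ are proportional to $1,\omega,\omega^2$ along the first diagonal; along the second one the ratio
at $e$ is inverted while that at $f$ is kept, so $e$ and $f$ get equal values, which is impossible within a block.\<close>

lemma no_pentagonal_square:
  assumes u: "\<And>p. cmod (a p) = 1" "\<And>p. cmod (b p) = 1" "\<And>p. cmod (c p) = 1" "\<And>p. cmod (d p) = 1"
    and t3: "pentagonal (quotient a c) A" "pentagonal (quotient c b) B" "pentagonal (quotient b d) C" "pentagonal (quotient a d) D"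
    and t2: "two_triples (quotient a b) R" "two_triples (quotient c d) S0"
    and ad: "admissible (quotient a c)" "admissible (quotient c b)" "admissible (quotient b d)" "admissible (quotient a d)" "admissible (quotient a b)" "admissible (quotient c d)"
  shows False
proof -
  obtain m e f m' e' f' where R: "R = {m, e, f}" "- R = {m', e', f'}" "A = {e, e'}" "B = {f, f'}"
    and dist: "distinct [m, e, f, m', e', f']"
    and s: "end_sign e = - end_sign m" "end_sign f = - end_sign m" "end_sign m' = - end_sign m" "end_sign e' = end_sign m" "end_sign f' = end_sign m"
    using triangle_pentagonal[OF ad(1) t3(1) ad(2) t3(2) ad(5) t2(1) quotient_trans[of c, OF u(3)]] by metis
  have neq: "end_sign m \<noteq> - end_sign m" by (simp add: end_sign_def)
  obtain n g h n' g' h' where R': "R = {n, g, h}" "- R = {n', g', h'}" "D = {g, g'}" "C = {h, h'}"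
    and dist': "distinct [n, g, h, n', g', h']"
    and s': "end_sign g = - end_sign n" "end_sign h = - end_sign n" "end_sign n' = - end_sign n" "end_sign g' = end_sign n" "end_sign h' = end_sign n"
    using triangle_pentagonal[OF ad(4) t3(4) quotient_admissible_sym[OF ad(3)] quotient_pentagonal_sym[OF t3(3)] ad(5) t2(1) quotient_trans[of d, OF u(4)]]
    by metis
  have n: "n = m"
  proof (rule ccontr)
    assume "n \<noteq> m"
    then have "n = e \<or> n = f" using R(1) R'(1) by blast
    then show False
    proof
      assume "n = e"
      have "f \<in> {n, g, h}" using R(1) R'(1) by (metis insertCI)
      then have "f = g \<or> f = h" using dist \<open>n = e\<close> by auto
      then show False using s(1,2) s'(1,2) \<open>n = e\<close> neq by (metis minus_minus)
    next
      assume "n = f"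
      have "e \<in> {n, g, h}" using R(1) R'(1) by (metis insertCI)
      then have "e = g \<or> e = h" using dist \<open>n = f\<close> by auto
      then show False using s(1,2) s'(1,2) \<open>n = f\<close> neq by (metis minus_minus)
    qed
  qed
  have n': "n' = m'"
  proof -
    have "n' \<in> {m', e', f'}" using R(2) R'(2) by auto
    then show ?thesis using s(4,5) s'(3) n neq by (metis insertE singletonD)
  qed
  define S where "S = (if m \<in> S0 then S0 else - S0)"
  have S: "two_triples (quotient c d) S" "m \<in> S" using t2(2) two_triples_Compl by (auto simp: S_def)
  obtain k i j k' i' j' where S': "S = {k, i, j}" "- S = {k', i', j'}" "B = {i, i'}" "C = {j, j'}"
    and dist2: "distinct [k, i, j, k', i', j']"
    and s2: "end_sign i = - end_sign k" "end_sign j = - end_sign k" "end_sign k' = - end_sign k" "end_sign i' = end_sign k" "end_sign j' = end_sign k"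
    using triangle_pentagonal[OF ad(2) t3(2) ad(3) t3(3) ad(6) S(1) quotient_trans[of b, OF u(2)]] by metis
  have AB: "A \<union> B = - {m, m'}" using R dist by auto
  have CD: "C \<union> D = - {m, m'}" using R' dist' n n' by auto
  have BC: "B \<inter> C = {}" "B \<union> C = - {k, k'}" using S' dist2 by auto
  have CD0: "C \<inter> D = {}" using R' dist' by auto
  have AB0: "A \<inter> B = {}" using R dist by auto
  have cards: "card A = 2" "card C = 2" "card B = 2" "card D = 2"
    using R(3,4) R'(3,4) dist dist' by auto
  have "C \<subseteq> A" using AB CD BC(1) by blast
  then have CA: "C = A" using cards by (intro card_subset_eq) auto
  then have DB: "D = B" using AB CD CD0 AB0 by blast
  have "{k, k'} = {m, m'}" using BC(2) AB CA by blast
  moreover have "k' \<noteq> m" using S(2) S'(2) by blast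
  ultimately have k: "k = m" "k' = m'" by (metis doubleton_eq_iff)+
  have inS: "p \<in> S" if "p \<noteq> m'" "end_sign p = - end_sign m" for p
  proof (rule ccontr)
    assume "p \<notin> S"
    then have "p \<in> {k', i', j'}" using S'(2) by blast
    then show False using that k s2 neq by auto
  qed
  have eS: "e \<in> S" "f \<in> S" using inS s dist by auto
  \<comment> \<open>tenth powers kill the signs, so they multiply exactly along triangles\<close>
  define t where "t v w p = quotient v w p ^ 10" for v w p
  have tt: "t x z p = t x y p * t y z p" if "\<And>p. cmod (y p) = 1" for x y z p
    unfolding t_def quotient_trans[of y x z p, OF that] by (simp add: power_mult_distrib end_sign_power)
  have "t a b f = t a c m * t c b f" "t a b m = t a c m * t c b m"
    "t a b e = t a d m * t d b e" "t a b m = t a d m * t d b m"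
    "t c d e = t c b m * t b d e" "t c d f = t c b f * t b d m"
    using tt[of c a b f, OF u(3)] tt[of c a b m, OF u(3)] tt[of d a b e, OF u(4)] tt[of d a b m, OF u(4)]
      tt[of b c d e, OF u(2)] tt[of b c d f, OF u(2)]
      pentagonal_10[OF t3(1), of f m] pentagonal_10[OF t3(4), of e m] pentagonal_10[OF t3(2), of e m] pentagonal_10[OF t3(3), of f m]
      R(3,4) dist CA DB
    unfolding t_def by auto
  note f = this
  have inv: "t d b p * t b d p = 1" "t d b p \<noteq> 0" "t a c p \<noteq> 0" "t a d p \<noteq> 0" for p
  proof -
    have "quotient d b p * quotient b d p = 1"
      using unimodular_cnj[of "quotient d b p"] admissibleD(1)[OF quotient_admissible_sym[OF ad(3)]] quotient_sym[of b d] by simp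
    then have "(quotient d b p * quotient b d p) ^ 10 = 1" by simp
    then show 1: "t d b p * t b d p = 1" by (simp add: t_def power_mult_distrib)
    then show "t d b p \<noteq> 0" by auto
    show "t a c p \<noteq> 0" "t a d p \<noteq> 0" using admissibleD(2)[OF ad(1)] admissibleD(2)[OF ad(4)] by (simp_all add: t_def)
  qed
  have "quotient a b m * quotient a b m = quotient a b e * quotient a b f"
  proof (rule unimodular_zero_sum_triple(1))
    show "quotient a b m + quotient a b e + quotient a b f = 0"
      using t2(1) dist unfolding two_triples_def R(1) by (simp add: add.assoc)
  qed (simp_all add: admissibleD(1)[OF ad(5)])
  then have "(quotient a b m * quotient a b m) ^ 10 = (quotient a b e * quotient a b f) ^ 10" by simp
  then have sq: "t a b m * t a b m = t a b e * t a b f" by (simp add: t_def power_mult_distrib)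
  have "(t a c m * t a d m * t d b e * t d b m) * (t c b m * t b d e)
      = (t a c m * t c b m) * (t a d m * t d b m) * (t d b e * t b d e)" by (simp add: mult_ac)
  also have "\<dots> = t a b m * t a b m" by (simp only: f(2,4)[symmetric] inv) simp
  also have "\<dots> = (t a d m * t d b e) * (t a c m * t c b f)" by (simp only: sq f(1,3))
  also have "\<dots> = (t a d m * t d b e) * (t a c m * t c b f) * (t d b m * t b d m)" by (simp only: inv) simp
  also have "\<dots> = (t a c m * t a d m * t d b e * t d b m) * (t c b f * t b d m)" by (simp add: mult_ac)
  finally have "t c b m * t b d e = t c b f * t b d m" using inv by simp
  then have "quotient c d e ^ 10 = quotient c d f ^ 10" using f(5,6) by (simp add: t_def)
  then have "e = f" using two_triples_block_power(3)[OF ad(6) S(1), of e f] eS by simp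
  then show False using dist by simp
qed

text \<open>Colour the six sides by their kind. A triangle has no pentagonal side or exactly two, so splitting into triples is an
equivalence relation on the four vectors with at most two classes: all of them, three and one, or two and two.\<close>

lemma no_four_pairwise_admissible:
  assumes u: "\<And>v p. v \<in> {a, b, c, d} \<Longrightarrow> cmod (v p) = 1"
    and N: "N > 0" "\<And>v p. v \<in> {a, b, c, d} \<Longrightarrow> v p ^ N = 1"
    and ad0: "admissible (quotient a b)" "admissible (quotient a c)" "admissible (quotient a d)" "admissible (quotient b c)" "admissible (quotient b d)" "admissible (quotient c d)"
  shows False
proof -
  let ?S = "{a, b, c, d}"
  define ok where "ok x y \<longleftrightarrow> admissible (quotient x y)" for x y
  have ok: "ok a b" "ok a c" "ok a d" "ok b c" "ok b d" "ok c d"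
      "ok b a" "ok c a" "ok d a" "ok c b" "ok d b" "ok d c"
    using ad0 quotient_admissible_sym by (auto simp: ok_def)
  define two where "two x y \<longleftrightarrow> (\<exists>P. two_triples (quotient x y) P)" for x y
  have two_sym: "two x y \<Longrightarrow> two y x" for x y using quotient_two_triples_sym by (auto simp: two_def)
  have three: "\<exists>E. pentagonal (quotient x y) E" if H: "ok x y" "\<not> two x y" "x \<in> ?S" "y \<in> ?S" for x y
  proof -
    have "quotient x y p ^ (2 * N) = 1" for p
    proof -
      have "end_sign p ^ (2 * N) = 1" by (simp add: power_mult power2_eq_square)
      moreover have "x p ^ (2 * N) = 1" "cnj (y p) ^ (2 * N) = 1"
        using N(2)[OF H(3)] N(2)[OF H(4)] by (simp_all add: power_mult mult.commute[of 2] complex_cnj_power[symmetric] del: complex_cnj_power)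
      ultimately show ?thesis by (simp add: quotient_def power_mult_distrib)
    qed
    then have "antipodal (quotient x y) \<or> (\<exists>P. two_triples (quotient x y) P) \<or> (\<exists>E. pentagonal (quotient x y) E)"
      using H(1) N(1) unfolding ok_def by (intro classify[of _ "2 * N"]) (auto simp: admissibleD)
    then show ?thesis using H(1,2) admissibleD(4) unfolding ok_def two_def by blast
  qed
  have trans: "two x z" if H: "ok x y" "ok y z" "ok x z" "two x y" "two y z" "x \<in> ?S" "y \<in> ?S" "z \<in> ?S" for x y z
  proof (rule ccontr)
    assume "\<not> two x z"
    then obtain E where E: "pentagonal (quotient x z) E" using three H by blast
    obtain P Q where "two_triples (quotient x y) P" "two_triples (quotient y z) Q" using H by (auto simp: two_def)
    then show False
      using pentagonal_not_product_of_two_triples[OF _ _ _ _ E quotient_trans[of y]] H(1,2) u[OF H(7)] unfolding ok_def by blast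
  qed
  have odd: "two x z" if H: "ok x y" "ok y z" "ok x z" "\<not> two x y" "\<not> two y z" "x \<in> ?S" "y \<in> ?S" "z \<in> ?S" for x y z
  proof (rule ccontr)
    assume "\<not> two x z"
    then obtain E F D where "pentagonal (quotient x y) E" "pentagonal (quotient y z) F" "pentagonal (quotient x z) D" using three H by metis
    then show False
      using pentagonal_not_product_of_pentagonal[OF _ _ _ quotient_trans[of y x z, OF u[OF H(7)]]] admissibleD(2)[of "quotient x z"] H(3)
      unfolding ok_def by metis
  qed
  have star: False if H: "\<not> two x y" "\<not> two x z" "two y z" "two z w" "two y w"
    "ok x y" "ok x z" "ok y x" "ok y z" "ok z w" "ok y w" "x \<in> ?S" "y \<in> ?S" "z \<in> ?S" "w \<in> ?S" for x y z w
  proof -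
    have "\<not> two y x" using H(1) two_sym by blast
    then obtain E F where "pentagonal (quotient y x) E" "pentagonal (quotient x z) F" using three H by metis
    moreover obtain P Q R where "two_triples (quotient y z) P" "two_triples (quotient z w) Q" "two_triples (quotient y w) R"
      using H by (auto simp: two_def)
    ultimately show False
      using no_pentagonal_star[of x y z w E F P Q R] u H unfolding ok_def by metis
  qed
  have square: False if H: "two x y" "two z w" "\<not> two x z" "\<not> two z y" "\<not> two y w" "\<not> two x w"
    "ok x z" "ok z y" "ok y w" "ok x w" "ok x y" "ok z w" "x \<in> ?S" "y \<in> ?S" "z \<in> ?S" "w \<in> ?S" for x y z w
  proof -
    obtain A B C D where "pentagonal (quotient x z) A" "pentagonal (quotient z y) B" "pentagonal (quotient y w) C" "pentagonal (quotient x w) D"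
      using three H by metis
    moreover obtain P Q where "two_triples (quotient x y) P" "two_triples (quotient z w) Q"
      using H by (auto simp: two_def)
    ultimately show False
      using no_pentagonal_square[of x y z w A B C D P Q] u H unfolding ok_def by metis
  qed
  have S: "a \<in> ?S" "b \<in> ?S" "c \<in> ?S" "d \<in> ?S" by auto
  note tr = trans two_sym odd
  show False
  proof (cases "two a b"; cases "two a c"; cases "two a d")
    assume t: "two a b" "two a c" "two a d"
    have s: "two b c" "two b d" "two c d" using t tr ok S by metis+
    have X: "two_triples (quotient x y) right_ends" if H: "two x y" "two y z" "two x z" "ok x y" "ok y z" "ok x z" "y \<in> ?S" for x y z
    proof -
      obtain P Q R where "two_triples (quotient x y) P" "two_triples (quotient y z) Q" "two_triples (quotient x z) R" using H by (auto simp: two_def)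
      then show ?thesis
        using triangle_two_triples[OF _ _ _ _ _ _ quotient_trans[of y x z, OF u[OF H(7)]]] H unfolding ok_def by blast
    qed
    have "two_triples (quotient a b) right_ends" "two_triples (quotient a c) right_ends" "two_triples (quotient a d) right_ends" "two_triples (quotient b c) right_ends" "two_triples (quotient b d) right_ends" "two_triples (quotient c d) right_ends"
      using X[of a b c] X[of a c d] X[of a d b] X[of b c d] X[of b d c] X[of c d a] t s ok S two_sym by metis+
    then show False using no_four_parallel[of a b c d] u S ok unfolding ok_def by metis
  next
    assume t: "two a b" "two a c" "\<not> two a d"
    have "two b c" "\<not> two d b" "\<not> two d c" "\<not> two d a" using t tr ok S by metis+
    then show False using star[of d a b c] t ok S by metis
  next
    assume t: "two a b" "\<not> two a c" "two a d"
    have "two b d" "\<not> two c b" "\<not> two c d" "\<not> two c a" using t tr ok S by metis+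
    then show False using star[of c a b d] t ok S by metis
  next
    assume t: "\<not> two a b" "two a c" "two a d"
    have "two c d" "\<not> two b c" "\<not> two b d" "\<not> two b a" using t tr ok S by metis+
    then show False using star[of b a c d] t ok S by metis
  next
    assume t: "two a b" "\<not> two a c" "\<not> two a d"
    have "two c d" "\<not> two c b" "\<not> two b d" using t tr ok S by metis+
    then show False using square[of a b c d] t ok S by metis
  next
    assume t: "\<not> two a b" "two a c" "\<not> two a d"
    have "two b d" "\<not> two b c" "\<not> two c d" using t tr ok S by metis+
    then show False using square[of a c b d] t ok S by metis
  next
    assume t: "\<not> two a b" "\<not> two a c" "two a d"
    have "two b c" "\<not> two b d" "\<not> two d c" using t tr ok S by metis+
    then show False using square[of a d b c] t ok S by metis
  next
    assume t: "\<not> two a b" "\<not> two a c" "\<not> two a d"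
    have "two b c" "two c d" "two b d" using t tr ok S by metis+
    then show False using star[of a b c d] t ok S by metis
  qed
qed

section \<open>Orthogonality in $L^2$ of a set\<close>

definition ee :: "real \<Rightarrow> complex" where "ee x = cis (2 * pi * x)"

lemma ee_add: "ee (x + y) = ee x * ee y"
  by (simp add: ee_def cis_mult distrib_left)

lemma ee_0 [simp]: "ee 0 = 1" by (simp add: ee_def)

lemma cnj_ee: "cnj (ee x) = ee (- x)"
  by (simp add: ee_def cis_cnj)

lemma norm_ee [simp]: "cmod (ee x) = 1" by (simp add: ee_def)

lemma ee_neq0 [simp]: "ee x \<noteq> 0" by (simp add: ee_def)

lemma ee_of_int [simp]: "ee (of_int n) = 1"
  by (simp add: ee_def cis_multiple_2pi)

lemma ee_eq_1_iff: "ee x = 1 \<longleftrightarrow> x \<in> \<int>"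
proof
  assume "ee x = 1"
  then have "cos (2 * pi * x) = 1" by (simp add: ee_def complex_eq_iff)
  then obtain n :: int where "2 * pi * x = of_int n * 2 * pi" using cos_one_2pi_int by blast
  then have "x = of_int n" by simp
  then show "x \<in> \<int>" by simp
next
  assume "x \<in> \<int>"
  then show "ee x = 1" by (auto elim: Ints_cases)
qed

lemma ee_power: "ee x ^ n = ee (real n * x)"
  unfolding ee_def Complex.DeMoivre by (simp add: algebra_simps)

lemma continuous_on_ee [continuous_intros]: "continuous_on S f \<Longrightarrow> continuous_on S (\<lambda>x. ee (f x))"
  unfolding ee_def by (intro continuous_intros)

lemma exp_eq_ee: "exp (2 * of_real pi * \<i> * of_real l * of_real x) = ee (l * x)"
  by (simp add: ee_def cis_conv_exp mult_ac)

lemma expo_eq: "expo \<Omega> l x = of_real (1 / sqrt (measure lebesgue \<Omega>)) * ee (l * x) * indicator \<Omega> x"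
  by (simp only: expo_def exp_eq_ee)

lemma L2_product_integrable:
  assumes "f \<in> L2_fun M" "g \<in> L2_fun M"
  shows "integrable M (\<lambda>x. f x * cnj (g x))"
proof (rule Bochner_Integration.integrable_bound)
  show "integrable M (\<lambda>x. (cmod (f x))\<^sup>2 + (cmod (g x))\<^sup>2)"
    using assms by (simp add: L2_fun_def)
  show "(\<lambda>x. f x * cnj (g x)) \<in> borel_measurable M"
  proof (rule borel_measurable_times)
    have "cnj \<in> borel_measurable borel"
      by (intro borel_measurable_continuous_onI continuous_intros)
    then show "(\<lambda>x. cnj (g x)) \<in> borel_measurable M"
      using assms(2) measurable_compose[of g M borel cnj borel] by (simp add: L2_fun_def)
  qed (use assms in \<open>simp add: L2_fun_def\<close>)
  show "AE x in M. norm (f x * cnj (g x)) \<le> norm ((cmod (f x))\<^sup>2 + (cmod (g x))\<^sup>2)"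
  proof (intro always_eventually allI)
    fix x
    have "2 * (cmod (f x) * cmod (g x)) \<le> (cmod (f x))\<^sup>2 + (cmod (g x))\<^sup>2"
      using sum_squares_bound[of "cmod (f x)" "cmod (g x)"] by simp
    moreover have "0 \<le> cmod (f x) * cmod (g x)" by simp
    ultimately show "norm (f x * cnj (g x)) \<le> norm ((cmod (f x))\<^sup>2 + (cmod (g x))\<^sup>2)"
      unfolding norm_mult complex_mod_cnj real_norm_def by linarith
  qed
qed

text \<open>Subtracting anything from the span of the basis can only increase the norm of a function orthogonal to it.\<close>

lemma orthogonal_to_basis_imp_null:
  assumes b: "L2_orthonormal_basis M I e" and f: "f \<in> L2_fun M"
    and orth: "\<And>i. i \<in> I \<Longrightarrow> L2_inner M f (e i) = 0"
  shows "(LINT x|M. (cmod (f x))\<^sup>2) = 0"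
proof (rule ccontr)
  let ?n = "LINT x|M. (cmod (f x))\<^sup>2"
  assume "?n \<noteq> 0"
  then have pos: "?n > 0" by (simp add: order_less_le integral_nonneg_AE)
  then have "sqrt ?n > 0" by simp
  then obtain J c where J: "finite J" "J \<subseteq> I"
    and lt: "L2_norm M (\<lambda>x. f x - (\<Sum>i\<in>J. c i * e i x)) < sqrt ?n"
    using b f unfolding L2_orthonormal_basis_def by blast
  have e: "e i \<in> L2_fun M" if "i \<in> J" for i
    using b J that unfolding L2_orthonormal_basis_def by blast
  define s where "s x = (\<Sum>i\<in>J. c i * e i x)" for x
  have cs: "cnj (s x) = (\<Sum>i\<in>J. cnj (c i) * cnj (e i x))" for x by (simp add: s_def)
  have fs: "f x * cnj (s x) = (\<Sum>i\<in>J. cnj (c i) * (f x * cnj (e i x)))" for x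
    unfolding cs by (simp add: sum_distrib_left mult_ac)
  have ss: "s x * cnj (s x) = (\<Sum>i\<in>J. \<Sum>j\<in>J. (c i * cnj (c j)) * (e i x * cnj (e j x)))" for x
    unfolding cs by (simp add: s_def sum_product mult_ac)
  have intf: "integrable M (\<lambda>x. (cmod (f x))\<^sup>2)" using f by (simp add: L2_fun_def)
  have ifs: "integrable M (\<lambda>x. f x * cnj (s x))"
    unfolding fs using e by (intro Bochner_Integration.integrable_sum integrable_mult_right L2_product_integrable f)
  have "integrable M (\<lambda>x. s x * cnj (s x))"
    unfolding ss using e by (intro Bochner_Integration.integrable_sum integrable_mult_right L2_product_integrable)
  then have iss: "integrable M (\<lambda>x. (cmod (s x))\<^sup>2)"
    by (simp only: complex_norm_square[symmetric] complex_of_real_integrable_eq)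
  define r where "r = (\<lambda>x. Re (f x * cnj (s x)))"
  have expand: "(cmod (f x - s x))\<^sup>2 = (cmod (f x))\<^sup>2 - 2 * r x + (cmod (s x))\<^sup>2" for x
    unfolding r_def by (simp only: cmod_power2) (simp add: power2_eq_square algebra_simps)
  have ir: "integrable M r" using integrable_Re[OF ifs] by (simp only: r_def)
  have "(LINT x|M. f x * cnj (s x)) = (\<Sum>i\<in>J. cnj (c i) * L2_inner M f (e i))"
    unfolding fs L2_inner_def using e
    by (subst Bochner_Integration.integral_sum) (auto intro!: integrable_mult_right L2_product_integrable f)
  also have "\<dots> = 0" using orth J by (intro sum.neutral) auto
  finally have zero: "integral\<^sup>L M r = 0"
    using integral_Re[OF ifs] by (simp only: r_def) simp
  have "(LINT x|M. (cmod (f x - s x))\<^sup>2) =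
      ?n - 2 * integral\<^sup>L M r + (LINT x|M. (cmod (s x))\<^sup>2)"
    unfolding expand using intf ir iss by simp
  also have "\<dots> \<ge> ?n" using zero by (simp add: integral_nonneg_AE)
  finally have "sqrt ?n \<le> L2_norm M (\<lambda>x. f x - s x)"
    unfolding L2_norm_def by (rule real_sqrt_le_mono)
  then show False using lt unfolding s_def by simp
qed

section \<open>Exponentials on intervals and step functions\<close>

definition ee_integral :: "real \<Rightarrow> real \<Rightarrow> real \<Rightarrow> complex" where
  "ee_integral t a b = (if t = 0 then of_real (b - a) else (ee (t * b) - ee (t * a)) / (2 * of_real pi * \<i> * of_real t))"

lemma has_integral_ee:
  assumes "a \<le> b"
  shows "((\<lambda>x. ee (t * x)) has_integral ee_integral t a b) {a..b}"
proof (cases "t = 0")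
  case True
  have "((\<lambda>x::real. 1 :: complex) has_integral (b - a) *\<^sub>R 1) {a..b}"
    using has_integral_const_real[of "1 :: complex" a b] assms by simp
  then show ?thesis using True by (simp add: ee_integral_def scaleR_conv_of_real)
next
  case False
  let ?F = "\<lambda>x. ee (t * x) / (2 * of_real pi * \<i> * of_real t)"
  have "(?F has_vector_derivative ee (t * x)) (at x within {a..b})" for x
  proof -
    have "((\<lambda>x. exp (\<i> * of_real (2 * pi * t) * of_real x)) has_vector_derivative
        (\<i> * of_real (2 * pi * t)) * exp (\<i> * of_real (2 * pi * t) * of_real x)) (at x within {a..b})"
      by (rule has_vector_derivative_real_field) (auto intro!: derivative_eq_intros)
    then have "((\<lambda>x. ee (t * x)) has_vector_derivative (\<i> * of_real (2 * pi * t)) * ee (t * x)) (at x within {a..b})"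
      by (simp add: ee_def cis_conv_exp mult_ac)
    from has_vector_derivative_divide[OF this, of "2 * of_real pi * \<i> * of_real t"]
    show ?thesis using False by (simp add: mult_ac)
  qed
  then have "((\<lambda>x. ee (t * x)) has_integral (?F b - ?F a)) {a..b}"
    using assms by (intro fundamental_theorem_of_calculus) auto
  then show ?thesis using False by (simp add: ee_integral_def diff_divide_distrib)
qed

lemma ee_integral_shift: "ee_integral t (a + h) (b + h) = ee (t * h) * ee_integral t a b"
  by (simp add: ee_integral_def distrib_left ee_add algebra_simps diff_divide_distrib)

lemma interval_lebesgue_integral:
  assumes \<Omega>: "\<Omega> \<in> sets lebesgue" and J: "{a..<b} \<subseteq> \<Omega>" and ab: "a \<le> b"
  shows "integrable (lebesgue_on \<Omega>) (\<lambda>x. indicator {a..<b} x * ee (t * x))"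
    and "(LINT x|lebesgue_on \<Omega>. indicator {a..<b} x * ee (t * x)) = ee_integral t a b"
proof -
  let ?g = "\<lambda>x. indicator {a..<b} x *\<^sub>R ee (t * x)"
  have ind: "indicator \<Omega> x *\<^sub>R (indicator {a..<b} x * ee (t * x)) = ?g x" for x
    using J by (auto simp: indicator_def)
  have "set_integrable lborel {a..b} (\<lambda>x. ee (t * x))"
    unfolding set_integrable_def by (rule borel_integrable_compact) (auto intro!: continuous_intros)
  then have si: "set_integrable lborel {a..<b} (\<lambda>x. ee (t * x))"
    by (rule set_integrable_subset) auto
  then have ig: "integrable lborel ?g" by (simp add: set_integrable_def)
  then have ig': "integrable lebesgue ?g" by (subst integrable_completion) auto
  then show "integrable (lebesgue_on \<Omega>) (\<lambda>x. indicator {a..<b} x * ee (t * x))"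
    using \<Omega> by (subst integrable_restrict_space) (auto simp: ind)
  have "(LINT x|lebesgue_on \<Omega>. indicator {a..<b} x * ee (t * x)) = (LINT x|lebesgue. ?g x)"
    using \<Omega> by (subst integral_restrict_space) (auto simp: ind)
  also have "\<dots> = (LINT x|lborel. ?g x)"
    using ig by (intro integral_completion) auto
  also have "\<dots> = integral {a..<b} (\<lambda>x. ee (t * x))"
    using set_borel_integral_eq_integral(2)[OF si] by (simp add: set_lebesgue_integral_def)
  also have "\<dots> = integral {a..b} (\<lambda>x. ee (t * x))"
  proof (rule integral_spike_set)
    show "negligible {x \<in> {a..<b} - {a..b}. ee (t * x) \<noteq> 0}"
      by (rule negligible_subset[of "{}"]) auto
    show "negligible {x \<in> {a..b} - {a..<b}. ee (t * x) \<noteq> 0}"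
      by (rule negligible_subset[of "{b}"]) auto
  qed
  also have "\<dots> = ee_integral t a b" using has_integral_ee[OF ab] by (rule integral_unique)
  finally show "(LINT x|lebesgue_on \<Omega>. indicator {a..<b} x * ee (t * x)) = ee_integral t a b" .
qed

text \<open>Translating an interval by $h$ multiplies the integral of $e(-lx)$ by $e(-lh)$. Hence the inner product of the step
function with weights $c_k$ and an exponential factors into $\sum_k c_k e(-l h_k)$ and an integral that does not depend on $k$.\<close>

lemma step_function_null:
  assumes sp: "is_spectrum \<Omega> \<Lambda>" and K: "finite K" and \<eta>: "\<eta> > 0"
    and sub: "\<And>k. k \<in> K \<Longrightarrow> {p + h k..<p + h k + \<eta>} \<subseteq> \<Omega>"
    and disj: "\<And>k l. k \<in> K \<Longrightarrow> l \<in> K \<Longrightarrow> k \<noteq> l \<Longrightarrow> {p + h k..<p + h k + \<eta>} \<inter> {p + h l..<p + h l + \<eta>} = {}"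
    and zero: "\<And>l. l \<in> \<Lambda> \<Longrightarrow> (\<Sum>k\<in>K. c k * ee (- (l * h k))) = 0"
    and k: "k \<in> K"
  shows "c k = 0"
proof -
  let ?M = "lebesgue_on \<Omega>"
  let ?J = "\<lambda>k. {p + h k..<p + h k + \<eta>}"
  have \<Omega>: "\<Omega> \<in> sets lebesgue" and basis: "L2_orthonormal_basis ?M \<Lambda> (expo \<Omega>)"
    using sp by (auto simp: is_spectrum_def)
  define f where "f x = (\<Sum>k\<in>K. c k * indicator (?J k) x)" for x :: real
  have J: "?J k \<in> sets ?M" if "k \<in> K" for k
    using sub[OF that] \<Omega> by (auto simp: sets_restrict_space_iff)
  have fsq: "(cmod (f x))\<^sup>2 = (\<Sum>k\<in>K. (cmod (c k))\<^sup>2 * indicator (?J k) x)" for x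
  proof (cases "\<exists>k\<in>K. x \<in> ?J k")
    case True
    then obtain k where k: "k \<in> K" "x \<in> ?J k" by blast
    then have other: "x \<notin> ?J l" if "l \<in> K" "l \<noteq> k" for l using disj[of l k] that by blast
    have "f x = (\<Sum>l\<in>K. if l = k then c l else 0)"
      unfolding f_def using k other by (intro sum.cong) (auto simp: indicator_def)
    moreover have "(\<Sum>l\<in>K. (cmod (c l))\<^sup>2 * indicator (?J l) x) = (\<Sum>l\<in>K. if l = k then (cmod (c l))\<^sup>2 else 0)"
      using k other by (intro sum.cong) (auto simp: indicator_def)
    ultimately show ?thesis using k K by simp
  next
    case False
    then have "f x = 0" "(\<Sum>k\<in>K. (cmod (c k))\<^sup>2 * indicator (?J k) x) = 0"
      unfolding f_def by (intro sum.neutral; auto simp: indicator_def)+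
    then show ?thesis by simp
  qed
  have int_ind: "integrable ?M (\<lambda>x. indicator (?J k) x * ee (t * x))"
    "(LINT x|?M. indicator (?J k) x * ee (t * x)) = ee_integral t (p + h k) (p + h k + \<eta>)" if "k \<in> K" for k t
    using interval_lebesgue_integral[OF \<Omega> sub[OF that]] \<eta> by auto
  have int1: "integrable ?M (\<lambda>x. indicator (?J k) x :: complex)"
    "(LINT x|?M. indicator (?J k) x :: complex) = of_real \<eta>" if "k \<in> K" for k
    using int_ind[OF that, of 0] by (simp_all add: ee_integral_def)
  have csq: "complex_of_real ((cmod (f x))\<^sup>2) = (\<Sum>k\<in>K. of_real ((cmod (c k))\<^sup>2) * indicator (?J k) x)" for x
    unfolding fsq by (simp add: of_real_indicator)
  have intsq: "integrable ?M (\<lambda>x. complex_of_real ((cmod (f x))\<^sup>2))"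
    unfolding csq by (intro Bochner_Integration.integrable_sum integrable_mult_right int1)
  have f: "f \<in> L2_fun ?M"
  proof -
    have "f \<in> borel_measurable ?M"
      unfolding f_def using J by (intro borel_measurable_sum borel_measurable_times) auto
    then show ?thesis using intsq by (simp only: L2_fun_def mem_Collect_eq integrable_of_real complex_of_real_integrable_eq)
  qed
  have "L2_inner ?M f (expo \<Omega> l) = 0" if l: "l \<in> \<Lambda>" for l
  proof -
    define C :: complex where "C = of_real (1 / sqrt (measure lebesgue \<Omega>))"
    have "f x * cnj (expo \<Omega> l x) = (\<Sum>k\<in>K. (C * c k) * (indicator (?J k) x * ee (- l * x)))" for x
    proof -
      have "cnj (expo \<Omega> l x) = C * ee (- l * x) * indicator \<Omega> x"
        by (simp add: expo_eq C_def cnj_ee indicator_def)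
      then have "f x * cnj (expo \<Omega> l x) = (\<Sum>k\<in>K. c k * indicator (?J k) x * (C * ee (- l * x) * indicator \<Omega> x))"
        by (simp only: f_def sum_distrib_right)
      also have "\<dots> = (\<Sum>k\<in>K. (C * c k) * (indicator (?J k) x * ee (- l * x)))"
      proof (rule sum.cong[OF refl])
        fix k assume "k \<in> K"
        then show "c k * indicator (?J k) x * (C * ee (- l * x) * indicator \<Omega> x) =
            C * c k * (indicator (?J k) x * ee (- l * x))"
          using subsetD[OF sub[of k], of x] by (cases "x \<in> ?J k") (simp_all add: indicator_def)
      qed
      finally show ?thesis .
    qed
    then have "L2_inner ?M f (expo \<Omega> l) = (LINT x|?M. (\<Sum>k\<in>K. (C * c k) * (indicator (?J k) x * ee (- l * x))))"
      by (simp add: L2_inner_def)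
    also have "\<dots> = (\<Sum>k\<in>K. (C * c k) * (LINT x|?M. indicator (?J k) x * ee (- l * x)))"
      by (subst Bochner_Integration.integral_sum) (auto intro!: integrable_mult_right int_ind(1)[where t = "- l", simplified])
    also have "\<dots> = (\<Sum>k\<in>K. (C * c k) * (ee (- l * h k) * ee_integral (- l) p (p + \<eta>)))"
    proof (rule sum.cong)
      fix k assume "k \<in> K"
      then show "(C * c k) * (LINT x|?M. indicator (?J k) x * ee (- l * x)) =
          (C * c k) * (ee (- l * h k) * ee_integral (- l) p (p + \<eta>))"
        unfolding int_ind(2)[OF \<open>k \<in> K\<close>] ee_integral_shift[symmetric] by (simp add: add_ac)
    qed simp
    also have "\<dots> = C * ee_integral (- l) p (p + \<eta>) * (\<Sum>k\<in>K. c k * ee (- (l * h k)))"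
      by (simp add: sum_distrib_left mult_ac)
    also have "\<dots> = 0" using zero[OF l] by simp
    finally show ?thesis .
  qed
  from orthogonal_to_basis_imp_null[OF basis f this]
  have "(LINT x|?M. complex_of_real ((cmod (f x))\<^sup>2)) = 0"
    by (simp only: integral_complex_of_real of_real_0)
  moreover have "(LINT x|?M. complex_of_real ((cmod (f x))\<^sup>2)) = (\<Sum>k\<in>K. of_real ((cmod (c k))\<^sup>2) * of_real \<eta>)"
    unfolding csq by (subst Bochner_Integration.integral_sum) (auto intro!: integrable_mult_right int1 simp: int1)
  ultimately have "complex_of_real (\<Sum>k\<in>K. (cmod (c k))\<^sup>2 * \<eta>) = 0" by simp
  then have "(\<Sum>k\<in>K. (cmod (c k))\<^sup>2 * \<eta>) = 0" by (simp only: of_real_eq_0_iff)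
  then have "(cmod (c k))\<^sup>2 * \<eta> = 0"
    using \<eta> K k by (subst (asm) sum_nonneg_eq_0_iff) auto
  then show ?thesis using \<eta> by simp
qed

lemma spectrum_endpoint_sum:
  fixes l m :: real
  assumes sp: "is_spectrum \<Omega> \<Lambda>" and lm: "l \<in> \<Lambda>" "m \<in> \<Lambda>" "l \<noteq> m" and I: "finite I"
    and \<Omega>: "\<Omega> = (\<Union>i\<in>I. {a i..<b i})" and ab: "\<And>i. i \<in> I \<Longrightarrow> a i \<le> b i"
    and disj: "disjoint_family_on (\<lambda>i. {a i..<b i}) I"
  shows "(\<Sum>i\<in>I. ee ((l - m) * b i) - ee ((l - m) * a i)) = 0"
proof -
  let ?M = "lebesgue_on \<Omega>"
  have \<Omega>s: "\<Omega> \<in> sets lebesgue" using sp by (auto simp: is_spectrum_def)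
  define C :: complex where "C = of_real (1 / sqrt (measure lebesgue \<Omega>))"
  have "measure lebesgue \<Omega> > 0"
    using sp by (auto simp: is_spectrum_def measure_def enn2real_positive_iff)
  then have C: "C \<noteq> 0" by (simp add: C_def)
  have sub: "{a i..<b i} \<subseteq> \<Omega>" if "i \<in> I" for i using that \<Omega> by blast
  have ind: "indicator \<Omega> x = (\<Sum>i\<in>I. indicator {a i..<b i} x :: complex)" for x
    unfolding \<Omega> using I disj by (rule indicator_UN_disjoint)
  have "expo \<Omega> l x * cnj (expo \<Omega> m x) = (\<Sum>i\<in>I. C\<^sup>2 * (indicator {a i..<b i} x * ee ((l - m) * x)))" for x
  proof -
    have "expo \<Omega> l x * cnj (expo \<Omega> m x) = C\<^sup>2 * ee ((l - m) * x) * indicator \<Omega> x"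
      using ee_add[of "l * x" "- (m * x)"]
      by (simp add: expo_eq C_def cnj_ee indicator_def power2_eq_square algebra_simps)
    then show ?thesis unfolding ind by (simp add: sum_distrib_left mult_ac)
  qed
  then have "L2_inner ?M (expo \<Omega> l) (expo \<Omega> m) = (LINT x|?M. (\<Sum>i\<in>I. C\<^sup>2 * (indicator {a i..<b i} x * ee ((l - m) * x))))"
    by (simp add: L2_inner_def)
  also have "\<dots> = (\<Sum>i\<in>I. C\<^sup>2 * ee_integral (l - m) (a i) (b i))"
    by (subst Bochner_Integration.integral_sum)
       (auto intro!: integrable_mult_right interval_lebesgue_integral(1)[OF \<Omega>s sub ab]
             simp: interval_lebesgue_integral(2)[OF \<Omega>s sub ab])
  also have "\<dots> = C\<^sup>2 / (2 * of_real pi * \<i> * of_real (l - m)) * (\<Sum>i\<in>I. ee ((l - m) * b i) - ee ((l - m) * a i))"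
    using lm by (simp add: ee_integral_def sum_distrib_left)
  finally have "C\<^sup>2 / (2 * of_real pi * \<i> * of_real (l - m)) * (\<Sum>i\<in>I. ee ((l - m) * b i) - ee ((l - m) * a i)) = 0"
    using sp lm by (auto simp: is_spectrum_def L2_orthonormal_basis_def)
  then show ?thesis using C lm by simp
qed

section \<open>Packings by a lattice\<close>

subsection \<open>Packings by a lattice\<close>

text \<open>Cut $\Omega$ at the lattice points and move all pieces into one fundamental interval. The pieces stay disjoint, so the total
measure is at most $1/d$, and in case of equality the part of the interval that is missed is null.\<close>

lemma lattice_packing:
  fixes \<Omega> :: "real set" and d :: nat
  assumes \<Omega>: "\<Omega> \<in> sets lebesgue" "\<Omega> \<subseteq> {0..<L}" and d: "d > 0"
    and pack: "\<And>x m. x \<in> \<Omega> \<Longrightarrow> x + of_int m / d \<in> \<Omega> \<Longrightarrow> m = 0"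
  shows "measure lebesgue \<Omega> \<le> 1 / d"
    and "measure lebesgue \<Omega> = 1 / d \<Longrightarrow> negligible (- (\<Union>m::int. (\<lambda>x. x + of_int m / d) ` \<Omega>))"
proof -
  obtain n :: nat where n: "L * d \<le> n" using real_arch_simple by blast
  define P where "P k = \<Omega> \<inter> {real k / d..<(real k + 1) / d}" for k
  define C where "C k = (\<lambda>x. x - real k / d) ` P k" for k
  define U where "U = (\<Union>k<n. C k)"
  have lm: "\<Omega> \<in> lmeasurable"
    by (rule bounded_set_imp_lmeasurable[OF bounded_subset[OF _ \<Omega>(2)] \<Omega>(1)]) simp
  have Pm: "P k \<in> lmeasurable" for k
    unfolding P_def using lm by (intro fmeasurable_Int_fmeasurable) auto
  have Cm: "C k \<in> lmeasurable" for k
    unfolding C_def by (rule measurable_translation_subtract[OF Pm])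
  have Um: "U \<in> lmeasurable" unfolding U_def by (intro fmeasurable.finite_UN Cm) auto
  have \<Omega>P: "\<Omega> = (\<Union>k<n. P k)"
  proof
    show "\<Omega> \<subseteq> (\<Union>k<n. P k)"
    proof
      fix x assume x: "x \<in> \<Omega>"
      then have x0: "0 \<le> x" "x < L" using \<Omega>(2) by auto
      then have fl: "real (nat \<lfloor>x * d\<rfloor>) \<le> x * d" "x * d < real (nat \<lfloor>x * d\<rfloor>) + 1" by simp_all
      have "x * d < L * d" using x0 d by simp
      then have "real (nat \<lfloor>x * d\<rfloor>) < n" using fl n by linarith
      then have "nat \<lfloor>x * d\<rfloor> < n" by simp
      moreover have "x \<in> P (nat \<lfloor>x * d\<rfloor>)" using x fl d by (simp add: P_def field_simps)
      ultimately show "x \<in> (\<Union>k<n. P k)" by blast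
    qed
  qed (auto simp: P_def)
  have dP: "pairwise (\<lambda>i j. disjnt (P i) (P j)) {..<n}"
  proof (rule pairwiseI)
    fix i j :: nat assume "i \<noteq> j"
    show "disjnt (P i) (P j)"
    proof (rule ccontr)
      assume "\<not> disjnt (P i) (P j)"
      then obtain x where "real i / d \<le> x" "x < (real i + 1) / d" "real j / d \<le> x" "x < (real j + 1) / d"
        by (auto simp: disjnt_def P_def)
      then have "real i \<le> x * d" "x * d < real i + 1" "real j \<le> x * d" "x * d < real j + 1"
        using d by (simp_all add: field_simps)
      then have "real i < real j + 1" "real j < real i + 1" by linarith+
      then show False using \<open>i \<noteq> j\<close> by linarith
    qed
  qed
  have dC: "pairwise (\<lambda>i j. disjnt (C i) (C j)) {..<n}"
  proof (rule pairwiseI)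
    fix i j :: nat assume "i \<noteq> j"
    show "disjnt (C i) (C j)"
    proof (rule ccontr)
      assume "\<not> disjnt (C i) (C j)"
      then obtain x y where xy: "x \<in> \<Omega>" "y \<in> \<Omega>" "x - real i / d = y - real j / d"
        by (auto simp: disjnt_def C_def P_def)
      then have "y = x + of_int (int j - int i) / d" by (simp add: diff_divide_distrib)
      then have "int j - int i = 0" using pack[of x] xy by metis
      then show False using \<open>i \<noteq> j\<close> by simp
    qed
  qed
  have "measure lebesgue U = (\<Sum>k<n. measure lebesgue (C k))"
    unfolding U_def by (rule measure_UNION') (use Cm dC in auto)
  also have "\<dots> = (\<Sum>k<n. measure lebesgue (P k))"
    by (simp add: C_def measure_translation_subtract)
  also have "\<dots> = measure lebesgue \<Omega>"
    unfolding \<Omega>P by (rule measure_UNION'[symmetric]) (use Pm dP in auto)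
  finally have mU: "measure lebesgue U = measure lebesgue \<Omega>" .
  have Usub: "U \<subseteq> {0..<1 / d}"
    by (auto simp: U_def C_def P_def add_divide_distrib)
  have I: "{0..<1 / real d} \<in> lmeasurable" "measure lebesgue {0..<1 / real d} = 1 / d"
    by (rule bounded_set_imp_lmeasurable) simp_all
  show "measure lebesgue \<Omega> \<le> 1 / d"
    using measure_mono_fmeasurable[OF Usub _ I(1)] Um I(2) mU by auto
  assume full: "measure lebesgue \<Omega> = 1 / d"
  define N where "N = {0..<1 / real d} - U"
  have "measure lebesgue N = 0"
    unfolding N_def using measurable_measure_Diff[OF I(1) _ Usub] Um mU full I(2) by auto
  moreover have "N \<in> lmeasurable" unfolding N_def using I(1) Um by (intro fmeasurable.Diff) auto
  ultimately have N: "negligible N" by (simp add: negligible_iff_measure)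
  have "negligible (\<Union>m::int. (+) (of_int m / d) ` N)"
    by (rule negligible_countable_Union) (auto intro: negligible_translation[OF N])
  moreover have "- (\<Union>m::int. (\<lambda>x. x + of_int m / d) ` \<Omega>) \<subseteq> (\<Union>m::int. (+) (of_int m / d) ` N)"
  proof
    fix y assume y: "y \<in> - (\<Union>m::int. (\<lambda>x. x + of_int m / d) ` \<Omega>)"
    define m where "m = \<lfloor>y * d\<rfloor>"
    define x where "x = y - of_int m / d"
    have "of_int m \<le> y * d" "y * d < of_int m + 1" by (simp_all add: m_def)
    then have "of_int m / d \<le> y" "y < (of_int m + 1) / d"
      using d by (simp_all add: pos_divide_le_eq pos_less_divide_eq)
    then have x: "x \<in> {0..<1 / real d}" by (simp add: x_def add_divide_distrib)
    have "x \<notin> U"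
    proof
      assume "x \<in> U"
      then obtain k w where w: "w \<in> \<Omega>" "x = w - real k / d" by (auto simp: U_def C_def P_def)
      then have "y = w + of_int (m - int k) / d" by (simp add: x_def diff_divide_distrib)
      then show False using y w by blast
    qed
    then have "x \<in> N" using x by (simp add: N_def)
    then show "y \<in> (\<Union>m::int. (+) (of_int m / d) ` N)"
      by (intro UN_I[of m] image_eqI[of _ _ x]) (simp_all add: x_def)
  qed
  ultimately show "negligible (- (\<Union>m::int. (\<lambda>x. x + of_int m / d) ` \<Omega>))"
    using negligible_subset by blast
qed

text \<open>All exponentials with frequencies in $d\mathbb{Z}$ are $1/d$-periodic. If $\Omega$ contained two short intervals that differ by
a non-zero element of $\frac1d\mathbb{Z}$, the difference of their indicator functions would be orthogonal to all of
them. So the translates by $\frac1d\mathbb{Z}$ are disjoint, and the measure of $\Omega$ leaves only $d = 1$.\<close>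

lemma lattice_spectrum_tiles:
  fixes d :: nat
  assumes sp: "is_spectrum \<Omega> (int_multiples (real d))" and d: "d > 0"
    and \<Omega>: "\<Omega> \<subseteq> {0..<L}" "measure lebesgue \<Omega> = 1"
    and right: "\<And>x. x \<in> \<Omega> \<Longrightarrow> \<exists>\<eta>>0. {x..<x + \<eta>} \<subseteq> \<Omega>"
  shows "tiles_by_translations \<Omega>"
proof -
  have \<Omega>m: "\<Omega> \<in> sets lebesgue" using sp by (simp add: is_spectrum_def)
  have pack: "m = 0" if x: "x \<in> \<Omega>" "x + of_int m / d \<in> \<Omega>" for x and m :: int
  proof (rule ccontr)
    assume m: "m \<noteq> 0"
    obtain \<eta>1 \<eta>2 where \<eta>: "\<eta>1 > 0" "{x..<x + \<eta>1} \<subseteq> \<Omega>" "\<eta>2 > 0"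
      "{x + of_int m / d..<x + of_int m / d + \<eta>2} \<subseteq> \<Omega>"
      using right x by blast
    define \<eta> where "\<eta> = min (min \<eta>1 \<eta>2) (1 / d)"
    have \<eta>pos: "\<eta> > 0" "\<eta> \<le> \<eta>1" "\<eta> \<le> \<eta>2" "\<eta> \<le> 1 / d" using \<eta> d by (auto simp: \<eta>_def)
    have "\<bar>of_int m / real d\<bar> \<ge> 1 / d" using m d by (simp add: abs_divide divide_right_mono)
    then have gap: "\<eta> \<le> \<bar>of_int m / real d\<bar>" using \<eta>pos by linarith
    define h where "h k = (if k = (0::nat) then 0 else of_int m / real d)" for k
    define c :: "nat \<Rightarrow> complex" where "c k = (if k = 0 then 1 else - 1)" for k
    have "c 0 = 0"
    proof (rule step_function_null[OF sp, of "{0, 1}" \<eta> x h c 0])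
      show "{x + h k..<x + h k + \<eta>} \<subseteq> \<Omega>" if "k \<in> {0, 1}" for k
        using that \<eta> \<eta>pos by (auto simp: h_def subset_iff)
      show "{x + h k..<x + h k + \<eta>} \<inter> {x + h l..<x + h l + \<eta>} = {}" if "k \<in> {0, 1}" "l \<in> {0, 1}" "k \<noteq> l" for k l
        using that gap by (auto simp: h_def)
      show "(\<Sum>k\<in>{0, 1}. c k * ee (- (l * h k))) = 0" if l: "l \<in> int_multiples (real d)" for l
      proof -
        obtain n where "l = d * of_int n" using l by (auto simp: int_multiples_def)
        then have "- (l * h 1) = of_int (- (n * m))" using d by (simp add: h_def)
        then have "ee (- (l * h 1)) = 1" by (simp only: ee_of_int)
        moreover have "ee (- (l * h 0)) = 1" by (simp add: h_def)
        ultimately show ?thesis by (simp add: c_def)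
      qed
    qed (use \<eta>pos in auto)
    then show False by (simp add: c_def)
  qed
  note lp = lattice_packing[OF \<Omega>m \<Omega>(1) d pack]
  have "real d \<le> 1" using lp(1) \<Omega>(2) d by (simp add: field_simps)
  then have d1: "d = 1" using d by simp
  have neg: "negligible (- (\<Union>m::int. (\<lambda>x. x + of_int m) ` \<Omega>))" using lp(2) \<Omega>(2) by (simp add: d1)
  show ?thesis unfolding tiles_by_translations_def
  proof (intro exI[of _ "range real_of_int"] conjI ballI impI)
    fix s t assume st: "s \<in> range real_of_int" "t \<in> range real_of_int" "s \<noteq> t"
    then obtain i j where ij: "s = of_int i" "t = of_int j" by blast
    have "(\<lambda>x. x + s) ` \<Omega> \<inter> (\<lambda>x. x + t) ` \<Omega> = {}"
    proof (rule ccontr)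
      assume "(\<lambda>x. x + s) ` \<Omega> \<inter> (\<lambda>x. x + t) ` \<Omega> \<noteq> {}"
      then obtain x y where xy: "x \<in> \<Omega>" "y \<in> \<Omega>" "x + s = y + t" by auto
      then have "y = x + of_int (i - j) / d" by (simp add: ij d1)
      then have "i - j = 0" using pack[of x "i - j"] xy by simp
      then show False using st ij by simp
    qed
    then show "negligible ((\<lambda>x. x + s) ` \<Omega> \<inter> (\<lambda>x. x + t) ` \<Omega>)" by simp
  next
    have "(\<Union>t\<in>range real_of_int. (\<lambda>x. x + t) ` \<Omega>) = (\<Union>m::int. (\<lambda>x. x + of_int m) ` \<Omega>)" by blast
    then show "negligible (- (\<Union>t\<in>range real_of_int. (\<lambda>x. x + t) ` \<Omega>))" using neg by simp
  qed
qed

section \<open>Three unit cells\<close>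

text \<open>The relation $A j' = B j$ with $j \equiv -j' \not\equiv 0$ modulo $3$ forces $A = 3^k\alpha$ and $B = 3^k\beta$ with $0$, $\alpha$,
$\beta$ pairwise incongruent modulo $3$. Then every integer is uniquely the sum of an element of $\{0, A, B\}$ and an integer
whose ternary digit at place $k$ is $0$.\<close>

lemma three_cells_tile:
  fixes A B j j' :: int
  assumes A: "A \<noteq> 0" and j: "\<not> 3 dvd j" "\<not> 3 dvd j'" "3 dvd j + j'" and cross: "A * j' = B * j"
    and \<Omega>: "\<Omega> = {x. \<lfloor>3 * x\<rfloor> \<in> {0, A, B}}"
  shows "tiles_by_translations \<Omega>"
proof -
  have p3: "prime (3 :: int)" by simp
  obtain \<alpha> where "A = 3 ^ multiplicity 3 A * \<alpha>" "\<not> 3 dvd \<alpha>"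
    using multiplicity_decompose'[of A 3] A by auto
  then obtain k where k: "A = 3 ^ k * \<alpha>" "\<not> 3 dvd \<alpha>" by blast
  have "3 ^ k dvd B * j" using cross k by (metis dvd_mult2 dvd_triv_left)
  moreover have "coprime (3 ^ k) j" using j(1) p3 by (simp add: prime_imp_coprime)
  ultimately have "3 ^ k dvd B" by (simp add: coprime_dvd_mult_left_iff)
  then obtain \<beta> where \<beta>: "B = 3 ^ k * \<beta>" by (auto simp: dvd_def)
  have cr: "\<alpha> * j' = \<beta> * j" using cross unfolding k(1) \<beta> by simp
  have "\<alpha> * (j + j') = j * (\<alpha> + \<beta>)" using cr by (simp add: algebra_simps)
  then have "3 dvd j * (\<alpha> + \<beta>)" using j(3) by (metis dvd_mult)
  then have ab: "3 dvd \<alpha> + \<beta>" using j(1) p3 prime_dvd_mult_iff by blast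
  define q where "q = (3 ^ k :: int)"
  have q0: "q > 0" by (simp add: q_def)
  have AB: "A = q * \<alpha>" "B = q * \<beta>" using k \<beta> by (simp_all add: q_def)
  have shift: "(n - q * g) div q = n div q - g" for n g :: int
    using q0 by (metis add_diff_cancel_left' diff_add_cancel div_mult_self2 less_irrefl add.commute)
  have m3: "\<alpha> mod 3 \<noteq> 0" "\<beta> mod 3 = (- \<alpha>) mod 3"
    using k(2) ab by presburger+
  \<comment> \<open>the integers whose ternary digit at place \<open>k\<close> vanishes\<close>
  define Z where "Z = {t :: int. 3 dvd t div q}"
  have unique: "\<exists>!t. t \<in> Z \<and> n - t \<in> {0, A, B}" for n
  proof -
    define c where "c = n div q"
    have Z: "n \<in> Z \<longleftrightarrow> 3 dvd c" "n - A \<in> Z \<longleftrightarrow> 3 dvd c - \<alpha>" "n - B \<in> Z \<longleftrightarrow> 3 dvd c - \<beta>"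
      by (simp_all add: Z_def c_def AB shift)
    have "(3 dvd c \<and> \<not> 3 dvd c - \<alpha> \<and> \<not> 3 dvd c - \<beta>) \<or> (\<not> 3 dvd c \<and> 3 dvd c - \<alpha> \<and> \<not> 3 dvd c - \<beta>)
        \<or> (\<not> 3 dvd c \<and> \<not> 3 dvd c - \<alpha> \<and> 3 dvd c - \<beta>)"
    proof -
      have "3 dvd c \<longleftrightarrow> c mod 3 = 0" "3 dvd c - \<alpha> \<longleftrightarrow> c mod 3 = \<alpha> mod 3" "3 dvd c - \<beta> \<longleftrightarrow> c mod 3 = \<beta> mod 3"
        by (simp_all add: mod_eq_dvd_iff dvd_eq_mod_eq_0)
      moreover have "\<alpha> mod 3 = 1 \<and> \<beta> mod 3 = 2 \<or> \<alpha> mod 3 = 2 \<and> \<beta> mod 3 = 1"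
        using m3 by presburger
      moreover have "c mod 3 = 0 \<or> c mod 3 = 1 \<or> c mod 3 = 2" by presburger
      ultimately show ?thesis by (elim disjE conjE) (simp_all only: simp_thms, simp_all)
    qed
    moreover have "t \<in> Z \<and> n - t \<in> {0, A, B} \<longleftrightarrow> t \<in> Z \<and> (t = n \<or> t = n - A \<or> t = n - B)" for t by auto
    ultimately show ?thesis using Z by metis
  qed
  define T where "T = (\<lambda>t. real_of_int t / 3) ` Z"
  have mem: "x \<in> (\<lambda>y. y + real_of_int t / 3) ` \<Omega> \<longleftrightarrow> \<lfloor>3 * x\<rfloor> - t \<in> {0, A, B}" for x and t :: int
  proof -
    have "x \<in> (\<lambda>y. y + real_of_int t / 3) ` \<Omega> \<longleftrightarrow> x - real_of_int t / 3 \<in> \<Omega>" by force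
    moreover have "\<lfloor>3 * (x - real_of_int t / 3)\<rfloor> = \<lfloor>3 * x\<rfloor> - t"
    proof -
      have "3 * (x - real_of_int t / 3) = 3 * x - real_of_int t" by simp
      then show ?thesis by simp
    qed
    ultimately show ?thesis by (simp add: \<Omega>)
  qed
  show ?thesis unfolding tiles_by_translations_def
  proof (intro exI[of _ T] conjI ballI impI)
    fix s t assume "s \<in> T" "t \<in> T" "s \<noteq> t"
    then obtain i j where ij: "i \<in> Z" "j \<in> Z" "i \<noteq> j" "s = real_of_int i / 3" "t = real_of_int j / 3"
      by (auto simp: T_def)
    have "(\<lambda>x. x + s) ` \<Omega> \<inter> (\<lambda>x. x + t) ` \<Omega> = {}"
    proof (rule equals0I)
      fix x assume "x \<in> (\<lambda>x. x + s) ` \<Omega> \<inter> (\<lambda>x. x + t) ` \<Omega>"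
      then have "\<lfloor>3 * x\<rfloor> - i \<in> {0, A, B}" "\<lfloor>3 * x\<rfloor> - j \<in> {0, A, B}"
        unfolding Int_iff ij mem by blast+
      then show False using unique[of "\<lfloor>3 * x\<rfloor>"] ij by metis
    qed
    then show "negligible ((\<lambda>x. x + s) ` \<Omega> \<inter> (\<lambda>x. x + t) ` \<Omega>)" by simp
  next
    have "x \<in> (\<Union>t\<in>T. (\<lambda>y. y + t) ` \<Omega>)" for x
    proof -
      obtain t where t: "t \<in> Z" "\<lfloor>3 * x\<rfloor> - t \<in> {0, A, B}" using unique[of "\<lfloor>3 * x\<rfloor>"] by blast
      then have "x \<in> (\<lambda>y. y + real_of_int t / 3) ` \<Omega>" using mem by blast
      then show ?thesis using t(1) unfolding T_def by blast
    qed
    then have "- (\<Union>t\<in>T. (\<lambda>y. y + t) ` \<Omega>) = {}" by blast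
    then show "negligible (- (\<Union>t\<in>T. (\<lambda>x. x + t) ` \<Omega>))" by (simp only: negligible_empty)
  qed
qed

section \<open>The six endpoints of three intervals\<close>

lemma exhaust_6: "(x :: 6) = 1 \<or> x = 2 \<or> x = 3 \<or> x = 4 \<or> x = 5 \<or> x = 6"
proof (induct x)
  case (of_int z)
  then have "z = 0 \<or> z = 1 \<or> z = 2 \<or> z = 3 \<or> z = 4 \<or> z = 5" by fastforce
  then show ?case by auto
qed

lemma UNIV_6: "(UNIV :: 6 set) = {1, 2, 3, 4, 5, 6}"
  using exhaust_6 by blast

lemma sum_6: "sum f (UNIV :: 6 set) = f 1 + f 2 + f 3 + f 4 + f 5 + f 6"
  unfolding UNIV_6 by (simp add: add.assoc)

text \<open>The six listed positions are all positions, so listing them is a permutation.\<close>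

lemma antipodal_imp_Type1:
  assumes "antipodal (\<lambda>p. \<alpha> $ p)"
  shows "Type1 \<alpha>"
proof -
  obtain a b c d e f where dist: "distinct [a, b, c, d, e, f]"
    and s: "\<alpha> $ a + \<alpha> $ b = 0" "\<alpha> $ c + \<alpha> $ d = 0" "\<alpha> $ e + \<alpha> $ f = 0"
    using assms by (auto simp: antipodal_def)
  define \<sigma> :: "6 \<Rightarrow> 6" where
    "\<sigma> i = (if i = 1 then a else if i = 2 then b else if i = 3 then c else if i = 4 then d else if i = 5 then e else f)" for i
  have \<sigma>: "\<sigma> 1 = a" "\<sigma> 2 = b" "\<sigma> 3 = c" "\<sigma> 4 = d" "\<sigma> 5 = e" "\<sigma> 6 = f" by (simp_all add: \<sigma>_def)
  have "range \<sigma> = {a, b, c, d, e, f}" unfolding UNIV_6 by (simp add: \<sigma>)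
  then have c6: "card (range \<sigma>) = card (UNIV :: 6 set)" using dist by simp
  then have "inj \<sigma>" by (intro eq_card_imp_inj_on) simp_all
  moreover have "range \<sigma> = UNIV" using c6 by (intro card_subset_eq) simp_all
  ultimately have "\<sigma> permutes UNIV" by (intro bij_imp_permutes) (simp_all add: bij_betw_def)
  then show ?thesis using s \<sigma> unfolding Type1_def by metis
qed

definition endpoint :: "(nat \<Rightarrow> real) \<Rightarrow> (nat \<Rightarrow> real) \<Rightarrow> 6 \<Rightarrow> real" where
  "endpoint a r p = (if p = 1 then a 1 + r 1 else if p = 2 then a 1 else if p = 3 then a 2 + r 2
     else if p = 4 then a 2 else if p = 5 then a 3 + r 3 else a 3)"

lemma endpoint_simps:
  "endpoint a r 1 = a 1 + r 1" "endpoint a r 2 = a 1" "endpoint a r 3 = a 2 + r 2"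
  "endpoint a r 4 = a 2" "endpoint a r 5 = a 3 + r 3" "endpoint a r 6 = a 3"
  by (simp_all add: endpoint_def)

lemma end_sign_simps: "end_sign 1 = 1" "end_sign 2 = - 1" "end_sign 3 = 1" "end_sign 4 = - 1" "end_sign 5 = 1" "end_sign 6 = - 1"
  by (simp_all add: end_sign_def)

lemma endpoint_vec_nth: "endpoint_vec a r l $ p = end_sign p * ee (l * endpoint a r p)"
proof -
  have v: "(vector [x1, x2, x3, x4, x5, x6] :: complex^6) $ 1 = x1"
    "(vector [x1, x2, x3, x4, x5, x6] :: complex^6) $ 2 = x2"
    "(vector [x1, x2, x3, x4, x5, x6] :: complex^6) $ 3 = x3"
    "(vector [x1, x2, x3, x4, x5, x6] :: complex^6) $ 4 = x4"
    "(vector [x1, x2, x3, x4, x5, x6] :: complex^6) $ 5 = x5"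
    "(vector [x1, x2, x3, x4, x5, x6] :: complex^6) $ 6 = x6" for x1 x2 x3 x4 x5 x6
    unfolding vector_def by simp_all
  show ?thesis
    using exhaust_6[of p] unfolding endpoint_vec_def Let_def exp_eq_ee
    by (elim disjE) (simp_all only: v endpoint_simps end_sign_simps mult_1 mult_minus1)
qed

section \<open>Spectra of three intervals\<close>

locale three_interval_spectrum =
  fixes a r :: "nat \<Rightarrow> real" and \<Omega> \<Lambda> :: "real set" and d :: nat
  assumes \<Omega>: "\<Omega> = {a 1..<a 1 + r 1} \<union> {a 2..<a 2 + r 2} \<union> {a 3..<a 3 + r 3}"
    and a1: "a 1 = 0"
    and r_pos: "r 1 > 0" "r 2 > 0" "r 3 > 0"
    and r_sum: "r 1 + r 2 + r 3 = 1"
    and gaps: "a 1 + r 1 < a 2" "a 2 + r 2 < a 3"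
    and spectrum: "is_spectrum \<Omega> \<Lambda>"
    and zero: "0 \<in> \<Lambda>"
    and d: "d > 0"
    and dL: "int_multiples (real d) \<subseteq> \<Lambda>"
    and lattice: "\<exists>\<theta>>0. \<Lambda> \<subseteq> int_multiples \<theta>"
    and type1: "\<And>l m. l \<in> \<Lambda> \<Longrightarrow> m \<in> \<Lambda> \<Longrightarrow> Type1 (endpoint_vec a r (l - m)) \<Longrightarrow> l - m \<in> int_multiples (real d)"
begin

abbreviation "c \<equiv> endpoint a r"

abbreviation "V l p \<equiv> end_sign p * ee (l * c p)"

lemma antipodal_imp_multiple:
  assumes "l \<in> \<Lambda>" "m \<in> \<Lambda>" "antipodal (V (l - m))"
  shows "l - m \<in> int_multiples (real d)"
  using type1[OF assms(1,2)] antipodal_imp_Type1[of "endpoint_vec a r (l - m)"] assms(3)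
  by (simp add: endpoint_vec_nth)

text \<open>Orthogonality of two exponentials, written out at the endpoints.\<close>

lemma sum_V:
  assumes "l \<in> \<Lambda>" "m \<in> \<Lambda>"
  shows "sum (V (l - m)) UNIV = 0"
proof (cases "l = m")
  case True
  then show ?thesis by (simp add: sum_6 end_sign_simps)
next
  case False
  have "\<Omega> = (\<Union>i\<in>{1, 2, 3 :: nat}. {a i..<a i + r i})" using \<Omega> by auto
  moreover have "disjoint_family_on (\<lambda>i. {a i..<a i + r i}) {1, 2, 3 :: nat}"
    using gaps r_pos by (auto simp: disjoint_family_on_def)
  ultimately have "(\<Sum>i\<in>{1, 2, 3 :: nat}. ee ((l - m) * (a i + r i)) - ee ((l - m) * a i)) = 0"
    using r_pos by (intro spectrum_endpoint_sum[OF spectrum assms False]) auto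
  then show ?thesis by (simp add: sum_6 end_sign_simps endpoint_simps algebra_simps)
qed

lemma \<Omega>_bounds: "\<Omega> \<subseteq> {0..<a 3 + r 3}"
  using \<Omega> a1 gaps r_pos by auto

lemma measure_\<Omega>: "measure lebesgue \<Omega> = 1"
proof -
  have eq: "\<Omega> = (\<Union>i\<in>{1, 2, 3 :: nat}. {a i..<a i + r i})" using \<Omega> by auto
  have "measure lebesgue (\<Union>i\<in>{1, 2, 3 :: nat}. {a i..<a i + r i})
      = (\<Sum>i\<in>{1, 2, 3 :: nat}. measure lebesgue {a i..<a i + r i})"
  proof (rule measure_UNION')
    show "pairwise (\<lambda>i j. disjnt {a i..<a i + r i} {a j..<a j + r j}) {1, 2, 3 :: nat}"
      using gaps r_pos by (auto simp: pairwise_def disjnt_def)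
    show "{a i..<a i + r i} \<in> lmeasurable" for i by (rule bounded_set_imp_lmeasurable) simp_all
  qed simp
  then show ?thesis using r_sum r_pos by (simp add: eq)
qed

lemma \<Omega>_right_open: "x \<in> \<Omega> \<Longrightarrow> \<exists>\<eta>>0. {x..<x + \<eta>} \<subseteq> \<Omega>"
  unfolding \<Omega>
proof (elim UnE)
  assume "x \<in> {a 1..<a 1 + r 1}"
  then show "\<exists>\<eta>>0. {x..<x + \<eta>} \<subseteq> {a 1..<a 1 + r 1} \<union> {a 2..<a 2 + r 2} \<union> {a 3..<a 3 + r 3}"
    by (intro exI[of _ "a 1 + r 1 - x"]) auto
next
  assume "x \<in> {a 2..<a 2 + r 2}"
  then show "\<exists>\<eta>>0. {x..<x + \<eta>} \<subseteq> {a 1..<a 1 + r 1} \<union> {a 2..<a 2 + r 2} \<union> {a 3..<a 3 + r 3}"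
    by (intro exI[of _ "a 2 + r 2 - x"]) auto
next
  assume "x \<in> {a 3..<a 3 + r 3}"
  then show "\<exists>\<eta>>0. {x..<x + \<eta>} \<subseteq> {a 1..<a 1 + r 1} \<union> {a 2..<a 2 + r 2} \<union> {a 3..<a 3 + r 3}"
    by (intro exI[of _ "a 3 + r 3 - x"]) auto
qed

lemma tiles_if_lattice:
  assumes "\<Lambda> \<subseteq> int_multiples (real d)"
  shows "tiles_by_translations \<Omega>"
proof -
  have "\<Lambda> = int_multiples (real d)" using assms dL by blast
  then show ?thesis
    using lattice_spectrum_tiles[OF _ d \<Omega>_bounds measure_\<Omega> \<Omega>_right_open] spectrum by simp
qed

text \<open>The endpoints congruent to $a_1 = 0$ modulo $1/d$ form a class $U$ whose coordinates of $v_l$ sum to $0$. At $l = 0$ this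
says that $U$ contains as many right as left endpoints, so it is not one of two triples, and every $v_l$ is of Type 1.\<close>

lemma tiles_if_endpoints_incongruent:
  assumes "\<exists>p. ee (real d * c p) \<noteq> 1"
  shows "tiles_by_translations \<Omega>"
proof (rule tiles_if_lattice, rule subsetI)
  fix l assume l: "l \<in> \<Lambda>"
  define U where "U = {p \<in> (UNIV :: 6 set). ee (real d * c p) = 1}"
  have U0: "sum (V l) U = 0" if l: "l \<in> \<Lambda>" for l
    unfolding U_def
  proof (rule vandermonde_class_sum)
    fix j :: nat
    have "- (real d * real j) \<in> \<Lambda>" using dL by (force simp: int_multiples_def intro: image_eqI[of _ _ "- int j"])
    from sum_V[OF l this] have "sum (V (l - - (real d * real j))) UNIV = 0" .
    moreover have "V (l - - (real d * real j)) p = V l p * ee (real d * c p) ^ j" for p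
      by (simp add: ee_power ee_add[symmetric] algebra_simps)
    ultimately show "(\<Sum>p\<in>UNIV. V l p * ee (real d * c p) ^ j) = 0" by (simp only:)
  qed simp
  have "2 \<in> U" by (simp add: U_def endpoint_simps a1 del: One_nat_def)
  then have Une: "U \<noteq> {}" "U \<noteq> UNIV" using assms by (auto simp: U_def)
  have "card U \<noteq> 3"
  proof
    assume "card U = 3"
    have "sum (V 0) U = of_nat (card (U \<inter> right_ends)) - of_nat (card (U - right_ends))"
      by (simp add: end_sign_right_ends sum.If_cases Diff_eq)
    then have "(of_nat (card (U \<inter> right_ends)) :: complex) = of_nat (card (U - right_ends))" using U0[OF zero] by simp
    then have "card (U \<inter> right_ends) = card (U - right_ends)" by (simp only: of_nat_eq_iff)
    then have "3 = 2 * card (U \<inter> right_ends)" using card_Int_Diff[of U right_ends] \<open>card U = 3\<close> by simp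
    then show False by presburger
  qed
  moreover have "antipodal (V l) \<or> two_triples (V l) U"
    using sum_V[OF l zero] Une U0[OF l] by (intro zero_subsum) (simp_all add: norm_mult)
  ultimately have "antipodal (V (l - 0))" by (auto simp: two_triples_def)
  then show "l \<in> int_multiples (real d)" using antipodal_imp_multiple[OF l zero] by simp
qed

context
  assumes cong: "\<And>p. ee (real d * c p) = 1"
begin

lemma int_endpoint: "real d * c p \<in> \<int>"
  using cong[of p] ee_eq_1_iff by blast

lemma ee_root_of_unity: "\<exists>N>0. \<forall>l\<in>\<Lambda>. \<forall>p. ee (l * c p) ^ N = 1"
proof -
  \<comment> \<open>\<open>d\<close> itself lies in the lattice, so \<open>\<Lambda>\<close> is contained in rational multiples of \<open>d\<close> with a common denominator\<close>
  obtain \<theta> where \<theta>: "\<theta> > 0" "\<Lambda> \<subseteq> int_multiples \<theta>" using lattice by blast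
  have "real d \<in> \<Lambda>" using dL by (force simp: int_multiples_def intro: image_eqI[of _ _ 1])
  then obtain n where n: "real d = \<theta> * of_int n" using \<theta> by (auto simp: int_multiples_def)
  then have n0: "n > 0" using d \<theta>(1) by (metis of_int_0_less_iff of_nat_0_less_iff zero_less_mult_pos)
  show ?thesis
  proof (intro exI[of _ "nat n"] conjI ballI allI)
    fix l p assume "l \<in> \<Lambda>"
    then obtain m where m: "l = \<theta> * of_int m" using \<theta> by (auto simp: int_multiples_def)
    have "real (nat n) * (l * c p) = of_int m * (real d * c p)"
      using n0 by (simp add: n m mult_ac)
    also have "\<dots> \<in> \<int>" using int_endpoint by simp
    finally show "ee (l * c p) ^ nat n = 1" by (simp add: ee_power ee_eq_1_iff)
  qed (use n0 in simp)
qed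

lemma no_four_classes:
  assumes L: "l1 \<in> \<Lambda>" "l2 \<in> \<Lambda>" "l3 \<in> \<Lambda>" "l4 \<in> \<Lambda>"
    and n: "l1 - l2 \<notin> int_multiples (real d)" "l1 - l3 \<notin> int_multiples (real d)" "l1 - l4 \<notin> int_multiples (real d)"
      "l2 - l3 \<notin> int_multiples (real d)" "l2 - l4 \<notin> int_multiples (real d)" "l3 - l4 \<notin> int_multiples (real d)"
  shows False
proof -
  define w where "w l p = ee (l * c p)" for l p
  have wV: "quotient (w l) (w m) = V (l - m)" for l m
    by (simp add: quotient_def w_def fun_eq_iff cnj_ee mult.assoc ee_add[symmetric] left_diff_distrib)
  have ad: "admissible (quotient (w l) (w m))" if "l \<in> \<Lambda>" "m \<in> \<Lambda>" "l - m \<notin> int_multiples (real d)" for l m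
    using that sum_V antipodal_imp_multiple unfolding admissible_def wV by (auto simp: norm_mult)
  obtain N where N: "N > 0" "\<And>l p. l \<in> \<Lambda> \<Longrightarrow> w l p ^ N = 1"
    using ee_root_of_unity unfolding w_def by blast
  show False
  proof (rule no_four_pairwise_admissible[of "w l1" "w l2" "w l3" "w l4" N])
    show "cmod (v p) = 1" if "v \<in> {w l1, w l2, w l3, w l4}" for v p
      using that by (auto simp: w_def)
    show "v p ^ N = 1" if "v \<in> {w l1, w l2, w l3, w l4}" for v p
      using that N(2) L by auto
  qed (use ad L n N(1) in blast)+
qed

lemma three_classes:
  obtains l1 l2 l3 where "l1 \<in> \<Lambda>" "l2 \<in> \<Lambda>" "l3 \<in> \<Lambda>"
    "\<And>l. l \<in> \<Lambda> \<Longrightarrow> l - l1 \<in> int_multiples (real d) \<or> l - l2 \<in> int_multiples (real d) \<or> l - l3 \<in> int_multiples (real d)"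
proof -
  let ?D = "int_multiples (real d)"
  show ?thesis
  proof (cases "\<forall>l\<in>\<Lambda>. l - 0 \<in> ?D")
    case True
    then show ?thesis using that[of 0 0 0] zero by blast
  next
    case False
    then obtain l2 where l2: "l2 \<in> \<Lambda>" "l2 - 0 \<notin> ?D" by blast
    show ?thesis
    proof (cases "\<forall>l\<in>\<Lambda>. l - 0 \<in> ?D \<or> l - l2 \<in> ?D")
      case True
      then show ?thesis using that[of 0 l2 l2] zero l2 by blast
    next
      case False
      then obtain l3 where l3: "l3 \<in> \<Lambda>" "l3 - 0 \<notin> ?D" "l3 - l2 \<notin> ?D" by blast
      have "l - 0 \<in> ?D \<or> l - l2 \<in> ?D \<or> l - l3 \<in> ?D" if "l \<in> \<Lambda>" for l
        using no_four_classes[of l l3 l2 0] that l2 l3 zero by blast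
      then show ?thesis using that[of 0 l2 l3] zero l2 l3 by blast
    qed
  qed
qed

text \<open>Four unknown weights and, because $l$ matters only modulo $d\mathbb{Z}$, three linear equations. The matrix is made square by
repeating the last equation.\<close>

lemma exists_orthogonal_weights:
  fixes h :: "4 \<Rightarrow> real"
  assumes h: "\<And>k. real d * h k \<in> \<int>"
  shows "\<exists>x. x \<noteq> (0 :: complex^4) \<and> (\<forall>l\<in>\<Lambda>. (\<Sum>k\<in>UNIV. x $ k * ee (- (l * h k))) = 0)"
proof -
  obtain l1 l2 l3 where L: "l1 \<in> \<Lambda>" "l2 \<in> \<Lambda>" "l3 \<in> \<Lambda>"
    and cls: "\<And>l. l \<in> \<Lambda> \<Longrightarrow> l - l1 \<in> int_multiples (real d) \<or> l - l2 \<in> int_multiples (real d) \<or> l - l3 \<in> int_multiples (real d)"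
    using three_classes by blast
  define t :: "4 \<Rightarrow> real" where "t i = (if i = 1 then l1 else if i = 2 then l2 else l3)" for i
  define M :: "complex^4^4" where "M = (\<chi> i k. ee (- (t i * h k)))"
  have "row 3 M = row 4 M" by (simp add: row_def M_def t_def)
  then have "det M = 0" by (intro det_identical_rows[of 3 4]) simp_all
  then obtain x where x: "x \<noteq> 0" "M *v x = 0"
    using invertible_det_nz[of M] invertible_left_inverse[of M] matrix_left_invertible_ker[of M] by blast
  have sol: "(\<Sum>k\<in>UNIV. x $ k * ee (- (t i * h k))) = 0" for i
  proof -
    have "(M *v x) $ i = 0" using x by simp
    then show ?thesis by (simp add: matrix_vector_mult_def M_def mult.commute)
  qed
  have "(\<Sum>k\<in>UNIV. x $ k * ee (- (l * h k))) = 0" if l: "l \<in> \<Lambda>" for l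
  proof -
    have "l - t 1 \<in> int_multiples (real d) \<or> l - t 2 \<in> int_multiples (real d) \<or> l - t 3 \<in> int_multiples (real d)"
      using cls[OF l] by (simp add: t_def)
    then obtain i where "l - t i \<in> int_multiples (real d)" by blast
    then obtain n where n: "l - t i = real d * of_int n" by (auto simp: int_multiples_def)
    have "ee (- (l * h k)) = ee (- (t i * h k))" for k
    proof -
      have "- (l * h k) = - (t i * h k) + of_int (- n) * (real d * h k)"
        using n by (simp add: algebra_simps)
      moreover have "ee (of_int (- n) * (real d * h k)) = 1"
        using h[of k] by (auto simp: ee_eq_1_iff)
      ultimately show ?thesis by (simp only: ee_add) simp
    qed
    then show ?thesis using sol[of i] by simp
  qed
  then show ?thesis using x(1) by blast
qed

text \<open>Otherwise one interval contains two cells of length $1/d$. Together with the first cells of the other intervals these are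
four disjoint cells in $\Omega$, and weights orthogonal to all exponentials contradict completeness.\<close>

lemma interval_length:
  assumes j: "j \<in> {1, 2, 3}"
  shows "r j = 1 / d"
proof -
  have dr: "real d * r i \<in> \<int>" "real d * a i \<in> \<int>" if "i \<in> {1, 2, 3}" for i
  proof -
    have "real d * (a i + r i) - real d * a i \<in> \<int>" "real d * a i \<in> \<int>"
      using that int_endpoint[of 1] int_endpoint[of 2] int_endpoint[of 3] int_endpoint[of 4] int_endpoint[of 5] int_endpoint[of 6]
      by (auto simp: endpoint_simps intro!: Ints_diff)
    then show "real d * r i \<in> \<int>" "real d * a i \<in> \<int>" by (simp_all add: distrib_left)
  qed
  have ge: "1 / d \<le> r i" if i: "i \<in> {1, 2, 3}" for i
  proof -
    have "real d * r i > 0" using i r_pos d by auto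
    moreover obtain n where "real d * r i = of_int n" using dr(1)[OF i] by (auto elim: Ints_cases)
    ultimately have "real d * r i \<ge> 1" by simp
    then show ?thesis using d by (simp add: field_simps)
  qed
  show ?thesis
  proof (rule ccontr)
    assume ne: "r j \<noteq> 1 / d"
    obtain n where n: "real d * r j = of_int n" using dr(1)[OF j] by (auto elim: Ints_cases)
    have "n \<noteq> 1"
    proof
      assume "n = 1"
      then show False using ne n d by (simp add: field_simps)
    qed
    moreover have "of_int n \<ge> (1 :: real)" using ge[OF j] n d by (simp add: field_simps)
    ultimately have "n \<ge> 2" by simp
    then have "real d * r j \<ge> 2" using n by simp
    then have two: "a j + 1 / d + 1 / d \<le> a j + r j" using d by (simp add: field_simps)
    define h :: "4 \<Rightarrow> real" where "h k = (if k = 1 then a 1 else if k = 2 then a 2 else if k = 3 then a 3 else a j + 1 / d)" for k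
    have h: "h 1 = a 1" "h 2 = a 2" "h 3 = a 3" "h 4 = a j + 1 / d" by (simp_all add: h_def)
    have "real d * h k \<in> \<int>" for k
      using exhaust_4[of k] dr(2)[of 1] dr(2)[of 2] dr(2)[of 3] dr(2)[OF j] d
      by (elim disjE) (simp_all add: h distrib_left)
    then obtain x where x: "x \<noteq> (0 :: complex^4)" "\<And>l. l \<in> \<Lambda> \<Longrightarrow> (\<Sum>k\<in>UNIV. x $ k * ee (- (l * h k))) = 0"
      using exists_orthogonal_weights by blast
    have e: "1 / real d > 0" using d by simp
    have sep: "h 1 + 1 / real d \<le> h 2" "h 1 + 1 / real d \<le> h 3" "h 2 + 1 / real d \<le> h 3"
      using ge[of 1] ge[of 2] gaps r_pos by (simp_all add: h)
    have sep4: "h 1 + 1 / real d \<le> h 4 \<or> h 4 + 1 / real d \<le> h 1"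
      "h 2 + 1 / real d \<le> h 4 \<or> h 4 + 1 / real d \<le> h 2"
      "h 3 + 1 / real d \<le> h 4 \<or> h 4 + 1 / real d \<le> h 3"
    proof -
      from j consider "j = 1" | "j = 2" | "j = 3" by blast
      then have "h 1 + 1 / real d \<le> h 4 \<and> (h 2 + 1 / real d \<le> h 4 \<or> h 4 + 1 / real d \<le> h 2) \<and>
          (h 3 + 1 / real d \<le> h 4 \<or> h 4 + 1 / real d \<le> h 3)"
      proof cases
        case 1
        have "h 1 + 1 / real d \<le> h 4" "h 4 + 1 / real d \<le> h 2" "h 4 + 1 / real d \<le> h 3"
          using two[unfolded 1] gaps r_pos e unfolding h 1 by linarith+
        then show ?thesis by blast
      next
        case 2
        have "h 1 + 1 / real d \<le> h 4" "h 2 + 1 / real d \<le> h 4" "h 4 + 1 / real d \<le> h 3"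
          using two[unfolded 2] gaps r_pos e sep unfolding h 2 by linarith+
        then show ?thesis by blast
      next
        case 3
        have "h 1 + 1 / real d \<le> h 4" "h 2 + 1 / real d \<le> h 4" "h 3 + 1 / real d \<le> h 4"
          using e sep unfolding h 3 by linarith+
        then show ?thesis by blast
      qed
      then show "h 1 + 1 / real d \<le> h 4 \<or> h 4 + 1 / real d \<le> h 1"
        "h 2 + 1 / real d \<le> h 4 \<or> h 4 + 1 / real d \<le> h 2"
        "h 3 + 1 / real d \<le> h 4 \<or> h 4 + 1 / real d \<le> h 3" by blast+
    qed
    have "x $ k = 0" for k
    proof (rule step_function_null[OF spectrum, where K = UNIV and \<eta> = "1 / d" and p = 0 and h = h])
      show "{0 + h k..<0 + h k + 1 / real d} \<subseteq> \<Omega>" for k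
      proof -
        have "\<exists>i\<in>{1, 2, 3}. a i \<le> h k \<and> h k + 1 / real d \<le> a i + r i"
        proof (cases "k = 4")
          case True
          then show ?thesis using j two e h by (intro bexI[of _ j]) auto
        next
          case False
          then have "k = 1 \<or> k = 2 \<or> k = 3" using exhaust_4[of k] by blast
          then have "\<exists>i\<in>{1, 2, 3}. h k = a i" using h by blast
          then obtain i where i: "i \<in> {1, 2, 3}" "h k = a i" by blast
          show ?thesis using ge[OF i(1)] by (intro bexI[OF _ i(1)]) (simp add: i(2))
        qed
        then obtain i where i: "i \<in> {1, 2, 3}" "a i \<le> h k" "h k + 1 / real d \<le> a i + r i" by blast
        have "{0 + h k..<0 + h k + 1 / real d} \<subseteq> {a i..<a i + r i}" using i(2,3) by auto
        moreover have "{a i..<a i + r i} \<subseteq> \<Omega>"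
          using i(1) unfolding \<Omega> by (elim insertE emptyE; simp only:; blast)
        ultimately show ?thesis by blast
      qed
      show "{0 + h k..<0 + h k + 1 / real d} \<inter> {0 + h l..<0 + h l + 1 / real d} = {}" if "k \<noteq> l" for k l
      proof -
        have "h k + 1 / real d \<le> h l \<or> h l + 1 / real d \<le> h k"
          using that exhaust_4[of k] exhaust_4[of l] sep sep4 by metis
        then show ?thesis by auto
      qed
    qed (use x(2) e in auto)
    then show False using x(1) by (simp add: vec_eq_iff)
  qed
qed

lemma tiles_if_endpoints_congruent: "tiles_by_translations \<Omega>"
proof (cases "\<Lambda> \<subseteq> int_multiples (real d)")
  case True
  then show ?thesis by (rule tiles_if_lattice)
next
  case False
  then obtain l where l: "l \<in> \<Lambda>" "l \<notin> int_multiples (real d)" by blast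
  have "3 / real d = 1" using r_sum interval_length[of 1] interval_length[of 2] interval_length[of 3] by simp
  then have d3: "real d = 3" using d by (simp add: field_simps)
  have r: "r 1 = 1 / 3" "r 2 = 1 / 3" "r 3 = 1 / 3"
    using interval_length[of 1] interval_length[of 2] interval_length[of 3] d3 by simp_all
  have "3 * a 2 \<in> \<int>" "3 * a 3 \<in> \<int>"
    using int_endpoint[of 4] int_endpoint[of 6] by (simp_all add: endpoint_simps d3)
  then obtain A B where "3 * a 2 = of_int A" "3 * a 3 = of_int B" by (elim Ints_cases) blast
  then have AB: "a 2 = of_int A / 3" "a 3 = of_int B / 3" by simp_all
  have sumV: "sum (V l) UNIV = 0" using sum_V[OF l(1) zero] by simp
  have e: "ee (l * (x + 1 / 3)) = ee (l / 3) * ee (l * x)" for x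
    by (simp add: ee_add[symmetric] algebra_simps)
  have "sum (V l) UNIV = (ee (l / 3) - 1) * (1 + ee (l * a 2) + ee (l * a 3))"
    by (simp only: sum_6 end_sign_simps endpoint_simps r a1 e) (simp add: algebra_simps)
  then have prod0: "(ee (l / 3) - 1) * (1 + ee (l * a 2) + ee (l * a 3)) = 0" using sumV by simp
  have "ee (l / 3) \<noteq> 1"
  proof
    assume 1: "ee (l / 3) = 1"
    have "V l 1 + V l 2 = 0" "V l 3 + V l 4 = 0" "V l 5 + V l 6 = 0"
      by (simp_all only: end_sign_simps endpoint_simps r a1 e 1) simp_all
    then have "antipodal (V (l - 0))" using antipodalI[of 1 2 3 4 5 6 "V l"] by simp
    then show False using antipodal_imp_multiple[OF l(1) zero] l(2) by simp
  qed
  then have s: "1 + ee (l * a 2) + ee (l * a 3) = 0" using prod0 by simp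
  have tri: "1 * 1 = ee (l * a 2) * ee (l * a 3)" "1 ^ 3 = ee (l * a 2) ^ 3" "1 \<noteq> ee (l * a 2)"
    using unimodular_zero_sum_triple(1-3)[OF _ _ _ s] by simp_all
  have tri': "1 \<noteq> ee (l * a 3)" "1 ^ 3 = ee (l * a 3) ^ 3"
    using unimodular_zero_sum_triple(2,3)[of 1 "ee (l * a 3)" "ee (l * a 2)"] s by (simp_all add: add_ac)
  have "3 * (l * a 2) \<in> \<int>" "3 * (l * a 3) \<in> \<int>"
    using tri(2) tri'(2) by (simp_all add: ee_power ee_eq_1_iff[symmetric])
  then obtain j j' where j: "l * of_int A = of_int j" "l * of_int B = of_int j'"
    by (auto simp: AB elim!: Ints_cases)
  have int3: "of_int i / 3 \<in> (\<int> :: real set) \<longleftrightarrow> 3 dvd i" for i :: int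
  proof
    assume "of_int i / 3 \<in> (\<int> :: real set)"
    then obtain k where "of_int i / 3 = (of_int k :: real)" by (auto elim: Ints_cases)
    then have "(of_int i :: real) = of_int (3 * k)" by simp
    then have "i = 3 * k" by (simp only: of_int_eq_iff)
    then show "3 dvd i" by simp
  next
    assume "3 dvd i"
    then show "of_int i / 3 \<in> (\<int> :: real set)" by (auto simp: dvd_def)
  qed
  have la: "l * a 2 = of_int j / 3" "l * a 3 = of_int j' / 3" using j by (simp_all add: AB)
  have nd: "\<not> 3 dvd j" "\<not> 3 dvd j'" using tri(3) tri'(1) ee_eq_1_iff int3 unfolding la by metis+
  have "ee (of_int (j + j') / 3) = 1"
    using tri(1) by (simp add: la ee_add[symmetric] add_divide_distrib)
  then have dj: "3 dvd j + j'" using ee_eq_1_iff int3 by metis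
  have "real_of_int (A * j') = real_of_int (B * j)"
    unfolding of_int_mult j[symmetric] by simp
  then have cross: "A * j' = B * j" by (simp only: of_int_eq_iff)
  have "A \<noteq> 0" using gaps a1 r AB by auto
  moreover have "\<Omega> = {x. \<lfloor>3 * x\<rfloor> \<in> {0, A, B}}"
  proof -
    have cell: "{x. \<lfloor>3 * x\<rfloor> = i} = {of_int i / 3..<of_int i / 3 + 1 / 3}" for i :: int
      by (auto simp: floor_eq_iff)
    have "\<Omega> = {x. \<lfloor>3 * x\<rfloor> = 0} \<union> {x. \<lfloor>3 * x\<rfloor> = A} \<union> {x. \<lfloor>3 * x\<rfloor> = B}"
      unfolding \<Omega> cell AB r a1 by simp
    then show ?thesis by auto
  qed
  ultimately show ?thesis using three_cells_tile nd dj cross by blast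
qed

end

theorem tiles: "tiles_by_translations \<Omega>"
  using tiles_if_endpoints_incongruent tiles_if_endpoints_congruent by blast

end

theorem mainTheorem7:
  fixes a r :: "nat \<Rightarrow> real" and \<Omega> \<Lambda> :: "real set" and d :: nat
  assumes "\<Omega> = {a 1..<a 1 + r 1} \<union> {a 2..<a 2 + r 2} \<union> {a 3..<a 3 + r 3}"
    and "a 1 = 0"
    and "\<forall>j\<in>{1,2,3}. r j > 0"
    and "r 1 + r 2 + r 3 = 1"
    and "\<forall>j\<in>{1,2}. a j + r j < a (j + 1)"
    and "is_spectrum \<Omega> \<Lambda>"
    and "0 \<in> \<Lambda>"
    and "d > 0"
    and "int_multiples (real d) \<subseteq> \<Lambda>"
    and "\<forall>d'::nat. d' > 0 \<and> int_multiples (real d') \<subseteq> \<Lambda> \<longrightarrow> d \<le> d'"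
    and "\<exists>\<theta>>0. \<Lambda> \<subseteq> int_multiples \<theta>"
    and "\<forall>l1\<in>\<Lambda>. \<forall>l2\<in>\<Lambda>.
           Type1 (endpoint_vec a r (l1 - l2)) \<longleftrightarrow> l1 - l2 \<in> int_multiples (real d)"
  shows "tiles_by_translations \<Omega>"
proof -
  have gaps: "a 1 + r 1 < a 2" "a 2 + r 2 < a 3"
    using bspec[OF assms(5), of 1] bspec[OF assms(5), of 2] by (simp_all add: numeral_eq_Suc)
  interpret three_interval_spectrum a r \<Omega> \<Lambda> d
    using assms gaps by unfold_locales auto
  show ?thesis by (rule tiles)
qed

end
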